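(* For every $\alpha>0$ and every integer $q\geq0$ there exist $n_q\geq1$ and a constant $K_q>0$ such that the densities $G_{\sigma;j}(\mathbf{x})$, $G_{\sigma;j,l;\tau}(\mathbf{x})$, and $G_{\sigma,n;j}(\mathbf{x})$, $G_{\sigma,n;j,l;\tau}(\mathbf{x})$ for $n\geq n_q$, together with all their partial derivatives of order $\leq q$, are bounded in absolute value by $K_q\exp(-\alpha\|\mathbf{x}\|^2)$ for all $\mathbf{x}\in\mathbb{C}^N$, every $\sigma\geq1$, $j,l\in\{1,\ldots,N\}$, $j\neq l$, and $\tau\in\{\pm1,\pm i\}$.
   Context: Setting: $N\geq1$ and $F_1,\ldots,F_N$ orthogonal functions satisfying (I) $F(s)=\sum_{n\geq1}a_F(n)n^{-s}$ absolutely convergent for $\sigma>1$, and (II) $\log F(s)=\sum_p\sum_{k\geq1}b_F(p^k)p^{-ks}$ absolutely convergent for $\sigma>1$ with $|b_F(p^k)|\ll p^{k\theta}$ for some $\theta<\frac12$; orthogonality means $\sum_{p\leq x}a_{F_i}(p)\overline{a_{F_j}(p)}/p=(m_{i,j}+o(1))\log\log x$ with $m_{i,i}>0$, $m_{i,j}=0$ for $i\neq j$. Local factors $\log F_{j,p}(s)=\sum_{k\geq1}b_{F_j}(p^k)p^{-ks}$; $p_m$ the $m$-th prime; for $\boldsymbol\theta\in[0,1]^n$, $s_m=\sigma+2\pi i\theta_m/\log p_m$, $\log F_{j,n}(\sigma,\boldsymbol\theta)=\sum_{m\leq n}\log F_{j,p_m}(s_m)$, $\frac{F'_{j,n}}{F_{j,n}}(\sigma,\boldsymbol\theta)=\sum_{m\leq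 n}\frac{F'_{j,p_m}}{F_{j,p_m}}(s_m)$, $\mathbf{\log F}_n=(\log F_{1,n},\ldots,\log F_{N,n})$. For Borel $\mathbf{E}\subseteq\mathbb{C}^N$, with $W_n=\{\boldsymbol\theta\in[0,1)^n:\mathbf{\log F}_n(\sigma,\boldsymbol\theta)\in\mathbf{E}\}$: $\boldsymbol\lambda_{\sigma,n;j}(\mathbf{E})=\int_{W_n}|\frac{F'_{j,n}}{F_{j,n}}|^2d\boldsymbol\theta$ and $\boldsymbol\lambda_{\sigma,n;j,l;\tau}(\mathbf{E})=\int_{W_n}|\frac{F'_{j,n}}{F_{j,n}}+\tau\frac{F'_{l,n}}{F_{l,n}}|^2d\boldsymbol\theta$ ($j\neq l$, $\tau\in\{\pm1,\pm i\}$). It is known (established in the paper) that for $n$ large these measures are absolutely continuous with continuous densities $G_{\sigma,n;j}$, $G_{\sigma,n;j,l;\tau}$ (of class $\mathcal{C}^q$ for $n$ large depending on $q$), and that as $n\to\infty$ they converge weakly to absolutely continuous measures $\boldsymbol\lambda_{\sigma;j}$, $\boldsymbol\lambda_{\sigma;j,l;\tau}$ with $\mathcal{C}^\infty$ densities $G_{\sigma;j}$, $G_{\sigma;j,l;\tau}$, for all $\sigma\geq1$. $\|\cdot\|$ is the Euclidean norm.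
   Formalization: The constant K_q is uniform only for σ in each bounded range [1,σ_0] (n_q is uniform for all σ≥1); uniformity over all σ≥1 fails, e.g. for N=1, F=ζ, q=1, where the support shrinks like 2^{-σ} while the mass is at least (log 2)^2 4^{-σ}. *)

theory Defs
  imports "HOL-Analysis.Analysis" "HOL-Computational_Algebra.Primes"
begin

section \<open>Orthogonal families of Euler products\<close>

definition abs_conv_dirichlet :: "(nat \<Rightarrow> complex) \<Rightarrow> (complex \<Rightarrow> complex) \<Rightarrow> bool" where
  "abs_conv_dirichlet a F \<longleftrightarrow>
     (\<forall>s. Re s > 1 \<longrightarrow>
        (\<lambda>n. norm (a n * of_nat n powr (- s))) summable_on {1..} \<and>
        ((\<lambda>n. a n * of_nat n powr (- s)) has_sum F s) {1..})"

text \<open>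
  The coefficients are indexed by natural numbers, but only the values of \<open>b\<close> at prime powers
  are used. That the double series is ``the'' logarithm of \<open>F\<close> means that its exponential
  is \<open>F\<close>; it tends to \<open>0\<close> as \<open>Re s\<close> tends to infinity, which fixes the branch.
\<close>

definition abs_conv_euler_log :: "(nat \<Rightarrow> complex) \<Rightarrow> (complex \<Rightarrow> complex) \<Rightarrow> bool" where
  "abs_conv_euler_log b F \<longleftrightarrow>
     (\<forall>s. Re s > 1 \<longrightarrow>
        (\<lambda>(p, k). norm (b (p ^ k) * of_nat p powr (- (of_nat k * s))))
           summable_on ({p. prime p} \<times> {1..}) \<and>
        F s = exp (\<Sum>\<^sub>\<infinity>(p, k)\<in>{p. prime p} \<times> {1..}. b (p ^ k) * of_nat p powr (- (of_nat k * s))))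
   \<and> (\<exists>\<theta> C :: real. \<theta> < 1 / 2 \<and>
        (\<forall>p k. prime p \<longrightarrow> k \<ge> 1 \<longrightarrow> norm (b (p ^ k)) \<le> C * real p powr (real k * \<theta>)))"

definition orthogonal_coeffs :: "('n \<Rightarrow> nat \<Rightarrow> complex) \<Rightarrow> bool" where
  "orthogonal_coeffs a \<longleftrightarrow>
     (\<exists>m :: 'n \<Rightarrow> 'n \<Rightarrow> real.
        (\<forall>i. m i i > 0) \<and> (\<forall>i j. i \<noteq> j \<longrightarrow> m i j = 0) \<and>
        (\<forall>i j. ((\<lambda>x :: real. (\<Sum>p | prime p \<and> real p \<le> x. a i p * cnj (a j p) / of_nat p)
                              / of_real (ln (ln x))) \<longlongrightarrow> of_real (m i j)) at_top))"

section \<open>Truncated Euler products on the torus\<close>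

definition log_local :: "(nat \<Rightarrow> complex) \<Rightarrow> nat \<Rightarrow> complex \<Rightarrow> complex" where
  "log_local b p s = (\<Sum>k. b (p ^ Suc k) * of_nat p powr (- (of_nat (Suc k) * s)))"

definition local_factor :: "(nat \<Rightarrow> complex) \<Rightarrow> nat \<Rightarrow> complex \<Rightarrow> complex" where
  "local_factor b p s = exp (log_local b p s)"

definition nth_prime :: "nat \<Rightarrow> nat" where
  "nth_prime m = enumerate {p. prime p} m"

text \<open>
  Indices of primes and of torus coordinates start at \<open>0\<close>, so the first \<open>n\<close> primes
  are \<open>nth_prime m\<close> for \<open>m < n\<close>.
\<close>

definition shifted_point :: "real \<Rightarrow> (nat \<Rightarrow> real) \<Rightarrow> nat \<Rightarrow> complex" where
  "shifted_point \<sigma> t m = of_real \<sigma> + 2 * of_real pi * \<i> * of_real (t m) / of_real (ln (real (nth_prime m)))"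

definition log_trunc :: "(nat \<Rightarrow> complex) \<Rightarrow> nat \<Rightarrow> real \<Rightarrow> (nat \<Rightarrow> real) \<Rightarrow> complex" where
  "log_trunc b n \<sigma> t = (\<Sum>m<n. log_local b (nth_prime m) (shifted_point \<sigma> t m))"

definition logderiv_trunc :: "(nat \<Rightarrow> complex) \<Rightarrow> nat \<Rightarrow> real \<Rightarrow> (nat \<Rightarrow> real) \<Rightarrow> complex" where
  "logderiv_trunc b n \<sigma> t =
     (\<Sum>m<n. deriv (local_factor b (nth_prime m)) (shifted_point \<sigma> t m)
              / local_factor b (nth_prime m) (shifted_point \<sigma> t m))"

definition log_trunc_vec ::
  "('n::finite \<Rightarrow> nat \<Rightarrow> complex) \<Rightarrow> nat \<Rightarrow> real \<Rightarrow> (nat \<Rightarrow> real) \<Rightarrow> complex ^ 'n" where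
  "log_trunc_vec b n \<sigma> t = (\<chi> j. log_trunc (b j) n \<sigma> t)"

definition torus :: "nat \<Rightarrow> (nat \<Rightarrow> real) measure" where
  "torus n = (\<Pi>\<^sub>M m\<in>{..<n}. restrict_space lborel {0..<1})"

text \<open>
  A push-forward of a weighted measure: the value at a Borel set \<open>E\<close> is the integral of the
  weight over those points of the torus which \<open>log_trunc_vec b n \<sigma>\<close> maps into \<open>E\<close>.
\<close>

definition lambda_single ::
  "('n::finite \<Rightarrow> nat \<Rightarrow> complex) \<Rightarrow> real \<Rightarrow> nat \<Rightarrow> 'n \<Rightarrow> (complex ^ 'n) measure" where
  "lambda_single b \<sigma> n j =
     distr (density (torus n) (\<lambda>t. ennreal ((norm (logderiv_trunc (b j) n \<sigma> t))\<^sup>2)))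
       borel (log_trunc_vec b n \<sigma>)"

definition lambda_pair ::
  "('n::finite \<Rightarrow> nat \<Rightarrow> complex) \<Rightarrow> real \<Rightarrow> nat \<Rightarrow> 'n \<Rightarrow> 'n \<Rightarrow> complex \<Rightarrow> (complex ^ 'n) measure" where
  "lambda_pair b \<sigma> n j l \<tau> =
     distr (density (torus n)
              (\<lambda>t. ennreal ((norm (logderiv_trunc (b j) n \<sigma> t + \<tau> * logderiv_trunc (b l) n \<sigma> t))\<^sup>2)))
       borel (log_trunc_vec b n \<sigma>)"

section \<open>Densities, weak convergence, partial derivatives\<close>

text \<open>A continuous density with respect to Lebesgue measure is unique.\<close>

definition continuous_density :: "'a::euclidean_space measure \<Rightarrow> ('a \<Rightarrow> real) \<Rightarrow> bool" where
  "continuous_density M G \<longleftrightarrow>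
     continuous_on UNIV G \<and> (\<forall>x. 0 \<le> G x) \<and> M = density lborel (\<lambda>x. ennreal (G x))"

definition weakly_converges ::
  "(nat \<Rightarrow> 'a::topological_space measure) \<Rightarrow> 'a measure \<Rightarrow> bool" where
  "weakly_converges M L \<longleftrightarrow>
     sets L = sets borel \<and> finite_measure L \<and>
     (\<forall>f :: 'a \<Rightarrow> real. continuous_on UNIV f \<longrightarrow> bounded (range f) \<longrightarrow>
        (\<lambda>n. integral\<^sup>L (M n) f) \<longlonglongrightarrow> integral\<^sup>L L f)"

text \<open>
  Partial derivatives are taken along the standard real coordinates; for \<open>complex ^ 'n\<close> these are
  the real and imaginary parts of the components.
\<close>

definition partial_deriv :: "'a::euclidean_space \<Rightarrow> ('a \<Rightarrow> real) \<Rightarrow> 'a \<Rightarrow> real" where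
  "partial_deriv e f x = deriv (\<lambda>t :: real. f (x + t *\<^sub>R e)) 0"

primrec iter_partial :: "'a::euclidean_space list \<Rightarrow> ('a \<Rightarrow> real) \<Rightarrow> 'a \<Rightarrow> real" where
  "iter_partial [] f = f"
| "iter_partial (e # es) f = partial_deriv e (iter_partial es f)"

primrec C_k :: "nat \<Rightarrow> ('a::euclidean_space \<Rightarrow> real) \<Rightarrow> bool" where
  "C_k 0 f \<longleftrightarrow> continuous_on UNIV f"
| "C_k (Suc q) f \<longleftrightarrow> continuous_on UNIV f \<and>
     (\<forall>e\<in>Basis. (\<forall>x. (\<lambda>t :: real. f (x + t *\<^sub>R e)) differentiable (at 0)) \<and> C_k q (partial_deriv e f))"

definition partials_bounded ::
  "nat \<Rightarrow> real \<Rightarrow> real \<Rightarrow> ('a::euclidean_space \<Rightarrow> real) \<Rightarrow> bool" where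
  "partials_bounded q K \<alpha> G \<longleftrightarrow>
     (\<forall>es. set es \<subseteq> Basis \<and> length es \<le> q \<longrightarrow>
        (\<forall>x. \<bar>iter_partial es G x\<bar> \<le> K * exp (- \<alpha> * (norm x)\<^sup>2)))"

end

theory Submission
  imports Defs "HOL-Probability.Probability"
begin

text \<open>
  Write the truncated products as a random walk on the torus with independent mean-zero steps
  \<open>X\<^sub>m\<close> (the local logarithms) and \<open>g\<^sub>m\<close> (the local logarithmic derivatives), both of
  size at most \<open>\<epsilon>\<^sub>m\<close> with \<open>\<Sum> \<epsilon>\<^sub>m\<^sup>2 < \<infinity>\<close> uniformly in \<open>\<sigma> \<ge> 1\<close>. For a complex parameter \<open>B\<close> let
  \<open>M\<^sub>n(B)\<close> be the push-forward of \<open>\<bar>\<Sum> g\<^sub>m + B\<bar>\<^sup>2\<close> under \<open>\<Sum> X\<^sub>m\<close>. Its characteristic function is a sum of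
  products of one-dimensional integrals, and each prime at which the coefficient form in the direction
  \<open>y\<close> exceeds \<open>p powr (- \<eta>)\<close> contributes a factor \<open>O(\<bar>y\<bar> powr (- 1 / 2))\<close>. Orthogonality provides infinitely
  many such primes in every direction, so \<open>M\<^sub>n(B)\<close> has a density of class \<open>C\<^sup>q\<close> for large \<open>n\<close>.
  At the first such index the density has compact support. Adding one prime averages
  \<open>(B, x)\<close> over \<open>(B + g\<^sub>n, x - X\<^sub>n)\<close>, and since these are mean-zero steps with small total variance, this averaging
  preserves a bound \<open>exp (\<bar>B\<bar>\<^sup>2 - 2 \<alpha> \<bar>x\<bar>\<^sup>2)\<close> up to a bounded change of the exponents.
\<close>

section \<open>Gaussian integrals\<close>

text \<open>The constant K is chosen after an upper bound \<open>\<sigma>\<^sub>0\<close> for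
  \<sigma>, the starting index before it, because the laws shrink to the origin as \<sigma> grows.
  For one function and fixed n, let P be the least available prime power with nonzero coefficient
  and r = P^(-\<sigma>): the law lives on a disc of radius O(r) and has mass of order r^2, whereas
  bounded first derivatives would force mass O(r^3). So for q \<ge> 1 no constant can serve all
  \<sigma> \<ge> 1 in general. The condition \<theta> < 1/2 enters twice. It makes the squared step
  sizes summable, and it leaves the room \<eta> = (1 - 2 \<theta>)/2 by which the form at a prime
  may be small while the first harmonic still dominates the higher ones. Orthogonality concerns the
  Dirichlet coefficients \<open>a\<close>, the walk only the logarithmic coefficients
  \<open>b\<close>. Their agreement at primes has to be derived from the two representations of F.
  Averaging costs a little of the Gaussian exponent at every prime. The estimate therefore starts at
  exponent 2 \<alpha>, from an index after which the total loss is at most \<alpha>.\<close>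

lemma lborel_integral_prod:
  fixes f :: "'a::euclidean_space \<Rightarrow> real \<Rightarrow> 'b::{real_normed_field,banach,second_countable_topology}"
  assumes f: "\<And>b. b \<in> Basis \<Longrightarrow> integrable lborel (f b)"
  shows "integrable lborel (\<lambda>x. \<Prod>b\<in>Basis. f b (x \<bullet> b))"
    and "(\<integral>x. (\<Prod>b\<in>Basis. f b (x \<bullet> b)) \<partial>lborel) = (\<Prod>b\<in>Basis. (\<integral>x. f b x \<partial>lborel))"
proof -
  interpret product_sigma_finite "\<lambda>_::'a. lborel :: real measure" ..
  have [measurable]: "f b \<in> borel_measurable borel" if "b \<in> Basis" for b
    using f[OF that] by auto
  have eq: "(\<Prod>b\<in>Basis. f b ((\<Sum>c\<in>Basis. g c *\<^sub>R c) \<bullet> b)) = (\<Prod>b\<in>Basis. f b (g b))" for g :: "'a \<Rightarrow> real"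
    by (intro prod.cong refl) simp
  have m: "(\<lambda>x::'a. \<Prod>b\<in>Basis. f b (x \<bullet> b)) \<in> borel_measurable borel"
    by measurable
  have m2: "(\<lambda>g. \<Sum>b\<in>Basis. g b *\<^sub>R b) \<in> (\<Pi>\<^sub>M b\<in>(Basis::'a set). lborel) \<rightarrow>\<^sub>M borel"
    by measurable
  show "integrable lborel (\<lambda>x. \<Prod>b\<in>Basis. f b (x \<bullet> b))"
    apply (subst lborel_eq, subst integrable_distr_eq[OF m2 m], subst eq)
    by (intro product_integrable_prod f finite_Basis)
  show "(\<integral>x. (\<Prod>b\<in>Basis. f b (x \<bullet> b)) \<partial>lborel) = (\<Prod>b\<in>Basis. (\<integral>x. f b x \<partial>lborel))"
    apply (subst lborel_eq, subst integral_distr[OF m2 m], subst eq)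
    by (intro product_integral_prod f finite_Basis)
qed

lemma integrable_inverse_square:
  "integrable lborel (\<lambda>x::real. 1 / (1 + \<bar>x\<bar>)\<^sup>2)"
proof (rule Bochner_Integration.integrable_bound)
  show "integrable lborel (\<lambda>x::real. inverse (1 + x\<^sup>2))"
    using integrable_inverse_1_plus_square by (simp add: set_integrable_def)
  show "AE x in lborel. norm (1 / (1 + \<bar>x\<bar>)\<^sup>2) \<le> norm (inverse (1 + x\<^sup>2 :: real))"
  proof (intro AE_I2)
    fix x :: real
    have "1 + x\<^sup>2 \<le> (1 + \<bar>x\<bar>)\<^sup>2" by (simp add: power2_sum)
    then show "norm (1 / (1 + \<bar>x\<bar>)\<^sup>2) \<le> norm (inverse (1 + x\<^sup>2 :: real))"
      using divide_left_mono[of "1 + x\<^sup>2" "(1 + \<bar>x\<bar>)\<^sup>2" 1] by (simp add: inverse_eq_divide add_pos_nonneg zero_less_mult_iff)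
  qed
qed auto

text \<open>The exponent is generous on purpose:
  \<open>1 / (1 + \<bar>y \<bullet> b\<bar>)\<^sup>2\<close> is integrable in each coordinate, and
  the product of these factors dominates.\<close>

lemma integrable_inverse_norm_power:
  "integrable lborel (\<lambda>y::'a::euclidean_space. 1 / (1 + norm y) ^ (2 * DIM('a)))"
proof (rule Bochner_Integration.integrable_bound)
  show "integrable lborel (\<lambda>y::'a. \<Prod>b\<in>Basis. 1 / (1 + \<bar>y \<bullet> b\<bar>)\<^sup>2)"
    by (rule lborel_integral_prod(1)) (rule integrable_inverse_square)
  have "(\<Prod>b\<in>Basis. (1 + \<bar>y \<bullet> b\<bar>)\<^sup>2) \<le> (\<Prod>b\<in>(Basis::'a set). (1 + norm y)\<^sup>2)" for y :: 'a
    by (intro prod_mono) (auto intro!: power_mono simp: Basis_le_norm)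
  moreover have "(\<Prod>b\<in>Basis. (1 + \<bar>y \<bullet> b\<bar>)\<^sup>2) > 0" for y :: 'a
    by (intro prod_pos) (auto intro!: zero_less_power add_pos_nonneg)
  ultimately have "1 / (1 + norm y)\<^sup>2 ^ DIM('a) \<le> 1 / (\<Prod>b\<in>Basis. (1 + \<bar>y \<bullet> b\<bar>)\<^sup>2)" for y :: 'a
    by (intro divide_left_mono) (auto intro!: mult_pos_pos add_pos_nonneg zero_less_power)
  then have "norm (1 / (1 + norm y) ^ (2 * DIM('a))) \<le> norm (\<Prod>b\<in>Basis. 1 / (1 + \<bar>y \<bullet> b\<bar>)\<^sup>2 :: real)" for y :: 'a
    unfolding power_mult prod_dividef real_norm_def
    by (subst (1 2) abs_of_nonneg) (auto intro!: divide_nonneg_nonneg prod_nonneg)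
  then show "AE y in lborel. norm (1 / (1 + norm (y::'a)) ^ (2 * DIM('a)))
      \<le> norm (\<Prod>b\<in>Basis. 1 / (1 + \<bar>y \<bullet> b\<bar>)\<^sup>2 :: real)" by auto
qed measurable

lemma lborel_integral_affine:
  fixes f :: "'a::euclidean_space \<Rightarrow> 'b::{banach, second_countable_topology}"
  assumes [measurable]: "f \<in> borel_measurable borel" and s: "s > 0"
  shows "integrable lborel f \<longleftrightarrow> integrable lborel (\<lambda>z. f (u + s *\<^sub>R z))"
    and "(\<integral>x. f x \<partial>lborel) = s ^ DIM('a) *\<^sub>R (\<integral>z. f (u + s *\<^sub>R z) \<partial>lborel)"
proof -
  have e: "lborel = density (distr lborel borel (\<lambda>x::'a. u + s *\<^sub>R x)) (\<lambda>_. ennreal (s ^ DIM('a)))"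
    using lborel_affine[of s u] s by (simp add: ennreal_power)
  show "integrable lborel f \<longleftrightarrow> integrable lborel (\<lambda>z. f (u + s *\<^sub>R z))"
    using s apply (subst e)
    apply (subst integrable_density)
       apply (auto simp: integrable_distr_eq)
    using integrable_scaleR_right[of "inverse (s ^ DIM('a))" lborel "\<lambda>z. s ^ DIM('a) *\<^sub>R f (u + s *\<^sub>R z)"] by simp
  show "(\<integral>x. f x \<partial>lborel) = s ^ DIM('a) *\<^sub>R (\<integral>z. f (u + s *\<^sub>R z) \<partial>lborel)"
    using s by (subst e) (simp add: integral_density integral_distr)
qed

lemma gaussian_ft_1d:
  "integrable lborel (\<lambda>t. iexp (v * t) * of_real (exp (- t\<^sup>2 / 2)))"
  "(\<integral>t. iexp (v * t) * of_real (exp (- t\<^sup>2 / 2)) \<partial>lborel) = of_real (sqrt (2 * pi) * exp (- v\<^sup>2 / 2))"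
proof -
  have i: "integrable lborel (\<lambda>t. std_normal_density t *\<^sub>R iexp (v * t))"
    by (rule Bochner_Integration.integrable_bound[where f = std_normal_density])
       (auto intro!: AE_I2 simp: norm_mult)
  have e: "std_normal_density t *\<^sub>R iexp (v * t) * of_real (sqrt (2 * pi)) = iexp (v * t) * of_real (exp (- t\<^sup>2 / 2))" for t
    by (simp add: std_normal_density_def scaleR_conv_of_real)
  have "(\<integral>t. std_normal_density t *\<^sub>R iexp (v * t) \<partial>lborel) = exp (- v\<^sup>2 / 2)"
    using fun_cong[OF char_std_normal_distribution, of v]
    by (simp add: char_def integral_density)
  with i show "(\<integral>t. iexp (v * t) * of_real (exp (- t\<^sup>2 / 2)) \<partial>lborel) = of_real (sqrt (2 * pi) * exp (- v\<^sup>2 / 2))"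
    unfolding e[symmetric] by (subst Bochner_Integration.integral_mult_left) (auto simp: mult.commute)
  show "integrable lborel (\<lambda>t. iexp (v * t) * of_real (exp (- t\<^sup>2 / 2)))"
    unfolding e[symmetric] using i by (rule integrable_mult_left)
qed

lemma iexp_sum: "finite A \<Longrightarrow> iexp (\<Sum>a\<in>A. f a) = (\<Prod>a\<in>A. iexp (f a))"
  by (simp add: sum_distrib_left exp_sum)

lemma norm_power2_Basis: "(norm (z::'a::euclidean_space))\<^sup>2 = (\<Sum>b\<in>Basis. (z \<bullet> b)\<^sup>2)"
  by (metis (no_types, lifting) euclidean_inner power2_eq_square power2_norm_eq_inner sum.cong)

lemma gaussian_ft:
  fixes v :: "'a::euclidean_space"
  shows "integrable lborel (\<lambda>z. iexp (v \<bullet> z) * of_real (exp (- (norm z)\<^sup>2 / 2)))" (is ?A)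
    and "(\<integral>z. iexp (v \<bullet> z) * of_real (exp (- (norm z)\<^sup>2 / 2)) \<partial>lborel)
      = of_real (sqrt (2 * pi) ^ DIM('a) * exp (- (norm v)\<^sup>2 / 2))" (is ?B)
proof -
  have e: "iexp (v \<bullet> z) * of_real (exp (- (norm z)\<^sup>2 / 2))
      = (\<Prod>b\<in>Basis. iexp ((v \<bullet> b) * (z \<bullet> b)) * of_real (exp (- (z \<bullet> b)\<^sup>2 / 2)))" for z
    unfolding prod.distrib of_real_prod[symmetric] exp_sum[OF finite_Basis, symmetric]
      iexp_sum[OF finite_Basis, symmetric] euclidean_inner[of v z] norm_power2_Basis[of z]
    by (simp add: sum_negf sum_divide_distrib sum_distrib_left)
  show ?A unfolding e by (rule lborel_integral_prod(1)) (rule gaussian_ft_1d)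
  show ?B unfolding e
    apply (subst lborel_integral_prod(2))
     apply (rule gaussian_ft_1d)
    apply (simp only: gaussian_ft_1d of_real_prod[symmetric] prod.distrib exp_sum[OF finite_Basis, symmetric] norm_power2_Basis[of v])
    by (simp add: sum_negf sum_divide_distrib)
qed

definition gauss_kernel :: "real \<Rightarrow> 'a::euclidean_space \<Rightarrow> real" where
  "gauss_kernel s w = exp (- (norm w)\<^sup>2 / (2 * s\<^sup>2)) / (s * sqrt (2 * pi)) ^ DIM('a)"

text \<open>The kernel as an absolutely convergent Fourier integral, the form in which convolution
  with a measure can be exchanged with integration over frequencies.\<close>

lemma gauss_kernel_ft:
  fixes w :: "'a::euclidean_space"
  assumes s: "s > 0"
  shows "integrable lborel (\<lambda>y. iexp (w \<bullet> y) * of_real (exp (- s\<^sup>2 * (norm y)\<^sup>2 / 2)))" (is ?A)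
    and "of_real (gauss_kernel s w)
      = (\<integral>y. iexp (w \<bullet> y) * of_real (exp (- s\<^sup>2 * (norm y)\<^sup>2 / 2)) \<partial>lborel) / (2 * pi) ^ DIM('a)" (is ?B)
proof -
  let ?f = "\<lambda>z. iexp ((w /\<^sub>R s) \<bullet> z) * of_real (exp (- (norm z)\<^sup>2 / 2))"
  have e: "?f (0 + s *\<^sub>R y) = iexp (w \<bullet> y) * of_real (exp (- s\<^sup>2 * (norm y)\<^sup>2 / 2))" for y
  proof -
    have "(w /\<^sub>R s) \<bullet> (0 + s *\<^sub>R y) = w \<bullet> y" using s by simp
    then show ?thesis using s by (simp only:) (simp add: power_mult_distrib)
  qed
  have m: "?f \<in> borel_measurable borel" by measurable
  show ?A using lborel_integral_affine(1)[OF m s, of 0] gaussian_ft(1)[of "w /\<^sub>R s"] unfolding e by simp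
  define I where "I = (\<integral>y. iexp (w \<bullet> y) * of_real (exp (- s\<^sup>2 * (norm y)\<^sup>2 / 2)) \<partial>lborel)"
  have I: "of_real (s ^ DIM('a)) * I = of_real (sqrt (2 * pi) ^ DIM('a) * exp (- (norm (w /\<^sub>R s))\<^sup>2 / 2))"
    using lborel_integral_affine(2)[OF m s, of 0] unfolding e I_def[symmetric] gaussian_ft(2)
    by (simp only: scaleR_conv_of_real)
  have I': "I = of_real (sqrt (2 * pi) ^ DIM('a) * exp (- (norm (w /\<^sub>R s))\<^sup>2 / 2) / s ^ DIM('a))"
    unfolding of_real_divide I[symmetric] using s by simp
  have p: "(2 * pi) ^ DIM('a) = sqrt (2 * pi) ^ DIM('a) * sqrt (2 * pi) ^ DIM('a)"
    unfolding power_mult_distrib[symmetric] by (subst real_sqrt_mult_self) simp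
  have n: "(norm (w /\<^sub>R s))\<^sup>2 / 2 = (norm w)\<^sup>2 / (2 * s\<^sup>2)"
    using s by (simp add: power_mult_distrib power_inverse inverse_eq_divide power_divide)
  have "gauss_kernel s w = sqrt (2 * pi) ^ DIM('a) * exp (- (norm (w /\<^sub>R s))\<^sup>2 / 2) / s ^ DIM('a) / (2 * pi) ^ DIM('a)"
    unfolding p minus_divide_left[symmetric] n gauss_kernel_def power_mult_distrib[of s] using s by (simp del: real_sqrt_mult)
  then have "of_real (gauss_kernel s w) = I / of_real ((2 * pi) ^ DIM('a))"
    unfolding I' of_real_divide[symmetric] by simp
  then show ?B unfolding I_def .
qed

lemma gauss_kernel_nonneg: "s > 0 \<Longrightarrow> gauss_kernel s w \<ge> 0"
  by (simp add: gauss_kernel_def)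

lemma gauss_kernel_measurable[measurable]: "gauss_kernel s \<in> borel_measurable borel"
  unfolding gauss_kernel_def[abs_def] by measurable

lemma gauss_kernel_prob:
  "integrable lborel (gauss_kernel 1 :: 'a::euclidean_space \<Rightarrow> real)"
  "(\<integral>z. gauss_kernel 1 (z::'a::euclidean_space) \<partial>lborel) = 1"
proof -
  let ?f = "\<lambda>z::'a. complex_of_real (exp (- (norm z)\<^sup>2 / 2))"
  have i: "integrable lborel ?f"
    and v: "(\<integral>z. ?f z \<partial>lborel) = of_real (sqrt (2 * pi) ^ DIM('a))"
    using gaussian_ft[of "0::'a"] by simp_all
  have i': "integrable lborel (\<lambda>z::'a. exp (- (norm z)\<^sup>2 / 2))"
    using i by (simp add: complex_of_real_integrable_eq)
  have v': "(\<integral>z. exp (- (norm (z::'a))\<^sup>2 / 2) \<partial>lborel) = sqrt (2 * pi) ^ DIM('a)"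
    using v unfolding integral_complex_of_real of_real_eq_iff .
  show "integrable lborel (gauss_kernel 1 :: 'a \<Rightarrow> real)"
    using i' by (simp add: gauss_kernel_def[abs_def])
  show "(\<integral>z. gauss_kernel 1 (z::'a) \<partial>lborel) = 1"
    using v' by (simp add: gauss_kernel_def[abs_def])
qed

lemma gauss_kernel_scale:
  "s > 0 \<Longrightarrow> gauss_kernel s (s *\<^sub>R z) = gauss_kernel 1 z / s ^ DIM('a)" for z :: "'a::euclidean_space"
  by (simp add: gauss_kernel_def power_mult_distrib)

section \<open>Fourier inversion\<close>

text \<open>The minus sign matches \<open>char_fn\<close>, whose exponent carries a plus. Taking
  \<open>Re\<close> serves to obtain a real-valued function: for characteristic functions and their
  derivative symbols, u(-y) is the conjugate of u(y), so the integral is already real.\<close>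

definition inv_ft :: "('a::euclidean_space \<Rightarrow> complex) \<Rightarrow> 'a \<Rightarrow> real" where
  "inv_ft u x = Re (\<integral>y. iexp (- (x \<bullet> y)) * u y \<partial>lborel) / (2 * pi) ^ DIM('a)"

definition char_fn :: "'a::euclidean_space measure \<Rightarrow> 'a \<Rightarrow> complex" where
  "char_fn M y = (\<integral>x. iexp (x \<bullet> y) \<partial>M)"

lemma integrable_iexp_mult:
  fixes u :: "'a::euclidean_space \<Rightarrow> complex"
  assumes "integrable M u" "sets M = sets borel"
  shows "integrable M (\<lambda>y. iexp (- (x \<bullet> y)) * u y)"
proof -
  have [measurable]: "u \<in> borel_measurable M" using assms by auto
  have [measurable_cong]: "sets M = sets borel" by fact
  show ?thesis
    by (rule Bochner_Integration.integrable_bound[OF assms(1)]) (auto intro!: AE_I2 simp: norm_mult)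
qed

lemma continuous_on_integral_dominated:
  fixes f :: "'x::metric_space \<Rightarrow> 'y \<Rightarrow> 'b::{banach,second_countable_topology}"
  assumes "\<And>x. f x \<in> borel_measurable M" "integrable M w"
    and "\<And>x y. norm (f x y) \<le> w y" and "\<And>y. continuous_on UNIV (\<lambda>x. f x y)"
  shows "continuous_on UNIV (\<lambda>x. \<integral>y. f x y \<partial>M)"
proof (rule continuous_on_sequentiallyI)
  fix X :: "nat \<Rightarrow> 'x" and l
  assume X: "X \<longlonglongrightarrow> l"
  show "(\<lambda>n. \<integral>y. f (X n) y \<partial>M) \<longlonglongrightarrow> (\<integral>y. f l y \<partial>M)"
  proof (rule integral_dominated_convergence[where w = w])
    have "(\<lambda>n. f (X n) y) \<longlonglongrightarrow> f l y" for y
      using continuous_on_tendsto_compose[OF assms(4)[of y] X] by simp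
    then show "AE y in M. (\<lambda>n. f (X n) y) \<longlonglongrightarrow> f l y" by simp
  qed (use assms in auto)
qed

lemma inv_ft_continuous:
  fixes u :: "'a::euclidean_space \<Rightarrow> complex"
  assumes "integrable lborel u"
  shows "continuous_on UNIV (inv_ft u)"
proof -
  have [measurable]: "u \<in> borel_measurable borel" using assms by auto
  have "continuous_on UNIV (\<lambda>x. \<integral>y. iexp (- (x \<bullet> y)) * u y \<partial>lborel)"
    by (rule continuous_on_integral_dominated[where w = "\<lambda>y. norm (u y)"])
       (use assms in \<open>auto simp: norm_mult intro!: continuous_intros\<close>)
  then show ?thesis
    unfolding inv_ft_def[abs_def] by (intro continuous_intros) auto
qed

lemma inv_ft_bound:
  fixes u :: "'a::euclidean_space \<Rightarrow> complex"
  assumes "integrable lborel w" "u \<in> borel_measurable borel" "\<And>y. norm (u y) \<le> w y"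
  shows "\<bar>inv_ft u x\<bar> \<le> (\<integral>y. w y \<partial>lborel)"
proof -
  have "\<bar>Re (\<integral>y. iexp (- (x \<bullet> y)) * u y \<partial>lborel)\<bar> \<le> norm (\<integral>y. iexp (- (x \<bullet> y)) * u y \<partial>lborel)"
    by (rule abs_Re_le_cmod)
  also have "\<dots> \<le> (\<integral>y. w y \<partial>lborel)"
  proof (rule Bochner_Integration.integral_norm_bound_integral)
    have "integrable lborel u"
      using assms by (intro Bochner_Integration.integrable_bound[OF assms(1)]) (auto intro!: AE_I2 order_trans[OF assms(3)])
    then show "integrable lborel (\<lambda>y. iexp (- (x \<bullet> y)) * u y)"
      by (rule integrable_iexp_mult) simp
  qed (use assms in \<open>auto simp: norm_mult\<close>)
  finally have a: "\<bar>Re (\<integral>y. iexp (- (x \<bullet> y)) * u y \<partial>lborel)\<bar> \<le> (\<integral>y. w y \<partial>lborel)" .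
  have "1 \<le> (2 * pi) ^ DIM('a)" using pi_gt3 by (intro one_le_power) auto
  then have "\<bar>Re (\<integral>y. iexp (- (x \<bullet> y)) * u y \<partial>lborel)\<bar> / (2 * pi) ^ DIM('a) \<le> \<bar>Re (\<integral>y. iexp (- (x \<bullet> y)) * u y \<partial>lborel)\<bar> / 1"
    by (intro divide_left_mono) auto
  with a show ?thesis by (simp add: inv_ft_def)
qed

text \<open>Fubini, after the Gaussian has been replaced by its Fourier integral: convolving M with
  a Gaussian damps its characteristic function.\<close>

lemma gauss_smoothing:
  fixes M :: "'a::euclidean_space measure"
  assumes M: "finite_measure M" "sets M = sets borel" and s: "s > 0"
    and phi: "integrable lborel (char_fn M)"
  shows "(\<integral>u. gauss_kernel s (u - x) \<partial>M)
    = inv_ft (\<lambda>y. of_real (exp (- s\<^sup>2 * (norm y)\<^sup>2 / 2)) * char_fn M y) x"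
proof -
  interpret finite_measure M by fact
  interpret pair_sigma_finite M "lborel :: 'a measure" ..
  have [measurable_cong]: "sets M = sets borel" by fact
  let ?g = "\<lambda>y::'a. complex_of_real (exp (- s\<^sup>2 * (norm y)\<^sup>2 / 2))"
  have gi: "integrable lborel ?g"
    using gauss_kernel_ft(1)[OF s, of "0::'a"] by simp
  have int: "integrable (M \<Otimes>\<^sub>M lborel) (\<lambda>(u, y). iexp ((u - x) \<bullet> y) * ?g y)"
  proof (rule Fubini_integrable)
    have "integrable M (\<lambda>u. \<integral>y. norm (?g y) \<partial>lborel)" by simp
    then show "integrable M (\<lambda>u. \<integral>y. norm (case (u, y) of (u, y) \<Rightarrow> iexp ((u - x) \<bullet> y) * ?g y) \<partial>lborel)"
      by (simp add: norm_mult)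
    show "AE u in M. integrable lborel (\<lambda>y. case (u, y) of (u, y) \<Rightarrow> iexp ((u - x) \<bullet> y) * ?g y)"
      by (intro AE_I2) (simp only: prod.case, rule gauss_kernel_ft(1)[OF s])
  qed measurable
  have "complex_of_real (\<integral>u. gauss_kernel s (u - x) \<partial>M) = (\<integral>u. of_real (gauss_kernel s (u - x)) \<partial>M)"
    by (rule integral_complex_of_real[symmetric])
  also have "\<dots> = (\<integral>u. (\<integral>y. iexp ((u - x) \<bullet> y) * ?g y \<partial>lborel) \<partial>M) / of_real ((2 * pi) ^ DIM('a))"
    by (simp only: gauss_kernel_ft(2)[OF s] Bochner_Integration.integral_divide_zero)
  also have "(\<integral>u. (\<integral>y. iexp ((u - x) \<bullet> y) * ?g y \<partial>lborel) \<partial>M) = (\<integral>y. (\<integral>u. iexp ((u - x) \<bullet> y) * ?g y \<partial>M) \<partial>lborel)"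
    using Fubini_integral[OF int] by simp
  also have "\<dots> = (\<integral>y. iexp (- (x \<bullet> y)) * (?g y * char_fn M y) \<partial>lborel)"
  proof (rule Bochner_Integration.integral_cong[OF refl])
    fix y
    have "iexp ((u - x) \<bullet> y) * ?g y = (iexp (- (x \<bullet> y)) * ?g y) * iexp (u \<bullet> y)" for u
      by (simp add: inner_diff_left right_diff_distrib exp_diff exp_minus field_simps)
    then show "(\<integral>u. iexp ((u - x) \<bullet> y) * ?g y \<partial>M) = iexp (- (x \<bullet> y)) * (?g y * char_fn M y)"
      by (simp add: char_fn_def mult.assoc)
  qed
  finally have "complex_of_real (\<integral>u. gauss_kernel s (u - x) \<partial>M)
      = (\<integral>y. iexp (- (x \<bullet> y)) * (?g y * char_fn M y) \<partial>lborel) / of_real ((2 * pi) ^ DIM('a))" .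
  from arg_cong[OF this, of Re] show ?thesis
    unfolding inv_ft_def Re_divide_of_real by simp
qed


lemma inv_ft_tendsto:
  fixes u :: "'a::euclidean_space \<Rightarrow> complex"
  assumes [measurable]: "\<And>n. v n \<in> borel_measurable borel" "u \<in> borel_measurable borel"
    and "integrable lborel w" "\<And>n y. norm (v n y) \<le> w y" "\<And>y. (\<lambda>n. v n y) \<longlonglongrightarrow> u y"
  shows "(\<lambda>n. inv_ft (v n) x) \<longlonglongrightarrow> inv_ft u x"
proof -
  have "(\<lambda>n. \<integral>y. iexp (- (x \<bullet> y)) * v n y \<partial>lborel) \<longlonglongrightarrow> (\<integral>y. iexp (- (x \<bullet> y)) * u y \<partial>lborel)"
    by (rule integral_dominated_convergence[where w = w])
       (use assms in \<open>auto intro!: AE_I2 tendsto_intros simp: norm_mult\<close>)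
  then show ?thesis unfolding inv_ft_def by (intro tendsto_intros) auto
qed

lemma char_fn_measurable:
  assumes M: "finite_measure M" "sets M = sets borel"
  shows "char_fn M \<in> borel_measurable borel"
proof -
  interpret finite_measure M by fact
  have [measurable_cong]: "sets M = sets borel" by fact
  show ?thesis unfolding char_fn_def[abs_def] by measurable
qed

lemma compact_support_facts:
  fixes f :: "'a::euclidean_space \<Rightarrow> real"
  assumes f: "continuous_on UNIV f" and R: "\<And>x. norm x > R \<Longrightarrow> f x = 0"
  shows "integrable lborel f" and "\<exists>C. \<forall>x. \<bar>f x\<bar> \<le> C"
proof -
  have "compact (f ` cball 0 R)" by (intro compact_continuous_image continuous_on_subset[OF f]) auto
  then obtain C where C: "\<And>x. x \<in> cball 0 R \<Longrightarrow> \<bar>f x\<bar> \<le> C"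
    using compact_imp_bounded[of "f ` cball 0 R"] unfolding bounded_iff by (metis imageI real_norm_def)
  have "\<bar>f x\<bar> \<le> max C 0" for x using C[of x] R[of x] by (cases "norm x > R") (auto simp: max_def)
  then show "\<exists>C. \<forall>x. \<bar>f x\<bar> \<le> C" by blast
  have "integrable lborel (\<lambda>x. indicator (cball 0 R) x *\<^sub>R f x)"
    using borel_integrable_compact[of "cball 0 R" f] continuous_on_subset[OF f]
    by (simp add: set_integrable_def)
  also have "(\<lambda>x. indicator (cball 0 R) x *\<^sub>R f x) = f"
    using R by (auto simp: fun_eq_iff indicator_def not_le)
  finally show "integrable lborel f" .
qed

text \<open>The integral of f against the Gaussian-smoothed M is evaluated in two ways as the width
  tends to 0. On the Fourier side the smoothed densities converge boundedly to
  \<open>inv_ft (char_fn M)\<close>; after Fubini the smoothing falls on f and disappears by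
  continuity. Non-negativity is inherited from the smoothed densities.\<close>

lemma fourier_inversion_test:
  fixes M :: "'a::euclidean_space measure" and f :: "'a \<Rightarrow> real"
  assumes M: "finite_measure M" "sets M = sets borel"
    and phi: "integrable lborel (char_fn M)"
    and f: "continuous_on UNIV f" and R: "\<And>x. norm x > R \<Longrightarrow> f x = 0"
  shows "(\<integral>x. f x \<partial>M) = (\<integral>x. f x * inv_ft (char_fn M) x \<partial>lborel)"
    and "inv_ft (char_fn M) x \<ge> 0"
proof -
  interpret finite_measure M by fact
  interpret pair_sigma_finite M "lborel :: 'a measure" ..
  have [measurable_cong]: "sets M = sets borel" by fact
  have [measurable]: "char_fn M \<in> borel_measurable borel" using phi by auto
  have [measurable]: "f \<in> borel_measurable borel" by (rule borel_measurable_continuous_onI[OF f])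
  have fint: "integrable lborel f" by (rule compact_support_facts(1)[OF f R])
  obtain C where C: "\<And>x. \<bar>f x\<bar> \<le> C" using compact_support_facts(2)[OF f R] by auto
  define s where "s n = 1 / real (Suc n)" for n
  have s: "s n > 0" for n by (simp add: s_def)
  have s0: "s \<longlonglongrightarrow> 0" unfolding s_def by real_asymp
  define G where "G n x = (\<integral>u. gauss_kernel (s n) (u - x) \<partial>M)" for n x
  have G_eq: "G n x = inv_ft (\<lambda>y. of_real (exp (- (s n)\<^sup>2 * (norm y)\<^sup>2 / 2)) * char_fn M y) x" for n x
    unfolding G_def by (rule gauss_smoothing[OF M s phi])
  have le: "norm (of_real (exp (- (s n)\<^sup>2 * (norm y)\<^sup>2 / 2)) * char_fn M y) \<le> norm (char_fn M y)" for n y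
    unfolding norm_mult norm_of_real abs_exp_cancel by (rule mult_left_le_one_le) auto
  have G_lim: "(\<lambda>n. G n x) \<longlonglongrightarrow> inv_ft (char_fn M) x" for x
    unfolding G_eq
  proof (rule inv_ft_tendsto[where w = "\<lambda>y. norm (char_fn M y)"])
    fix y
    have "(\<lambda>n. of_real (exp (- (s n)\<^sup>2 * (norm y)\<^sup>2 / 2)) * char_fn M y) \<longlonglongrightarrow> of_real (exp (- 0\<^sup>2 * (norm y)\<^sup>2 / 2)) * char_fn M y"
      by (intro tendsto_intros s0) auto
    then show "(\<lambda>n. of_real (exp (- (s n)\<^sup>2 * (norm y)\<^sup>2 / 2)) * char_fn M y) \<longlonglongrightarrow> char_fn M y" by simp
  qed (use phi le in auto)
  have G_nonneg: "G n x \<ge> 0" for n x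
    unfolding G_def by (intro integral_nonneg_AE AE_I2 gauss_kernel_nonneg s)
  show "inv_ft (char_fn M) x \<ge> 0"
    using G_nonneg by (intro LIMSEQ_le_const[OF G_lim]) auto
  define D where "D = (\<integral>y. norm (char_fn M y) \<partial>lborel)"
  have G_le: "\<bar>G n x\<bar> \<le> D" for n x
    unfolding G_eq D_def by (rule inv_ft_bound) (use phi le in auto)
  have Gm[measurable]: "G n \<in> borel_measurable borel" for n
    unfolding G_def[abs_def] by measurable
  have lim1: "(\<lambda>n. \<integral>x. f x * G n x \<partial>lborel) \<longlonglongrightarrow> (\<integral>x. f x * inv_ft (char_fn M) x \<partial>lborel)"
  proof (rule integral_dominated_convergence[where w = "\<lambda>x. \<bar>f x\<bar> * D"])
    show "(\<lambda>x. f x * inv_ft (char_fn M) x) \<in> borel_measurable lborel"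
      using borel_measurable_continuous_onI[OF inv_ft_continuous[OF phi]] by simp
    show "AE x in lborel. (\<lambda>n. f x * G n x) \<longlonglongrightarrow> f x * inv_ft (char_fn M) x"
      by (intro AE_I2 tendsto_intros G_lim)
    show "AE x in lborel. norm (f x * G n x) \<le> \<bar>f x\<bar> * D" for n
      by (intro AE_I2) (auto simp: abs_mult intro!: mult_left_mono G_le)
  qed (use fint in auto)
  \<comment> \<open>Substituting x = u + s z turns the narrow kernel into the fixed one, so that
    continuity of f at u gives the limit.\<close>
  have sub: "(\<integral>x. f x * gauss_kernel (s n) (u - x) \<partial>lborel) = (\<integral>z. f (u + s n *\<^sub>R z) * gauss_kernel 1 z \<partial>lborel)" for n u
  proof -
    have k: "gauss_kernel (s n) (u - (u + s n *\<^sub>R z)) = gauss_kernel 1 z / s n ^ DIM('a)" for z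
      using gauss_kernel_scale[OF s[of n], of "-z"] by (simp add: gauss_kernel_def)
    have "(\<integral>x. f x * gauss_kernel (s n) (u - x) \<partial>lborel)
        = s n ^ DIM('a) *\<^sub>R (\<integral>z. f (u + s n *\<^sub>R z) * gauss_kernel (s n) (u - (u + s n *\<^sub>R z)) \<partial>lborel)"
      by (rule lborel_integral_affine(2)) (use s in auto)
    also have "\<dots> = (\<integral>z. f (u + s n *\<^sub>R z) * gauss_kernel 1 z \<partial>lborel)"
      unfolding k using s[of n] by simp
    finally show ?thesis .
  qed
  have "(\<integral>x. f x * G n x \<partial>lborel) = (\<integral>u. (\<integral>z. f (u + s n *\<^sub>R z) * gauss_kernel 1 z \<partial>lborel) \<partial>M)" for n
  proof -
    have km: "\<exists>K. \<forall>w::'a. \<bar>gauss_kernel (s n) w\<bar> \<le> K"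
      by (intro exI[of _ "1 / (s n * sqrt (2 * pi)) ^ DIM('a)"])
         (use s[of n] in \<open>auto simp: gauss_kernel_def intro!: divide_right_mono\<close>)
    then obtain K where K: "\<And>w::'a. \<bar>gauss_kernel (s n) w\<bar> \<le> K" by auto
    have i1: "integrable lborel (\<lambda>x. f x * gauss_kernel (s n) (u - x))" for u
      by (rule Bochner_Integration.integrable_bound[where f = "\<lambda>x. \<bar>f x\<bar> * K"])
         (use fint K in \<open>auto simp: abs_mult intro!: AE_I2 mult_mono order_trans[OF K] \<close>)
    have int: "integrable (M \<Otimes>\<^sub>M lborel) (\<lambda>(u, x). f x * gauss_kernel (s n) (u - x))"
    proof (rule Fubini_integrable)
      show "AE u in M. integrable lborel (\<lambda>x. case (u, x) of (u, x) \<Rightarrow> f x * gauss_kernel (s n) (u - x))"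
        using i1 by simp
      have "norm (\<integral>x. norm (f x * gauss_kernel (s n) (u - x)) \<partial>lborel) \<le> (\<integral>x. \<bar>f x\<bar> * K \<partial>lborel)" for u
        by (rule Bochner_Integration.integral_norm_bound_integral)
           (use integrable_norm[OF i1] fint K in \<open>auto simp: abs_mult intro!: mult_left_mono\<close>)
      then show "integrable M (\<lambda>u. \<integral>x. norm (case (u, x) of (u, x) \<Rightarrow> f x * gauss_kernel (s n) (u - x)) \<partial>lborel)"
        by (intro integrable_const_bound[where B = "\<integral>x. \<bar>f x\<bar> * K \<partial>lborel"]) auto
    qed measurable
    have "(\<integral>x. f x * G n x \<partial>lborel) = (\<integral>x. (\<integral>u. f x * gauss_kernel (s n) (u - x) \<partial>M) \<partial>lborel)"
      unfolding G_def by simp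
    also have "\<dots> = (\<integral>u. (\<integral>x. f x * gauss_kernel (s n) (u - x) \<partial>lborel) \<partial>M)"
      using Fubini_integral[OF int] by simp
    finally show ?thesis unfolding sub .
  qed
  with lim1 have lim1': "(\<lambda>n. \<integral>u. (\<integral>z. f (u + s n *\<^sub>R z) * gauss_kernel 1 z \<partial>lborel) \<partial>M) \<longlonglongrightarrow> (\<integral>x. f x * inv_ft (char_fn M) x \<partial>lborel)"
    by simp
  have wi: "integrable lborel (\<lambda>z::'a. C * gauss_kernel 1 z)"
    using gauss_kernel_prob(1)[where ?'a = 'a] by (intro integrable_mult_right) simp
  have bd: "norm (f (u + s n *\<^sub>R z) * gauss_kernel 1 z) \<le> C * gauss_kernel 1 z" for u n z
    using C gauss_kernel_nonneg[of 1 z] by (simp add: abs_mult mult_right_mono)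
  have inner: "(\<lambda>n. \<integral>z. f (u + s n *\<^sub>R z) * gauss_kernel 1 z \<partial>lborel) \<longlonglongrightarrow> f u" for u
  proof -
    have "(\<lambda>n. \<integral>z. f (u + s n *\<^sub>R z) * gauss_kernel 1 z \<partial>lborel) \<longlonglongrightarrow> (\<integral>z. f u * gauss_kernel 1 (z::'a) \<partial>lborel)"
    proof (rule integral_dominated_convergence[where w = "\<lambda>z. C * gauss_kernel 1 z"])
      have "(\<lambda>n. f (u + s n *\<^sub>R z)) \<longlonglongrightarrow> f u" for z
      proof -
        have "(\<lambda>n. u + s n *\<^sub>R z) \<longlonglongrightarrow> u + 0 *\<^sub>R z" by (intro tendsto_intros s0)
        then show ?thesis using continuous_on_tendsto_compose[OF f] by fastforce
      qed
      then show "AE z in lborel. (\<lambda>n. f (u + s n *\<^sub>R z) * gauss_kernel 1 z) \<longlonglongrightarrow> f u * gauss_kernel 1 z"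
        by (intro AE_I2 tendsto_intros)
    qed (use wi bd in auto)
    then show ?thesis by (simp add: gauss_kernel_prob)
  qed
  have lim2: "(\<lambda>n. \<integral>u. (\<integral>z. f (u + s n *\<^sub>R z) * gauss_kernel 1 z \<partial>lborel) \<partial>M) \<longlonglongrightarrow> (\<integral>u. f u \<partial>M)"
  proof (rule integral_dominated_convergence[where w = "\<lambda>u. C"])
    show "AE u in M. norm (\<integral>z. f (u + s n *\<^sub>R z) * gauss_kernel 1 z \<partial>lborel) \<le> C" for n
    proof (intro AE_I2)
      fix u
      have "norm (\<integral>z. f (u + s n *\<^sub>R z) * gauss_kernel 1 z \<partial>lborel) \<le> (\<integral>z. C * gauss_kernel 1 (z::'a) \<partial>lborel)"
        by (rule Bochner_Integration.integral_norm_bound_integral[OF _ wi bd])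
           (rule Bochner_Integration.integrable_bound[OF wi], measurable, rule AE_I2, rule order_trans[OF bd], simp)
      then show "norm (\<integral>z. f (u + s n *\<^sub>R z) * gauss_kernel 1 z \<partial>lborel) \<le> C"
        by (simp add: gauss_kernel_prob)
    qed
  qed (use inner in auto)
  show "(\<integral>x. f x \<partial>M) = (\<integral>x. f x * inv_ft (char_fn M) x \<partial>lborel)"
    by (rule LIMSEQ_unique[OF lim2 lim1'])
qed

text \<open>The approximants are truncated multiples of the distance to the complement of the box.
  That distance is positive inside because the box is open.\<close>

lemma box_approx:
  fixes a b :: "'a::euclidean_space"
  obtains f :: "nat \<Rightarrow> 'a \<Rightarrow> real" and R where
    "\<And>k. continuous_on UNIV (f k)" "\<And>k x. norm x > R \<Longrightarrow> f k x = 0" "\<And>k x. 0 \<le> f k x" "\<And>k x. f k x \<le> 1"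
    "\<And>x. (\<lambda>k. f k x) \<longlonglongrightarrow> indicator (box a b) x"
proof -
  obtain R where R: "\<And>x. x \<in> box a b \<Longrightarrow> norm x \<le> R"
    using bounded_box[of a b] unfolding bounded_iff by auto
  let ?f = "\<lambda>k x. min 1 (real k * infdist x (- box a b))"
  have ne: "- box a b \<noteq> {}"
    using bounded_box[of a b] not_bounded_UNIV by (metis Compl_empty_eq double_complement)
  have 1: "continuous_on UNIV (?f k)" for k
    by (intro continuous_intros)
  have 2: "?f k x = 0" if "norm x > R" for k x
  proof -
    have "x \<in> - box a b" using R[of x] that by auto
    then show ?thesis by simp
  qed
  have 3: "0 \<le> ?f k x" "?f k x \<le> 1" for k x by (auto simp: infdist_nonneg)
  have 4: "(\<lambda>k. ?f k x) \<longlonglongrightarrow> indicator (box a b) x" for x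
  proof (cases "x \<in> box a b")
    case True
    have "infdist x (- box a b) \<noteq> 0"
      using in_closed_iff_infdist_zero[of "- box a b" x] ne True by (simp add: closed_Compl open_box)
    then have pos: "infdist x (- box a b) > 0" using infdist_nonneg[of x "- box a b"] by linarith
    have "eventually (\<lambda>k. real k * infdist x (- box a b) \<ge> 1) sequentially"
      using pos by real_asymp
    then have "eventually (\<lambda>k. ?f k x = 1) sequentially" by eventually_elim auto
    then show ?thesis using True by (simp add: tendsto_eventually)
  qed auto
  show thesis by (rule that[OF 1 2 3 4])
qed

text \<open>Test functions increasing to indicators of open boxes give equality on boxes, which form
  an intersection-stable generator of the Borel sets.\<close>

theorem fourier_inversion:
  fixes M :: "'a::euclidean_space measure"
  assumes M: "finite_measure M" "sets M = sets borel"
    and phi: "integrable lborel (char_fn M)"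
  shows "continuous_density M (inv_ft (char_fn M))"
proof -
  interpret finite_measure M by fact
  have [measurable_cong]: "sets M = sets borel" by fact
  let ?G = "inv_ft (char_fn M)"
  have G0: "?G x \<ge> 0" for x
    by (rule fourier_inversion_test(2)[OF assms, of "\<lambda>_. 0" 0]) auto
  have Gc: "continuous_on UNIV ?G" by (rule inv_ft_continuous[OF phi])
  have [measurable]: "?G \<in> borel_measurable borel" by (rule borel_measurable_continuous_onI[OF Gc])
  have eq: "emeasure M (box a b) = emeasure (density lborel (\<lambda>x. ennreal (?G x))) (box a b)" for a b :: 'a
  proof -
    obtain f :: "nat \<Rightarrow> 'a \<Rightarrow> real" and R where
      f: "\<And>k. continuous_on UNIV (f k)" "\<And>k x. norm x > R \<Longrightarrow> f k x = 0" "\<And>k x. 0 \<le> f k x" "\<And>k x. f k x \<le> 1"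
      "\<And>x. (\<lambda>k. f k x) \<longlonglongrightarrow> indicator (box a b) x"
      using box_approx[of a b] by blast
    have [measurable]: "f k \<in> borel_measurable borel" for k
      by (rule borel_measurable_continuous_onI[OF f(1)])
    have out: "indicator (box a b) x = (0::real)" if "norm x > R" for x
      using f(5)[of x] f(2)[OF that] LIMSEQ_unique[of "\<lambda>k. 0" 0 "indicator (box a b) x"] by simp
    have ci: "integrable lborel (\<lambda>x. indicator (cball 0 R) x *\<^sub>R ?G x)"
      using borel_integrable_compact[of "cball 0 R" ?G] continuous_on_subset[OF Gc]
      by (simp add: set_integrable_def)
    have l1: "(\<lambda>k. \<integral>x. f k x \<partial>M) \<longlonglongrightarrow> (\<integral>x. indicator (box a b) x \<partial>M)"
      by (rule integral_dominated_convergence[where w = "\<lambda>_. 1"]) (use f in auto)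
    have l2: "(\<lambda>k. \<integral>x. f k x * ?G x \<partial>lborel) \<longlonglongrightarrow> (\<integral>x. indicator (box a b) x * ?G x \<partial>lborel)"
    proof (rule integral_dominated_convergence[where w = "\<lambda>x. indicator (cball 0 R) x *\<^sub>R ?G x"])
      show "AE x in lborel. (\<lambda>k. f k x * ?G x) \<longlonglongrightarrow> indicator (box a b) x * ?G x"
        by (intro AE_I2 tendsto_intros f)
      show "AE x in lborel. norm (f k x * ?G x) \<le> indicator (cball 0 R) x *\<^sub>R ?G x" for k
        using G0 f(2-4) by (intro AE_I2) (auto simp: indicator_def abs_mult not_le mult_left_le_one_le)
    qed (use ci in auto)
    have "(\<integral>x. f k x \<partial>M) = (\<integral>x. f k x * ?G x \<partial>lborel)" for k
      by (rule fourier_inversion_test(1)[OF assms f(1,2)])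
    with l1 l2 have m: "measure M (box a b) = (\<integral>x. indicator (box a b) x * ?G x \<partial>lborel)"
      using LIMSEQ_unique by (fastforce simp: )
    have bi: "integrable lborel (\<lambda>x. indicator (box a b) x * ?G x)"
      by (rule Bochner_Integration.integrable_bound[OF ci])
         (use out in \<open>force intro!: AE_I2 simp: indicator_def not_le split: if_splits\<close>)+
    have "emeasure (density lborel (\<lambda>x. ennreal (?G x))) (box a b) = (\<integral>\<^sup>+x. ennreal (indicator (box a b) x * ?G x) \<partial>lborel)"
      by (subst emeasure_density) (auto intro!: nn_integral_cong simp: indicator_def)
    also have "\<dots> = ennreal (\<integral>x. indicator (box a b) x * ?G x \<partial>lborel)"
      by (rule nn_integral_eq_integral[OF bi]) (use G0 in \<open>auto simp: indicator_def\<close>)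
    finally show ?thesis by (simp add: m[symmetric] emeasure_eq_measure)
  qed
  have "M = density lborel (\<lambda>x. ennreal (?G x))"
  proof (rule measure_eqI_generator_eq)
    let ?E = "range (\<lambda>(a, b). box a b::'a set)"
    show "Int_stable ?E" by (auto simp: Int_stable_def box_Int_box)
    show "?E \<subseteq> Pow UNIV" "sets M = sigma_sets UNIV ?E"
      "sets (density lborel (\<lambda>x. ennreal (?G x))) = sigma_sets UNIV ?E"
      by (simp_all add: borel_eq_box M)
    let ?A = "\<lambda>n::nat. box (- (real n *\<^sub>R One)) (real n *\<^sub>R One) :: 'a set"
    show "range ?A \<subseteq> ?E" "(\<Union>i. ?A i) = UNIV" unfolding UN_box_eq_UNIV by auto
    show "emeasure M (?A i) \<noteq> \<infinity>" for i by simp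
    show "emeasure M X = emeasure (density lborel (\<lambda>x. ennreal (?G x))) X" if "X \<in> ?E" for X
      using that eq by auto
  qed
  with G0 Gc show ?thesis by (simp add: continuous_density_def)
qed

section \<open>Smoothness, uniqueness and convergence of densities\<close>

text \<open>Dominated convergence for difference quotients: |exp(i v) - 1| \<le> |v| bounds them by
  \<open>(1 + norm y) * norm (u y)\<close>, uniformly in the increment.\<close>

lemma inv_ft_partial:
  fixes u :: "'a::euclidean_space \<Rightarrow> complex"
  assumes [measurable]: "u \<in> borel_measurable borel"
    and ui: "integrable lborel (\<lambda>y. (1 + norm y) * norm (u y))" and e: "norm e \<le> 1"
  shows "((\<lambda>t::real. inv_ft u (x + t *\<^sub>R e)) has_real_derivative inv_ft (\<lambda>y. - \<i> * of_real (y \<bullet> e) * u y) x) (at 0)"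
proof -
  have i0: "integrable lborel u"
    by (rule Bochner_Integration.integrable_bound[OF ui])
       (auto intro!: AE_I2 mult_le_cancel_right1[THEN iffD2] simp: algebra_simps)
  have q: "(inv_ft u (x + h *\<^sub>R e) - inv_ft u (x + 0 *\<^sub>R e)) / h
      = inv_ft (\<lambda>y. (iexp (- (h * (y \<bullet> e))) - 1) / of_real h * u y) x" if "h \<noteq> 0" for h
  proof -
    have "(\<integral>y. iexp (- (x \<bullet> y)) * ((iexp (- (h * (y \<bullet> e))) - 1) / of_real h * u y) \<partial>lborel)
      = (\<integral>y. (iexp (- ((x + h *\<^sub>R e) \<bullet> y)) * u y - iexp (- (x \<bullet> y)) * u y) / of_real h \<partial>lborel)"
    proof (intro Bochner_Integration.integral_cong refl)
      fix y
      have "iexp (- ((x + h *\<^sub>R e) \<bullet> y)) = iexp (- (x \<bullet> y)) * iexp (- (h * (y \<bullet> e)))"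
        unfolding exp_add[symmetric] by (simp add: inner_add_left inner_commute[of e] algebra_simps)
      then show "iexp (- (x \<bullet> y)) * ((iexp (- (h * (y \<bullet> e))) - 1) / of_real h * u y)
        = (iexp (- ((x + h *\<^sub>R e) \<bullet> y)) * u y - iexp (- (x \<bullet> y)) * u y) / of_real h"
        by (simp add: left_diff_distrib right_diff_distrib diff_divide_distrib mult_ac)
    qed
    also have "\<dots> = (\<integral>y. iexp (- ((x + h *\<^sub>R e) \<bullet> y)) * u y - iexp (- (x \<bullet> y)) * u y \<partial>lborel) / of_real h"
      by (rule Bochner_Integration.integral_divide_zero)
    also have "(\<integral>y. iexp (- ((x + h *\<^sub>R e) \<bullet> y)) * u y - iexp (- (x \<bullet> y)) * u y \<partial>lborel)
       = (\<integral>y. iexp (- ((x + h *\<^sub>R e) \<bullet> y)) * u y \<partial>lborel) - (\<integral>y. iexp (- (x \<bullet> y)) * u y \<partial>lborel)"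
      by (rule Bochner_Integration.integral_diff) (rule integrable_iexp_mult[OF i0], simp)+
    finally show ?thesis
      unfolding inv_ft_def by (simp add: Re_divide_of_real diff_divide_distrib mult.commute)
  qed
  have ineq: "norm ((iexp (- (h * (y \<bullet> e))) - 1) / of_real h * u y) \<le> (1 + norm y) * norm (u y)" if "h \<noteq> 0" for h y
  proof -
    have "norm (iexp (- (h * (y \<bullet> e))) - 1) \<le> \<bar>- (h * (y \<bullet> e))\<bar>"
      using iexp_approx1[of "- (h * (y \<bullet> e))" 0] by simp
    also have "\<dots> \<le> \<bar>h\<bar> * (norm y * 1)"
      unfolding abs_minus abs_mult by (intro mult_left_mono order_trans[OF Cauchy_Schwarz_ineq2] e) auto
    also have "\<dots> \<le> \<bar>h\<bar> * (1 + norm y)" by (intro mult_left_mono) auto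
    finally have "norm (iexp (- (h * (y \<bullet> e))) - 1) / \<bar>h\<bar> \<le> 1 + norm y"
      using that by (simp add: divide_le_eq mult.commute)
    then show ?thesis unfolding norm_mult norm_divide norm_of_real by (rule mult_right_mono) simp
  qed
  have lim: "((\<lambda>w. (exp (- (\<i> * (w * of_real c))) - 1) / w) \<longlongrightarrow> - \<i> * of_real c) (at 0)" for c
  proof -
    have "((\<lambda>w. exp (- (\<i> * (w * of_real c)))) has_field_derivative (- \<i> * of_real c)) (at 0)"
      by (auto intro!: derivative_eq_intros)
    then show ?thesis by (simp add: has_field_derivative_iff)
  qed
  show ?thesis
    unfolding has_field_derivative_iff tendsto_at_iff_sequentially
  proof (intro allI impI)
    fix X :: "nat \<Rightarrow> real"
    assume X: "\<forall>i. X i \<in> UNIV - {0}" "X \<longlonglongrightarrow> 0"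
    have "(\<lambda>n. inv_ft (\<lambda>y. (iexp (- (X n * (y \<bullet> e))) - 1) / of_real (X n) * u y) x) \<longlonglongrightarrow> inv_ft (\<lambda>y. - \<i> * of_real (y \<bullet> e) * u y) x"
    proof (rule inv_ft_tendsto[OF _ _ ui])
      show "(\<lambda>n. (iexp (- (X n * (y \<bullet> e))) - 1) / of_real (X n) * u y) \<longlonglongrightarrow> - \<i> * of_real (y \<bullet> e) * u y" for y
      proof (intro tendsto_mult tendsto_const)
        have "(\<lambda>n. complex_of_real (X n)) \<longlonglongrightarrow> 0" using tendsto_of_real[OF X(2)] by simp
        then have "((\<lambda>w. (exp (- (\<i> * (w * of_real (y \<bullet> e)))) - 1) / w) \<circ> (\<lambda>n. complex_of_real (X n))) \<longlonglongrightarrow> - \<i> * of_real (y \<bullet> e)"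
          using lim[of "y \<bullet> e"] X(1) unfolding tendsto_at_iff_sequentially by auto
        then show "(\<lambda>n. (iexp (- (X n * (y \<bullet> e))) - 1) / of_real (X n)) \<longlonglongrightarrow> - \<i> * of_real (y \<bullet> e)"
          by (simp add: o_def)
      qed
    qed (use X ineq in auto)
    then show "((\<lambda>h. (inv_ft u (x + h *\<^sub>R e) - inv_ft u (x + 0 *\<^sub>R e)) / (h - 0)) \<circ> X) \<longlonglongrightarrow> inv_ft (\<lambda>y. - \<i> * of_real (y \<bullet> e) * u y) x"
      using X q by (simp add: o_def)
  qed
qed

text \<open>The Fourier multiplier of \<open>iter_partial es\<close>.\<close>

definition partial_symbol :: "'a::euclidean_space list \<Rightarrow> 'a \<Rightarrow> complex" where
  "partial_symbol es y = (\<Prod>e\<leftarrow>es. - \<i> * of_real (y \<bullet> e))"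

lemma partial_symbol_simps [simp]:
  "partial_symbol [] y = 1"
  "partial_symbol (e # es) y = - \<i> * of_real (y \<bullet> e) * partial_symbol es y"
  by (auto simp: partial_symbol_def)

lemma partial_symbol_measurable [measurable]: "partial_symbol es \<in> borel_measurable borel"
  by (induction es) auto

lemma partial_symbol_bound:
  assumes "set es \<subseteq> Basis"
  shows "norm (partial_symbol es y) \<le> (1 + norm y) ^ length es"
  using assms
proof (induction es)
  case (Cons e es)
  have "\<bar>y \<bullet> e\<bar> \<le> 1 + norm y" using Basis_le_norm[of e y] Cons.prems by simp
  then show ?case using Cons by (auto simp: norm_mult intro!: mult_mono)
qed simp

text \<open>Each derivative multiplies the symbol by a factor of size at most
  \<open>1 + norm y\<close>, so it uses up one of the k powers of the weight.\<close>

lemma inv_ft_smooth: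
  fixes u :: "'a::euclidean_space \<Rightarrow> complex"
  assumes [measurable]: "u \<in> borel_measurable borel"
    and "integrable lborel (\<lambda>y. (1 + norm y) ^ k * norm (u y))"
  shows "C_k k (inv_ft u)"
    and "set es \<subseteq> Basis \<Longrightarrow> length es \<le> k \<Longrightarrow> iter_partial es (inv_ft u) = inv_ft (\<lambda>y. partial_symbol es y * u y)"
proof -
  have less: "integrable lborel (\<lambda>y. (1 + norm y) ^ j * norm (v y))"
    if "integrable lborel (\<lambda>y. (1 + norm y) ^ k * norm (v y))" "j \<le> k" "v \<in> borel_measurable borel"
    for j k and v :: "'a \<Rightarrow> complex"
  proof (rule Bochner_Integration.integrable_bound[OF that(1)])
    show "AE y in lborel. norm ((1 + norm y) ^ j * norm (v y)) \<le> norm ((1 + norm y) ^ k * norm (v y))"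
      using that by (intro AE_I2) (auto simp: norm_mult intro!: mult_right_mono power_increasing)
  qed (use that(3) in measurable)
  show "C_k k (inv_ft u)"
    using assms
  proof (induction k arbitrary: u)
    case 0
    then show ?case by (auto intro!: inv_ft_continuous simp: integrable_norm_iff)
  next
    case (Suc k)
    note [measurable] = Suc.prems(1)
    have i0: "integrable lborel u"
      using less[OF Suc.prems(2), of 0] Suc.prems(1) by (simp add: integrable_norm_iff)
    have i1: "integrable lborel (\<lambda>y. (1 + norm y) * norm (u y))"
      using less[OF Suc.prems(2), of 1] Suc.prems(1) by simp
    show ?case
      unfolding C_k.simps
    proof (intro conjI ballI allI)
      show "continuous_on UNIV (inv_ft u)" by (rule inv_ft_continuous[OF i0])
      fix e :: 'a assume e: "e \<in> Basis"
      note d = inv_ft_partial[OF Suc.prems(1) i1, of e]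
      show "(\<lambda>t::real. inv_ft u (x + t *\<^sub>R e)) differentiable at 0" for x
        using d[of x] e real_differentiable_def by auto
      have "partial_deriv e (inv_ft u) = inv_ft (\<lambda>y. - \<i> * of_real (y \<bullet> e) * u y)"
        using d e by (auto simp: partial_deriv_def fun_eq_iff DERIV_imp_deriv)
      moreover have "C_k k (inv_ft (\<lambda>y. - \<i> * of_real (y \<bullet> e) * u y))"
      proof (rule Suc.IH)
        show "integrable lborel (\<lambda>y. (1 + norm y) ^ k * norm (- \<i> * of_real (y \<bullet> e) * u y))"
        proof (rule Bochner_Integration.integrable_bound[OF Suc.prems(2)])
          have "\<bar>y \<bullet> e\<bar> \<le> 1 + norm y" for y using Basis_le_norm[OF e, of y] by simp
          then have "(1 + norm y) ^ k * (\<bar>y \<bullet> e\<bar> * norm (u y)) \<le> (1 + norm y) ^ k * ((1 + norm y) * norm (u y))" for y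
            by (intro mult_left_mono mult_right_mono) auto
          then show "AE y in lborel. norm ((1 + norm y) ^ k * norm (- \<i> * of_real (y \<bullet> e) * u y)) \<le> norm ((1 + norm y) ^ Suc k * norm (u y))"
            by (intro AE_I2) (simp add: norm_mult abs_mult mult_ac)
        qed measurable
      qed measurable
      ultimately show "C_k k (partial_deriv e (inv_ft u))" by simp
    qed
  qed
  show "iter_partial es (inv_ft u) = inv_ft (\<lambda>y. partial_symbol es y * u y)"
    if "set es \<subseteq> Basis" "length es \<le> k"
    using that
  proof (induction es)
    case (Cons e es)
    let ?v = "\<lambda>y. partial_symbol es y * u y"
    have m: "?v \<in> borel_measurable borel" by measurable
    have "integrable lborel (\<lambda>y. (1 + norm y) * norm (?v y))"
    proof (rule Bochner_Integration.integrable_bound[OF less[OF assms(2), of "Suc (length es)"]])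
      have "(1 + norm y) * (norm (partial_symbol es y) * norm (u y)) \<le> (1 + norm y) * ((1 + norm y) ^ length es * norm (u y))" for y
        using partial_symbol_bound[of es y] Cons.prems by (intro mult_left_mono mult_right_mono) auto
      then show "AE y in lborel. norm ((1 + norm y) * norm (?v y)) \<le> norm ((1 + norm y) ^ Suc (length es) * norm (u y))"
        by (intro AE_I2) (simp add: norm_mult abs_mult mult_ac)
    qed (use Cons.prems in auto)
    from inv_ft_partial[OF m this, of e] Cons.prems
    have "partial_deriv e (inv_ft ?v) = inv_ft (\<lambda>y. - \<i> * of_real (y \<bullet> e) * ?v y)"
      by (auto simp: partial_deriv_def fun_eq_iff DERIV_imp_deriv)
    with Cons show ?case by (simp add: mult.assoc)
  qed simp
qed

lemma C_k_imp_continuous: "C_k k f \<Longrightarrow> continuous_on UNIV f"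
  by (cases k) auto

text \<open>A nonempty open set contains a box of positive volume. This turns almost everywhere
  statements about continuous densities into pointwise ones.\<close>

lemma open_AE_notin_empty:
  fixes S :: "'a::euclidean_space set"
  assumes "open S" "AE x in lborel. x \<notin> S"
  shows "S = {}"
proof (rule ccontr)
  assume "S \<noteq> {}"
  then obtain x e where "e > 0" "ball x e \<subseteq> S" using assms(1) open_contains_ball by blast
  then obtain a b where ab: "x \<in> box a b" "box a b \<subseteq> S"
    using rational_boxes[of e x] by (metis subset_trans)
  have ae: "AE x in lborel. x \<notin> box a b" using assms(2) ab by (auto elim!: eventually_mono)
  have z: "emeasure lborel (box a b) = 0"
    by (subst AE_iff_measurable[of "box a b" lborel "\<lambda>x. x \<notin> box a b", symmetric]) (use ae in auto)
  have lt: "\<And>i. i \<in> Basis \<Longrightarrow> a \<bullet> i < b \<bullet> i" using ab(1) by (auto simp: mem_box intro: less_trans)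
  then have "0 < (\<Prod>i\<in>Basis. (b - a) \<bullet> i)" "\<And>i. i \<in> Basis \<Longrightarrow> a \<bullet> i \<le> b \<bullet> i"
    by (auto intro!: prod_pos simp: inner_diff_left less_imp_le)
  moreover have "(\<Prod>i\<in>Basis. (b - a) \<bullet> i) \<le> 0" using z calculation(2) by (simp add: emeasure_lborel_box_eq ennreal_eq_0_iff del: prod_zero_iff)
  ultimately show False by linarith
qed

lemma continuous_density_unique:
  assumes "continuous_density M G" "continuous_density M H"
  shows "G = H"
proof -
  have c: "continuous_on UNIV G" "continuous_on UNIV H" and nn: "\<And>x. 0 \<le> G x" "\<And>x. 0 \<le> H x"
    and e: "density lborel (\<lambda>x. ennreal (G x)) = density lborel (\<lambda>x. ennreal (H x))"
    using assms by (auto simp: continuous_density_def)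
  have [measurable]: "G \<in> borel_measurable borel" "H \<in> borel_measurable borel"
    using c by (auto intro: borel_measurable_continuous_onI)
  have "AE x in lborel. ennreal (G x) = ennreal (H x)"
    by (rule sigma_finite_measure.density_unique[OF sigma_finite_lborel _ _ e]) auto
  then have "AE x in lborel. x \<in> {x. G x \<noteq> H x} \<longrightarrow> False" using nn by (auto elim!: eventually_mono)
  then have ae: "AE x in lborel. x \<notin> {x. G x \<noteq> H x}" by auto
  have op: "open {x. G x \<noteq> H x}" by (rule open_Collect_neq[OF c])
  from open_AE_notin_empty[OF op ae] show ?thesis by auto
qed

lemma continuous_density_support:
  assumes G: "continuous_density M G" and z: "emeasure M (- cball 0 R) = 0" and x: "norm x > R"
  shows "G x = 0"
proof -
  define H where "H x = (if norm x > R then 0 else G x)" for x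
  have c: "continuous_on UNIV G" and nn: "\<And>x. 0 \<le> G x" and M: "M = density lborel (\<lambda>x. ennreal (G x))"
    using G by (auto simp: continuous_density_def)
  have [measurable]: "G \<in> borel_measurable borel"
    using c by (auto intro: borel_measurable_continuous_onI)
  have "AE x in lborel. ennreal (G x) * indicator (- cball 0 R) x = 0"
    using z unfolding M by (subst (asm) emeasure_density) (auto simp: nn_integral_0_iff_AE)
  then have "AE x in lborel. x \<notin> {x. G x \<noteq> 0} \<inter> - cball 0 R" 
    using nn by (auto elim!: eventually_mono simp: indicator_def ennreal_eq_0_iff split: if_splits) (metis order_antisym)
  moreover have op: "open ({x. G x \<noteq> 0} \<inter> - cball 0 R)"
    by (intro open_Int open_Collect_neq c) auto
  ultimately have "{x. G x \<noteq> 0} \<inter> - cball 0 R = {}"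
    by (intro open_AE_notin_empty)
  then show ?thesis using x by auto
qed

text \<open>S is open, so along each line through x the function agrees with 0 near the parameter 0,
  and \<open>deriv\<close> returns 0 there.\<close>

lemma iter_partial_zero:
  assumes "open S" "\<And>x. x \<in> S \<Longrightarrow> f x = 0" "x \<in> S"
  shows "iter_partial es f x = 0"
  using assms(3)
proof (induction es arbitrary: x)
  case (Cons e es)
  have "open ((\<lambda>t::real. x + t *\<^sub>R e) -` S)"
    by (intro open_vimage assms continuous_intros)
  then have "eventually (\<lambda>t::real. x + t *\<^sub>R e \<in> S) (nhds 0)"
    using Cons.prems by (intro eventually_nhds[THEN iffD2]) (auto intro!: exI[of _ "(\<lambda>t::real. x + t *\<^sub>R e) -` S"])
  then have "eventually (\<lambda>t::real. iter_partial es f (x + t *\<^sub>R e) = (\<lambda>_. 0) t) (nhds 0)"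
    by eventually_elim (simp add: Cons.IH)
  then have "deriv (\<lambda>t::real. iter_partial es f (x + t *\<^sub>R e)) 0 = deriv (\<lambda>_. 0) 0"
    by (rule deriv_cong_ev) simp
  then show ?case by (simp add: partial_deriv_def)
qed (use assms in simp)

lemma integrable_gaussian:
  assumes "\<alpha> > 0"
  shows "integrable lborel (\<lambda>x::'a::euclidean_space. exp (- \<alpha> * (norm x)\<^sup>2))"
proof -
  have "integrable lborel (\<lambda>y::'a. complex_of_real (exp (- (sqrt (2 * \<alpha>))\<^sup>2 * (norm y)\<^sup>2 / 2)))"
    using gauss_kernel_ft(1)[of "sqrt (2 * \<alpha>)" "0::'a"] assms by simp
  then show ?thesis using assms by (simp add: complex_of_real_integrable_eq)
qed

text \<open>Pointwise convergence of densities under one Gaussian majorant yields everything by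
  dominated convergence. Since the majorant holds only from N on, the sequence is shifted
  first.\<close>

lemma weakly_converges_densities:
  fixes G :: "nat \<Rightarrow> 'a::euclidean_space \<Rightarrow> real"
  assumes M: "\<And>n. n \<ge> N \<Longrightarrow> continuous_density (M n) (G n)"
    and H: "continuous_on UNIV H" and lim: "\<And>x. (\<lambda>n. G n x) \<longlonglongrightarrow> H x"
    and bd: "\<And>n x. n \<ge> N \<Longrightarrow> \<bar>G n x\<bar> \<le> K * exp (- \<alpha> * (norm x)\<^sup>2)" and \<alpha>: "\<alpha> > 0"
  shows "weakly_converges M (density lborel (\<lambda>x. ennreal (H x)))"
    and "continuous_density (density lborel (\<lambda>x. ennreal (H x))) H"
    and "\<bar>H x\<bar> \<le> K * exp (- \<alpha> * (norm x)\<^sup>2)"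
proof -
  have G: "continuous_on UNIV (G n)" "0 \<le> G n x" "M n = density lborel (\<lambda>x. ennreal (G n x))" if "n \<ge> N" for n x
    using M[OF that] by (auto simp: continuous_density_def)
  have Gm: "G n \<in> borel_measurable borel" if "n \<ge> N" for n
    using G(1)[OF that] by (auto intro: borel_measurable_continuous_onI)
  have [measurable]: "H \<in> borel_measurable borel"
    using H by (auto intro: borel_measurable_continuous_onI)
  have H0: "H x \<ge> 0" for x
    using G(2) by (intro LIMSEQ_le_const[OF lim]) auto
  have Hb: "\<bar>H x\<bar> \<le> K * exp (- \<alpha> * (norm x)\<^sup>2)" for x
    using bd by (intro LIMSEQ_le_const2[OF tendsto_rabs[OF lim]]) auto
  then show "\<bar>H x\<bar> \<le> K * exp (- \<alpha> * (norm x)\<^sup>2)" .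
  show "continuous_density (density lborel (\<lambda>x. ennreal (H x))) H"
    using H H0 by (simp add: continuous_density_def)
  have gi: "integrable lborel (\<lambda>x::'a. c * (K * exp (- \<alpha> * (norm x)\<^sup>2)))" for c
    using integrable_gaussian[OF \<alpha>, where ?'a = 'a] by (intro integrable_mult_right) simp
  have Hi: "integrable lborel H"
    using Hb by (intro Bochner_Integration.integrable_bound[OF gi[of 1]]) (auto intro!: AE_I2 order_trans[OF Hb])
  have "emeasure (density lborel (\<lambda>x. ennreal (H x))) UNIV = (\<integral>\<^sup>+x. ennreal (H x) \<partial>lborel)"
    by (simp add: emeasure_density)
  also have "\<dots> < \<infinity>" using Hi H0 by (simp add: integrable_iff_bounded)
  finally have fin: "finite_measure (density lborel (\<lambda>x. ennreal (H x)))"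
    by (intro finite_measureI) auto
  show "weakly_converges M (density lborel (\<lambda>x. ennreal (H x)))"
    unfolding weakly_converges_def
  proof (intro conjI allI impI fin)
    fix f :: "'a \<Rightarrow> real"
    assume f: "continuous_on UNIV f" "bounded (range f)"
    have [measurable]: "f \<in> borel_measurable borel"
      using f by (auto intro: borel_measurable_continuous_onI)
    obtain C where C: "\<And>x. \<bar>f x\<bar> \<le> C" using f(2) unfolding bounded_iff by auto
    have C0: "C \<ge> 0" using C[of undefined] by linarith
    have "(\<lambda>n. \<integral>x. G (n + N) x * f x \<partial>lborel) \<longlonglongrightarrow> (\<integral>x. H x * f x \<partial>lborel)"
    proof (rule integral_dominated_convergence[where w = "\<lambda>x. C * (K * exp (- \<alpha> * (norm x)\<^sup>2))"])
      show "AE x in lborel. (\<lambda>n. G (n + N) x * f x) \<longlonglongrightarrow> H x * f x"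
        using lim by (intro AE_I2 tendsto_intros) (rule LIMSEQ_ignore_initial_segment)
      show "AE x in lborel. norm (G (n + N) x * f x) \<le> C * (K * exp (- \<alpha> * (norm x)\<^sup>2))" for n
        unfolding real_norm_def abs_mult mult.commute[of "\<bar>G (n + N) _\<bar>"]
        by (intro AE_I2 mult_mono C bd) (use C0 in auto)
    qed (use Gm gi in auto)
    moreover have "(\<integral>x. G (n + N) x * f x \<partial>lborel) = integral\<^sup>L (M (n + N)) f" for n
      using G(2)[of "n + N"] Gm[of "n + N"] by (simp add: G(3)[of "n + N"] integral_density)
    moreover have "(\<integral>x. H x * f x \<partial>lborel) = integral\<^sup>L (density lborel (\<lambda>x. ennreal (H x))) f"
      using H0 by (simp add: integral_density)
    ultimately have "(\<lambda>n. integral\<^sup>L (M (n + N)) f) \<longlonglongrightarrow> integral\<^sup>L (density lborel (\<lambda>x. ennreal (H x))) f"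
      by simp
    then show "(\<lambda>n. integral\<^sup>L (M n) f) \<longlonglongrightarrow> integral\<^sup>L (density lborel (\<lambda>x. ennreal (H x))) f"
      by (rule LIMSEQ_offset)
  qed simp
qed

section \<open>Oscillatory integrals on the circle\<close>

lemma periodic_integral_zero:
  fixes F :: "real \<Rightarrow> 'b::euclidean_space"
  assumes "\<And>t. (F has_vector_derivative f t) (at t)" and "F 1 = F 0"
  shows "(f has_integral 0) {0..1}"
  using fundamental_theorem_of_calculus[of 0 1 F f] assms
  by (auto intro: has_vector_derivative_at_within)

lemma iexp_comp_deriv:
  assumes "(f has_real_derivative f') (at t)"
  shows "((\<lambda>t. iexp (f t)) has_vector_derivative \<i> * of_real f' * iexp (f t)) (at t)"
proof -
  have "((\<lambda>t. \<i> * of_real (f t)) has_vector_derivative \<i> * of_real f') (at t)"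
    by (intro has_vector_derivative_mult_right has_vector_derivative_of_real assms)
  from field_vector_diff_chain_at[OF this DERIV_exp]
  show ?thesis by (simp add: o_def)
qed

text \<open>
  Multiplying the integrand by \<open>(\<psi>'\<^sup>2 + \<delta>\<^sup>2) / (\<psi>'\<^sup>2 + \<delta>\<^sup>2)\<close> with \<open>\<delta> = sqrt a\<close>
  and integrating by parts over a full period reduces the estimate to a bound for
  the integral of \<open>1 / (\<psi>'\<^sup>2 + \<delta>\<^sup>2)\<close>. That integral is bounded by means of
  \<open>c a\<^sup>2 \<le> \<psi>'\<^sup>2 + \<psi>''\<^sup>2\<close> and another integration by parts, in which \<open>arctan (\<psi>' / \<delta>)\<close>
  is the antiderivative; no splitting at the stationary points is needed.
\<close>

lemma oscillatory_integral_bound: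
  fixes f f1 f2 f3 :: "real \<Rightarrow> real"
  assumes d0: "\<And>t. (f has_real_derivative f1 t) (at t)"
    and d1: "\<And>t. (f1 has_real_derivative f2 t) (at t)"
    and d2: "\<And>t. (f2 has_real_derivative f3 t) (at t)"
    and c3: "continuous_on UNIV f3"
    and per: "f 1 = f 0" "f1 1 = f1 0" "f2 1 = f2 0"
    and b2: "\<And>t. \<bar>f2 t\<bar> \<le> C * a" and b3: "\<And>t. \<bar>f3 t\<bar> \<le> C * a"
    and low: "\<And>t. c * a\<^sup>2 \<le> (f1 t)\<^sup>2 + (f2 t)\<^sup>2"
    and a: "a \<ge> 1" and c: "c > 0" and C: "C \<ge> 0"
  shows "norm (integral {0..1} (\<lambda>t. iexp (f t))) \<le> (C + 1) * (1 + 2 * C) / c / sqrt a"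
proof -
  define \<delta> where "\<delta> = sqrt a"
  have \<delta>: "\<delta> > 0" "\<delta>\<^sup>2 = a" using a by (auto simp: \<delta>_def)
  define D where "D t = (f1 t)\<^sup>2 + \<delta>\<^sup>2" for t
  have D: "D t > 0" for t using \<delta> by (auto simp: D_def intro: add_nonneg_pos)
  have c0: "continuous_on S f" for S
    using d0 by (meson DERIV_continuous_on DERIV_subset subset_UNIV)
  have c1: "continuous_on S f1" for S
    using d1 by (meson DERIV_continuous_on DERIV_subset subset_UNIV)
  have c2: "continuous_on S f2" for S
    using d2 by (meson DERIV_continuous_on DERIV_subset subset_UNIV)
  have c3: "continuous_on S f3" for S using c3 continuous_on_subset by blast
  have cD: "continuous_on S D" for S unfolding D_def[abs_def] by (intro continuous_intros c1)
  have Dne: "D t \<noteq> 0" for t using D[of t] by simp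
  define I where "I = integral {0..1} (\<lambda>t. 1 / D t)"
  have iD: "(\<lambda>t. 1 / D t) integrable_on {0..1}"
    by (intro integrable_continuous_interval continuous_intros cD) (use Dne in auto)
  have dD: "(D has_real_derivative 2 * f1 t * f2 t) (at t)" for t
    unfolding D_def[abs_def] by (auto intro!: derivative_eq_intros d1)
  define h1 where "h1 t = f2 t * (\<delta>\<^sup>2 - (f1 t)\<^sup>2) / (D t)\<^sup>2" for t
  have dh: "((\<lambda>t. f1 t / D t) has_real_derivative h1 t) (at t)" for t
  proof -
    have "((\<lambda>t. f1 t / D t) has_real_derivative (f2 t * D t - f1 t * (2 * f1 t * f2 t)) / (D t * D t)) (at t)"
      by (rule DERIV_divide[OF d1 dD Dne])
    also have "(f2 t * D t - f1 t * (2 * f1 t * f2 t)) / (D t * D t) = h1 t"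
      unfolding h1_def by (simp add: D_def power2_eq_square algebra_simps)
    finally show ?thesis .
  qed
  have dexp: "((\<lambda>t. iexp (f t)) has_vector_derivative \<i> * of_real (f1 t) * iexp (f t)) (at t)" for t
    by (rule iexp_comp_deriv[OF d0])
  have dF: "((\<lambda>t. iexp (f t) * of_real (f1 t / D t)) has_vector_derivative
      (\<i> * of_real (f1 t) * iexp (f t) * of_real (f1 t / D t) + iexp (f t) * of_real (h1 t))) (at t)" for t
    using has_vector_derivative_mult[OF dexp has_vector_derivative_of_real[OF dh]]
    by (simp add: add.commute)
  have F0: "((\<lambda>t. \<i> * of_real (f1 t) * iexp (f t) * of_real (f1 t / D t) + iexp (f t) * of_real (h1 t)) has_integral 0) {0..1}"
    by (rule periodic_integral_zero[OF dF]) (simp add: D_def per)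
  \<comment> \<open>What remains of the integrand after subtracting \<open>- \<i>\<close> times the
    derivative of \<open>iexp (f t) * of_real (f1 t / D t)\<close>, which integrates to 0 over a
    period.\<close>
  define g where "g t = iexp (f t) * (\<i> * of_real (h1 t) + of_real (\<delta>\<^sup>2 / D t))" for t
  have gint: "g integrable_on {0..1}"
    unfolding g_def h1_def by (intro integrable_continuous_interval continuous_intros cD c0 c1 c2) (use Dne in auto)
  have split: "iexp (f t) = g t - \<i> * (\<i> * of_real (f1 t) * iexp (f t) * of_real (f1 t / D t) + iexp (f t) * of_real (h1 t))" for t
  proof -
    have "(f1 t * f1 t + \<delta>\<^sup>2) / D t = 1" using Dne[of t] by (simp add: D_def power2_eq_square)
    then have key: "complex_of_real (f1 t) * of_real (f1 t / D t) + of_real (\<delta>\<^sup>2 / D t) = 1"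
      by (metis add_divide_distrib of_real_1 of_real_add of_real_mult times_divide_eq_right)
    have "g t - \<i> * (\<i> * of_real (f1 t) * iexp (f t) * of_real (f1 t / D t) + iexp (f t) * of_real (h1 t))
       = iexp (f t) * (complex_of_real (f1 t) * of_real (f1 t / D t) + of_real (\<delta>\<^sup>2 / D t))"
      unfolding g_def by (simp add: algebra_simps)
    then show ?thesis unfolding key by simp
  qed
  have "((\<lambda>t. g t - \<i> * (\<i> * of_real (f1 t) * iexp (f t) * of_real (f1 t / D t) + iexp (f t) * of_real (h1 t))) has_integral (integral {0..1} g - \<i> * 0)) {0..1}"
    by (intro has_integral_diff integrable_integral gint has_integral_mult_right F0)
  then have eq: "integral {0..1} (\<lambda>t. iexp (f t)) = integral {0..1} g"
    unfolding split[symmetric] by (simp add: integral_unique)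
  have gb: "norm (g t) \<le> (C * a + a) * (1 / D t)" for t
  proof -
    have "norm (g t) \<le> \<bar>h1 t\<bar> + \<delta>\<^sup>2 / D t"
      using norm_triangle_ineq[of "\<i> * of_real (h1 t)" "of_real (\<delta>\<^sup>2 / D t)"] D[of t]
      unfolding g_def norm_mult norm_of_real by (simp del: of_real_divide of_real_power)
    also have "\<bar>h1 t\<bar> \<le> C * a * (1 / D t)"
    proof -
      have "\<bar>\<delta>\<^sup>2 - (f1 t)\<^sup>2\<bar> \<le> D t" unfolding D_def by (auto simp: abs_le_iff)
      then have "\<bar>f2 t\<bar> * \<bar>\<delta>\<^sup>2 - (f1 t)\<^sup>2\<bar> \<le> (C * a) * D t"
        using b2[of t] D[of t] C a by (intro mult_mono) auto
      then show ?thesis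
        using D[of t] by (simp add: h1_def abs_mult power2_eq_square divide_simps)
    qed
    finally show ?thesis by (simp add: \<delta> algebra_simps add_divide_distrib)
  qed
  have "norm (integral {0..1} g) \<le> integral {0..1} (\<lambda>t. (C * a + a) * (1 / D t))"
    by (rule integral_norm_bound_integral[OF gint _ gb]) (use integrable_on_cmult_left[OF iD, of "C * a + a"] in simp)
  then have r1: "norm (integral {0..1} (\<lambda>t. iexp (f t))) \<le> (C * a + a) * I"
    unfolding eq I_def integral_mult_right .
  have dA: "((\<lambda>t. f2 t * arctan (f1 t / \<delta>)) has_real_derivative (f3 t * arctan (f1 t / \<delta>) + \<delta> * ((f2 t)\<^sup>2 / D t))) (at t)" for t
  proof -
    have "((\<lambda>t. f2 t * arctan (f1 t / \<delta>)) has_real_derivative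
        (f3 t * arctan (f1 t / \<delta>) + (inverse (1 + (f1 t / \<delta>)\<^sup>2) * (f2 t / \<delta>)) * f2 t)) (at t)"
      by (intro DERIV_mult d2 DERIV_chain2[OF DERIV_arctan] DERIV_cdivide d1)
    also have "(inverse (1 + (f1 t / \<delta>)\<^sup>2) * (f2 t / \<delta>)) * f2 t = \<delta> * ((f2 t)\<^sup>2 / D t)"
    proof -
      have "1 + (f1 t / \<delta>)\<^sup>2 = D t / \<delta>\<^sup>2" using \<delta>(1) by (simp add: D_def field_simps)
      then show ?thesis using \<delta>(1) D[of t] by (simp add: power2_eq_square)
    qed
    finally show ?thesis .
  qed
  have A0: "((\<lambda>t. f3 t * arctan (f1 t / \<delta>) + \<delta> * ((f2 t)\<^sup>2 / D t)) has_integral 0) {0..1}"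
    by (rule periodic_integral_zero[OF dA[unfolded has_real_derivative_iff_has_vector_derivative]]) (simp add: per)
  \<comment> \<open>Since |arctan| \<le> 2, the term with \<open>f3\<close> is at least
    \<open>- (2 * C * a) / \<delta>\<close>. Hence the derivative of
    \<open>f2 t * arctan (f1 t / \<delta>)\<close>, divided by \<delta>, can stand in for
    \<open>(f2 t)\<^sup>2 / D t\<close> at the price of a constant, and it vanishes on
    integration.\<close>
  have pw: "c * a\<^sup>2 * (1 / D t) \<le> 1 + 2 * C * a / \<delta> + (f3 t * arctan (f1 t / \<delta>) + \<delta> * ((f2 t)\<^sup>2 / D t)) / \<delta>" for t
  proof -
    have "c * a\<^sup>2 * (1 / D t) \<le> ((f1 t)\<^sup>2 + (f2 t)\<^sup>2) * (1 / D t)"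
      using low[of t] D[of t] by (intro mult_right_mono) auto
    also have "\<dots> \<le> 1 + (f2 t)\<^sup>2 / D t"
      using D[of t] by (simp add: add_divide_distrib) (simp add: D_def)
    finally have 1: "c * a\<^sup>2 * (1 / D t) \<le> 1 + (f2 t)\<^sup>2 / D t" .
    have "\<bar>arctan (f1 t / \<delta>)\<bar> \<le> 2" using arctan_bounded[of "f1 t / \<delta>"] pi_less_4 by (simp add: abs_if)
    then have "\<bar>f3 t * arctan (f1 t / \<delta>)\<bar> \<le> (C * a) * 2"
      unfolding abs_mult using b3[of t] C a by (intro mult_mono) auto
    then have "- (2 * C * a) / \<delta> \<le> f3 t * arctan (f1 t / \<delta>) / \<delta>"
      using \<delta>(1) by (intro divide_right_mono) auto
    with 1 \<delta>(1) show ?thesis by (simp add: add_divide_distrib)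
  qed
  have "c * a\<^sup>2 * I \<le> (1 + 2 * C * a / \<delta>)"
  proof -
    have i1: "((\<lambda>t. c * a\<^sup>2 * (1 / D t)) has_integral c * a\<^sup>2 * I) {0..1}"
      unfolding I_def by (intro has_integral_mult_right integrable_integral iD)
    have i2: "((\<lambda>t. (1 + 2 * C * a / \<delta>) + (f3 t * arctan (f1 t / \<delta>) + \<delta> * ((f2 t)\<^sup>2 / D t)) / \<delta>) has_integral (1 + 2 * C * a / \<delta>) + 0 / \<delta>) {0..1}"
      by (rule has_integral_add[OF _ has_integral_divide[OF A0]])
         (use has_integral_const_real[of "1 + 2 * C * a / \<delta>" 0 1] in simp)
    show ?thesis using has_integral_le[OF i1 i2] pw by simp
  qed
  also have "\<dots> \<le> (1 + 2 * C) * \<delta>"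
  proof -
    have "\<delta> \<ge> 1" using a by (simp add: \<delta>_def)
    moreover have "a / \<delta> = \<delta>" using \<delta> by (metis \<delta>_def real_div_sqrt a order_trans zero_le_one)
    then have "2 * C * a / \<delta> = 2 * C * \<delta>" by (metis times_divide_eq_right)
    ultimately show ?thesis by (simp add: algebra_simps)
  qed
  finally have "c * a\<^sup>2 * I \<le> (1 + 2 * C) * \<delta>" .
  then have r2: "I \<le> (1 + 2 * C) * \<delta> / (c * a\<^sup>2)"
    using c a by (simp add: divide_simps mult.commute)
  have "(C * a + a) * I \<le> (C * a + a) * ((1 + 2 * C) * \<delta> / (c * a\<^sup>2))"
    using r2 C a by (intro mult_left_mono) auto
  also have "\<dots> = (C + 1) * (1 + 2 * C) / c * (\<delta> / a)"
    using a c by (simp add: power2_eq_square field_simps)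
  also have "\<delta> / a = 1 / sqrt a" using a by (simp add: \<delta>_def divide_simps)
  finally show ?thesis using r1 by simp
qed

section \<open>Power series restricted to the unit circle\<close>

lemma power_series_has_derivative:
  assumes sr: "summable (\<lambda>k. c k * of_real r ^ k)" and "r > 1" "norm (z::complex) \<le> 1"
  shows "((\<lambda>z. \<Sum>k. c k * z ^ k) has_field_derivative (\<Sum>k. diffs c k * z ^ k)) (at z)"
    and "summable (\<lambda>k. diffs c k * z ^ k)"
proof -
  have z: "norm z < norm (complex_of_real r)" using assms by simp
  show "((\<lambda>z. \<Sum>k. c k * z ^ k) has_field_derivative (\<Sum>k. diffs c k * z ^ k)) (at z)"
    by (rule termdiffs_strong[OF sr z])
  show "summable (\<lambda>k. diffs c k * z ^ k)"
    by (rule termdiff_converges[OF z]) (rule powser_inside[OF sr])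
qed

text \<open>The index \<open>i\<close> counts applications of \<open>z d/dz\<close>.\<close>

definition circle_series :: "(nat \<Rightarrow> complex) \<Rightarrow> nat \<Rightarrow> real \<Rightarrow> complex" where
  "circle_series d i t = (\<Sum>k. of_nat k ^ i * d k * iexp (- 2 * pi * t) ^ k)"

text \<open>In use \<open>rho\<close> is p^(\<theta> - \<sigma>) and \<open>d k\<close> is built
  from b(p^k) p^(-k \<sigma>). The missing constant term is what makes the local logarithm have mean
  zero on the circle.\<close>

locale circle_coeffs =
  fixes d :: "nat \<Rightarrow> complex" and B rho :: real
  assumes d_0: "d 0 = 0" and d_bound: "\<And>k. norm (d k) \<le> B * rho ^ k"
    and lam: "0 \<le> rho" "rho < 1"
begin

lemma B_nonneg: "B \<ge> 0"
  using d_bound[of 0] by (simp add: d_0)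

text \<open>Write r = s * s. One of the two powers s^k absorbs a factor k, the other leaves the same
  claim for a smaller exponent of k.\<close>

lemma summable_majorant:
  assumes "0 \<le> r" "r < 1"
  shows "summable (\<lambda>k. real k ^ i * r ^ k)"
  using assms
proof (induction i arbitrary: r)
  case (Suc i)
  show ?case
  proof (cases "r = 0")
    case False
    define s where "s = sqrt r"
    have s: "0 < s" "s < 1" "r = s * s" using Suc.prems False by (auto simp: s_def)
    have "Bseq (\<lambda>k. real k * s ^ k)"
      by (rule convergent_imp_Bseq, rule convergentI, rule powser_times_n_limit_0) (use s in simp)
    then have "\<exists>K>0. \<forall>k. norm (real k * s ^ k) \<le> K"
      unfolding Bseq_def .
    then obtain K where K: "\<forall>k. norm (real k * s ^ k) \<le> K" by (elim exE conjE)
    have "summable (\<lambda>k. K * (real k ^ i * s ^ k))"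
      using Suc.IH[of s] s by (intro summable_mult) auto
    then show ?thesis
    proof (rule summable_comparison_test'[of _ 0])
      fix k
      have "(real k * s ^ k) * (real k ^ i * s ^ k) \<le> K * (real k ^ i * s ^ k)"
        by (rule mult_right_mono[OF order_trans[OF abs_ge_self K[rule_format, unfolded real_norm_def]]]) (use s in simp)
      moreover have "norm (real k ^ Suc i * r ^ k) = (real k * s ^ k) * (real k ^ i * s ^ k)"
        unfolding s(3) power_mult_distrib using s(1) by (simp add: abs_mult)
      ultimately show "norm (real k ^ Suc i * r ^ k) \<le> K * (real k ^ i * s ^ k)" by (simp only:)
    qed
  next
    case True
    then have "(\<lambda>k. real k ^ Suc i * r ^ k) = (\<lambda>k. 0)" by (auto simp: fun_eq_iff power_0_left)
    then show ?thesis by simp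
  qed
qed (simp add: summable_geometric)

lemma summable_at_radius:
  "\<exists>r>1. \<forall>i. summable (\<lambda>k. norm (of_nat k ^ i * d k * of_real r ^ k))"
proof -
  \<comment> \<open>Any radius strictly between 1 and 1 / \<open>rho\<close> would do; this choice
    also covers \<open>rho = 0\<close>.\<close>
  define r where "r = 2 / (1 + rho)"
  have r: "r > 1" "rho * r < 1" using lam by (auto simp: r_def less_divide_eq divide_less_eq)
  have s: "summable (\<lambda>k. norm (of_nat k ^ i * d k * of_real r ^ k))" for i
  proof (rule summable_comparison_test'[of "\<lambda>k. B * (real k ^ i * (rho * r) ^ k)" 0])
    show "summable (\<lambda>k. B * (real k ^ i * (rho * r) ^ k))"
      using r lam by (intro summable_mult summable_majorant) auto
    fix k
    have "norm (d k) * (real k ^ i * r ^ k) \<le> B * rho ^ k * (real k ^ i * r ^ k)"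
      using d_bound r by (intro mult_right_mono) auto
    then show "norm (norm (of_nat k ^ i * d k * of_real r ^ k)) \<le> B * (real k ^ i * (rho * r) ^ k)"
      using r by (simp add: norm_mult norm_power power_mult_distrib mult_ac)
  qed
  show ?thesis using r(1) s by blast
qed

lemma summable_series: "norm z \<le> 1 \<Longrightarrow> summable (\<lambda>k. norm (of_nat k ^ i * d k * z ^ k))"
proof -
  assume z: "norm z \<le> 1"
  obtain r where r: "r > 1" "\<And>i. summable (\<lambda>k. norm (of_nat k ^ i * d k * of_real r ^ k))"
    using summable_at_radius by blast
  show ?thesis
  proof (rule summable_comparison_test'[OF r(2)[of i], of 0])
    fix k
    have "norm z ^ k \<le> r ^ k" using z r by (intro power_mono) auto
    then show "norm (norm (of_nat k ^ i * d k * z ^ k)) \<le> norm (of_nat k ^ i * d k * of_real r ^ k)"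
      using r by (auto simp: norm_mult norm_power intro!: mult_left_mono)
  qed
qed

text \<open>Stated for z D because z d/dz merely raises the power of k, so all derivatives along the
  circle stay in the same family of series.\<close>

lemma power_series_deriv:
  assumes z: "norm z \<le> 1"
  shows "\<exists>D. ((\<lambda>z. \<Sum>k. of_nat k ^ i * d k * z ^ k) has_field_derivative D) (at z)
     \<and> z * D = (\<Sum>k. of_nat k ^ Suc i * d k * z ^ k)"
proof -
  obtain r where r: "r > 1" "\<forall>i. summable (\<lambda>k. norm (of_nat k ^ i * d k * of_real r ^ k))"
    using summable_at_radius by blast
  define c where "c k = of_nat k ^ i * d k" for k
  have "summable (\<lambda>k. norm (c k * of_real r ^ k))"
    using spec[OF r(2), of i] unfolding c_def .
  then have sr: "summable (\<lambda>k. c k * of_real r ^ k)"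
    by (rule summable_norm_cancel)
  note D = power_series_has_derivative(1)[of c r z, OF sr r(1) z]
    and sd = power_series_has_derivative(2)[of c r z, OF sr r(1) z]
  define f where "f k = of_nat k ^ Suc i * d k * z ^ k" for k
  have sf: "f sums suminf f"
    unfolding f_def by (rule summable_sums[OF summable_norm_cancel[OF summable_series[OF z]]])
  have f0: "f 0 = 0" by (simp add: f_def)
  have e: "z * (diffs c k * z ^ k) = f (Suc k)" for k
    unfolding diffs_def f_def c_def by (simp del: of_nat_Suc)
  have "f sums (suminf f + f 0)" unfolding f0 add_0_right by (rule sf)
  then have "(\<lambda>k. z * (diffs c k * z ^ k)) sums suminf f"
    unfolding e by (rule sums_Suc_iff[of f "suminf f", THEN iffD2])
  then have "z * (\<Sum>k. diffs c k * z ^ k) = suminf f"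
    by (rule sums_unique2[OF sums_mult[OF summable_sums[OF sd]]])
  with D show ?thesis unfolding c_def f_def by (intro exI conjI)
qed

lemma circle_series_deriv:
  "(circle_series d i has_vector_derivative (- 2 * of_real pi * \<i> * circle_series d (Suc i) t)) (at t)"
proof -
  define P where "P i z = (\<Sum>k. of_nat k ^ i * d k * z ^ k)" for i and z :: complex
  define e where "e t = iexp (- 2 * pi * t)" for t
  have cs: "circle_series d i = (\<lambda>t. P i (e t))" for i
    by (simp add: circle_series_def P_def e_def fun_eq_iff)
  have "norm (e t) \<le> 1" by (simp add: e_def)
  from power_series_deriv[OF this, of i]
  obtain D where D: "(P i has_field_derivative D) (at (e t))" "e t * D = P (Suc i) (e t)"
    unfolding P_def[symmetric] by (elim exE conjE)
  have "((\<lambda>t. - 2 * pi * t) has_real_derivative - 2 * pi) (at t)"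
    by (auto intro!: derivative_eq_intros)
  from iexp_comp_deriv[OF this]
  have de: "(e has_vector_derivative \<i> * of_real (- 2 * pi) * e t) (at t)"
    unfolding e_def .
  have eq: "\<i> * of_real (- 2 * pi) * e t * D = - 2 * of_real pi * \<i> * P (Suc i) (e t)"
    unfolding D(2)[symmetric] by simp
  have "(P i \<circ> e has_vector_derivative \<i> * of_real (- 2 * pi) * e t * D) (at t)"
    by (rule field_vector_diff_chain_at[OF de D(1)])
  then show ?thesis unfolding cs eq o_def .
qed

lemma circle_series_periodic: "circle_series d i 1 = circle_series d i 0"
proof -
  have "iexp (- 2 * pi * 1) = inverse (exp (2 * of_real pi * \<i>))"
    unfolding exp_minus[symmetric] by (simp add: mult_ac)
  then have "iexp (- 2 * pi * 1) = 1" by simp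
  then show ?thesis unfolding circle_series_def by simp
qed

lemma circle_series_continuous: "continuous_on S (circle_series d i)"
  by (intro continuous_at_imp_continuous_on ballI has_vector_derivative_continuous[OF circle_series_deriv])

text \<open>Up to a constant factor, the series of index \<open>Suc i\<close> is the derivative of
  the periodic series of index i.\<close>

lemma circle_series_mean_Suc: "(circle_series d (Suc i) has_integral 0) {0..1}"
proof -
  have "((\<lambda>t. - 2 * of_real pi * \<i> * circle_series d (Suc i) t) has_integral 0) {0..1}"
    by (rule periodic_integral_zero[OF circle_series_deriv circle_series_periodic])
  from has_integral_mult_right[OF this, of "1 / (- 2 * of_real pi * \<i>)"] show ?thesis by simp
qed

text \<open>The terms with k \<ge> 2 share the factor \<open>rho\<^sup>2\<close>. Replacing the
  other powers of \<open>rho\<close> by those of L leaves a sum that is the same for all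
  primes.\<close>

lemma circle_series_tail:
  assumes L: "rho \<le> L" "L < 1"
  shows "norm (circle_series d i t - d 1 * iexp (- 2 * pi * t)) \<le> B * rho\<^sup>2 * (\<Sum>k. real (k + 2) ^ i * L ^ k)"
proof -
  let ?z = "iexp (- 2 * pi * t)"
  have s: "(\<lambda>k. of_nat k ^ i * d k * ?z ^ k) sums circle_series d i t"
    unfolding circle_series_def by (rule summable_sums[OF summable_norm_cancel[OF summable_series]]) simp
  define f where "f k = of_nat k ^ i * d k * ?z ^ k" for k
  have "(\<lambda>k. f (k + 2)) sums (circle_series d i t - (\<Sum>k<2. f k))"
    by (rule sums_split_initial_segment[OF s[folded f_def]])
  moreover have "(\<Sum>k<2. f k) = d 1 * ?z"
    by (simp add: numeral_2_eq_2 f_def d_0)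
  ultimately have s2: "(\<lambda>k. of_nat (k + 2) ^ i * d (k + 2) * ?z ^ (k + 2)) sums (circle_series d i t - d 1 * ?z)"
    unfolding f_def by (simp only:)
  have sm0: "summable (\<lambda>k. real (k + 2) ^ i * L ^ k)"
  proof (cases "L = 0")
    case False
    have "summable (\<lambda>k. real (k + 2) ^ i * L ^ (k + 2))"
      by (rule summable_ignore_initial_segment[OF summable_majorant]) (use L lam in auto)
    then have "summable (\<lambda>k. (real (k + 2) ^ i * L ^ (k + 2)) * (1 / L\<^sup>2))" by (rule summable_mult2)
    then show ?thesis using False by (simp add: power_add power2_eq_square)
  next
    case True
    then show ?thesis by (intro summable_finite[of "{0}"]) auto
  qed
  have sm: "summable (\<lambda>k. B * rho\<^sup>2 * (real (k + 2) ^ i * L ^ k))"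
    by (intro summable_mult sm0)
  have bd: "norm (of_nat (k + 2) ^ i * d (k + 2) * ?z ^ (k + 2)) \<le> B * rho\<^sup>2 * (real (k + 2) ^ i * L ^ k)" for k
  proof -
    have "norm (of_nat (k + 2) ^ i * d (k + 2) * ?z ^ (k + 2)) = real (k + 2) ^ i * norm (d (k + 2))"
      unfolding norm_mult norm_power norm_of_nat by simp
    also have "\<dots> \<le> real (k + 2) ^ i * (B * (rho\<^sup>2 * L ^ k))"
    proof -
      have "norm (d (k + 2)) \<le> B * (rho\<^sup>2 * rho ^ k)" using d_bound[of "k + 2"] by (simp add: power_add mult_ac power2_eq_square)
      also have "\<dots> \<le> B * (rho\<^sup>2 * L ^ k)"
        using L lam B_nonneg by (intro mult_left_mono power_mono) auto
      finally show ?thesis by (intro mult_left_mono) auto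
    qed
    finally show ?thesis by (simp add: mult_ac)
  qed
  have "norm (\<Sum>k. of_nat (k + 2) ^ i * d (k + 2) * ?z ^ (k + 2)) \<le> (\<Sum>k. B * rho\<^sup>2 * (real (k + 2) ^ i * L ^ k))"
    by (rule norm_suminf_le[OF bd sm])
  then have "norm (circle_series d i t - d 1 * ?z) \<le> (\<Sum>k. B * rho\<^sup>2 * (real (k + 2) ^ i * L ^ k))"
    unfolding sums_unique[OF s2] .
  also have "\<dots> = B * rho\<^sup>2 * (\<Sum>k. real (k + 2) ^ i * L ^ k)"
    by (rule suminf_mult[OF sm0])
  finally show ?thesis .
qed

end

section \<open>Weighted random walks on the torus\<close>

abbreviation unit_interval :: "real measure" where
  "unit_interval \<equiv> restrict_space lborel {0..<1}"

interpretation unit_interval: prob_space unit_interval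
  by (rule prob_spaceI) (simp add: emeasure_restrict_space space_restrict_space)

interpretation torus: product_prob_space "\<lambda>_::nat. unit_interval" UNIV
  by unfold_locales

lemma prob_space_torus: "prob_space (torus n)"
  unfolding torus_def by (rule prob_space_PiM) unfold_locales

lemma torus_Suc: "torus (Suc n) = Pi\<^sub>M (insert n {..<n}) (\<lambda>_. unit_interval)"
  by (simp add: torus_def lessThan_Suc)

text \<open>Made for averaging: if u has mean zero and u^2 \<le> c, the linear term drops out and
  the mean of exp u is at most exp c. For u \<le> 1 the proof passes through 1 + u + u^2; for u > 1
  one has u \<le> u^2.\<close>

lemma exp_le_quadratic: "exp u \<le> u + exp (u\<^sup>2)" for u :: real
proof -
  have 1: "1 + u\<^sup>2 \<le> exp (u\<^sup>2)" by (rule exp_ge_add_one_self)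
  show ?thesis
  proof (cases "u \<le> 0")
    case True
    define x where "x = - u"
    have x: "x \<ge> 0" using True by (simp add: x_def)
    have "exp u = 1 / exp x" by (simp add: x_def exp_minus inverse_eq_divide)
    also have "\<dots> \<le> 1 / (1 + x)"
      using x exp_ge_add_one_self[of x] by (intro divide_left_mono mult_pos_pos) auto
    also have "\<dots> \<le> 1 - x + x\<^sup>2"
    proof -
      have "(1 - x + x\<^sup>2) * (1 + x) = 1 + x ^ 3" by (simp add: algebra_simps power2_eq_square power3_eq_cube)
      then have "(1 - x + x\<^sup>2) * (1 + x) \<ge> 1" using x by simp
      then show ?thesis using x by (simp add: divide_le_eq)
    qed
    finally have "exp u \<le> 1 + u + u\<^sup>2" by (simp add: x_def)
    with 1 show ?thesis by linarith
  next
    case False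
    show ?thesis
    proof (cases "u \<le> 1")
      case True
      then have "exp u \<le> 1 + u + u\<^sup>2" using False exp_bound[of u] by simp
      with 1 show ?thesis by linarith
    next
      case False
      then have "u \<le> u\<^sup>2" by (simp add: power2_eq_square)
      then have "exp u \<le> exp (u\<^sup>2)" by simp
      with False show ?thesis by linarith
    qed
  qed
qed

lemma torus_component: "m < n \<Longrightarrow> (\<lambda>t. t m) \<in> torus n \<rightarrow>\<^sub>M unit_interval"
  unfolding torus_def by (rule measurable_component_singleton) simp

text \<open>One sequence \<epsilon> bounds both kinds of steps, since each new coordinate moves the
  weight and the position simultaneously.\<close>

locale random_walk =
  fixes X :: "nat \<Rightarrow> real \<Rightarrow> 'a::euclidean_space" and g :: "nat \<Rightarrow> real \<Rightarrow> complex"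
    and \<epsilon> :: "nat \<Rightarrow> real"
  assumes X_meas [measurable]: "\<And>m. X m \<in> borel_measurable borel"
    and g_meas [measurable]: "\<And>m. g m \<in> borel_measurable borel"
    and X_le: "\<And>m t. norm (X m t) \<le> \<epsilon> m" and g_le: "\<And>m t. norm (g m t) \<le> \<epsilon> m"
    and X_mean: "\<And>m. (\<integral>t. X m t \<partial>unit_interval) = 0" and g_mean: "\<And>m. (\<integral>t. g m t \<partial>unit_interval) = 0"
    and eps_summable: "summable (\<lambda>m. (\<epsilon> m)\<^sup>2)"
begin

definition position :: "nat \<Rightarrow> (nat \<Rightarrow> real) \<Rightarrow> 'a" where
  "position n t = (\<Sum>m<n. X m (t m))"

definition amplitude :: "nat \<Rightarrow> (nat \<Rightarrow> real) \<Rightarrow> complex" where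
  "amplitude n t = (\<Sum>m<n. g m (t m))"

text \<open>The shift B closes the recursion in n: fixing the newest coordinate s turns the weight
  into that of the shorter walk with shift B + g n s. The measures of the theorem have B =
  0.\<close>

definition weighted_law :: "nat \<Rightarrow> complex \<Rightarrow> 'a measure" where
  "weighted_law n B = distr (density (torus n) (\<lambda>t. ennreal ((norm (amplitude n t + B))\<^sup>2))) borel (position n)"

definition wchar :: "nat \<Rightarrow> complex \<Rightarrow> 'a \<Rightarrow> complex" where
  "wchar n B y = (\<integral>t. of_real ((norm (amplitude n t + B))\<^sup>2) * iexp (position n t \<bullet> y) \<partial>torus n)"

lemma eps_nonneg: "\<epsilon> m \<ge> 0"
  using X_le[of m 0] norm_ge_zero order_trans by blast

lemma X_unit [measurable]: "X m \<in> borel_measurable unit_interval"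
  by (rule measurable_restrict_space1) simp

lemma g_unit [measurable]: "g m \<in> borel_measurable unit_interval"
  by (rule measurable_restrict_space1) simp

lemma X_integrable: "integrable unit_interval (X m)"
  by (rule unit_interval.integrable_const_bound[where B = "\<epsilon> m"]) (auto simp: X_le)

lemma g_integrable: "integrable unit_interval (g m)"
  by (rule unit_interval.integrable_const_bound[where B = "\<epsilon> m"]) (auto simp: g_le)

lemma position_measurable [measurable]: "position n \<in> borel_measurable (torus n)"
  unfolding position_def[abs_def]
  by (intro borel_measurable_sum measurable_compose[OF torus_component X_unit]) auto

lemma amplitude_measurable [measurable]: "amplitude n \<in> borel_measurable (torus n)"
  unfolding amplitude_def[abs_def]
  by (intro borel_measurable_sum measurable_compose[OF torus_component g_unit]) auto

lemma position_bound: "norm (position n t) \<le> (\<Sum>m<n. \<epsilon> m)"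
  unfolding position_def by (rule sum_norm_le) (rule X_le)

lemma amplitude_bound: "norm (amplitude n t) \<le> (\<Sum>m<n. \<epsilon> m)"
  unfolding amplitude_def by (rule sum_norm_le) (rule g_le)

lemma position_update: "position (Suc n) (t(n := s)) = position n t + X n s"
  by (simp add: position_def)

lemma amplitude_update: "amplitude (Suc n) (t(n := s)) = amplitude n t + g n s"
  by (simp add: amplitude_def)

lemma weight_bound: "(norm (amplitude n t + B))\<^sup>2 \<le> ((\<Sum>m<n. \<epsilon> m) + norm B)\<^sup>2"
  by (intro power_mono norm_triangle_le) (use amplitude_bound in auto)

lemma weight_integrable: "integrable (torus n) (\<lambda>t. (norm (amplitude n t + B))\<^sup>2)"
proof -
  interpret prob_space "torus n" by (rule prob_space_torus)
  show ?thesis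
    by (rule integrable_const_bound[where B = "((\<Sum>m<n. \<epsilon> m) + norm B)\<^sup>2"]) (use weight_bound in auto)
qed

lemma wchar_integrable:
  "integrable (torus n) (\<lambda>t. of_real ((norm (amplitude n t + B))\<^sup>2) * iexp (position n t \<bullet> y))"
  by (rule Bochner_Integration.integrable_bound[OF weight_integrable[of n B]]) (auto simp: norm_mult norm_power)

lemma sets_weighted_law: "sets (weighted_law n B) = sets borel"
  by (simp add: weighted_law_def)

lemma finite_weighted_law: "finite_measure (weighted_law n B)"
proof -
  have "emeasure (weighted_law n B) (space (weighted_law n B)) = (\<integral>\<^sup>+t. ennreal ((norm (amplitude n t + B))\<^sup>2) \<partial>torus n)"
    unfolding weighted_law_def by (subst emeasure_distr) (auto simp: emeasure_density intro!: nn_integral_cong)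
  also have "\<dots> < \<infinity>"
    using weight_integrable[of n B] by (simp add: integrable_iff_bounded)
  finally show ?thesis by (intro finite_measureI) auto
qed

lemma char_fn_weighted_law: "char_fn (weighted_law n B) = wchar n B"
proof
  fix y
  have "char_fn (weighted_law n B) y = (\<integral>t. iexp (position n t \<bullet> y) \<partial>density (torus n) (\<lambda>t. ennreal ((norm (amplitude n t + B))\<^sup>2)))"
    unfolding char_fn_def weighted_law_def by (subst integral_distr) auto
  also have "\<dots> = (\<integral>t. (norm (amplitude n t + B))\<^sup>2 *\<^sub>R iexp (position n t \<bullet> y) \<partial>torus n)"
    by (subst integral_density) auto
  finally show "char_fn (weighted_law n B) y = wchar n B y"
    by (simp add: wchar_def scaleR_conv_of_real)
qed

lemma wchar_measurable [measurable]: "wchar n B \<in> borel_measurable borel"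
  using char_fn_measurable[OF finite_weighted_law sets_weighted_law] unfolding char_fn_weighted_law .

lemma weighted_law_support: "emeasure (weighted_law n B) (- cball 0 (\<Sum>m<n. \<epsilon> m)) = 0"
proof -
  have "position n -` (- cball 0 (\<Sum>m<n. \<epsilon> m)) \<inter> space (torus n) = {}"
    using position_bound[of n] by (auto simp: not_le[symmetric])
  then show ?thesis unfolding weighted_law_def by (subst emeasure_distr) auto
qed

text \<open>With the newest coordinate innermost, the inner integral can be compared with the
  integrand of \<open>wchar n B\<close>; \<open>wchar_diff\<close> relies on this order.\<close>

lemma wchar_Suc_iterated:
  "wchar (Suc n) B y = (\<integral>t. (\<integral>s. of_real ((norm (amplitude n t + B + g n s))\<^sup>2) * iexp (position n t \<bullet> y) * iexp (X n s \<bullet> y)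
     \<partial>unit_interval) \<partial>torus n)"
proof -
  have "wchar (Suc n) B y = (\<integral>t. (\<integral>s. of_real ((norm (amplitude (Suc n) (t(n := s)) + B))\<^sup>2) * iexp (position (Suc n) (t(n := s)) \<bullet> y)
     \<partial>unit_interval) \<partial>torus n)"
    unfolding wchar_def torus_Suc
    unfolding torus_def
    by (rule torus.product_integral_insert[OF _ _ wchar_integrable[of "Suc n" B y, unfolded torus_Suc]]) auto
  then show ?thesis
    unfolding amplitude_update position_update
    by (simp add: inner_add_left exp_add algebra_simps)
qed

text \<open>The opposite order of integration gives the recursion in n and B.\<close>

lemma wchar_Suc: "wchar (Suc n) B y = (\<integral>s. wchar n (B + g n s) y * iexp (X n s \<bullet> y) \<partial>unit_interval)"
proof -
  interpret T: prob_space "torus n" by (rule prob_space_torus)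
  interpret pair_prob_space "torus n" unit_interval ..
  let ?f = "\<lambda>(t :: nat \<Rightarrow> real, s :: real). complex_of_real ((norm (amplitude n t + B + g n s))\<^sup>2) * iexp (position n t \<bullet> y) * iexp (X n s \<bullet> y)"
  have m: "?f \<in> borel_measurable (torus n \<Otimes>\<^sub>M unit_interval)"
    by measurable
  have int: "integrable (torus n \<Otimes>\<^sub>M unit_interval) ?f"
  proof (rule integrable_const_bound[OF _ m])
    show "AE z in torus n \<Otimes>\<^sub>M unit_interval. norm (?f z) \<le> ((\<Sum>m<n. \<epsilon> m) + (norm B + \<epsilon> n))\<^sup>2"
    proof (intro AE_I2)
      fix z :: "(nat \<Rightarrow> real) \<times> real"
      obtain t s where z: "z = (t, s)" by (cases z)
      have "(norm (amplitude n t + (B + g n s)))\<^sup>2 \<le> ((\<Sum>m<n. \<epsilon> m) + (norm B + \<epsilon> n))\<^sup>2"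
        by (intro power_mono norm_triangle_le add_mono amplitude_bound g_le norm_triangle_le) auto
      then show "norm (?f z) \<le> ((\<Sum>m<n. \<epsilon> m) + (norm B + \<epsilon> n))\<^sup>2"
        unfolding z by (simp add: norm_mult norm_power add.assoc)
    qed
  qed
  have "wchar (Suc n) B y = (\<integral>t. (\<integral>s. ?f (t, s) \<partial>unit_interval) \<partial>torus n)"
    unfolding wchar_Suc_iterated by simp
  also have "\<dots> = (\<integral>s. (\<integral>t. ?f (t, s) \<partial>torus n) \<partial>unit_interval)"
    using Fubini_integral[OF int] by simp
  also have "\<dots> = (\<integral>s. wchar n (B + g n s) y * iexp (X n s \<bullet> y) \<partial>unit_interval)"
    unfolding wchar_def by (simp add: add.assoc)
  finally show ?thesis .
qed

lemma mean_zero_inner: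
  "(\<integral>s. X n s \<bullet> y \<partial>unit_interval) = 0" "(\<integral>s. Re (cnj A * g n s) \<partial>unit_interval) = 0"
  using X_integrable[of n] g_integrable[of n]
   apply (simp add: X_mean)
  apply (subst integral_Re[OF integrable_mult_right])
  using g_integrable[of n] by (auto simp: g_mean)

lemma norm_add_squared: "(norm (A + z :: complex))\<^sup>2 = (norm A)\<^sup>2 + 2 * Re (cnj A * z) + (norm z)\<^sup>2"
  unfolding cmod_power2 by (simp add: power2_eq_square algebra_simps)

lemma mean_norm_add_squared: "(\<integral>s. (norm (A + g n s))\<^sup>2 \<partial>unit_interval) \<le> (norm A)\<^sup>2 + (\<epsilon> n)\<^sup>2"
proof -
  have i: "integrable unit_interval (\<lambda>s. Re (cnj A * g n s))"
    using g_integrable[of n] by simp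
  have i2: "integrable unit_interval (\<lambda>s. (norm (g n s))\<^sup>2)"
    by (rule unit_interval.integrable_const_bound[where B = "(\<epsilon> n)\<^sup>2"]) (auto intro!: power_mono g_le)
  have "(\<integral>s. (norm (A + g n s))\<^sup>2 \<partial>unit_interval) = (norm A)\<^sup>2 + (\<integral>s. (norm (g n s))\<^sup>2 \<partial>unit_interval)"
  proof -
    define r where "r s = Re (cnj A * g n s)" for s
    have "integrable unit_interval r" "(\<integral>s. r s \<partial>unit_interval) = 0"
      using i mean_zero_inner(2)[of A n] unfolding r_def[abs_def] by blast+
    then show ?thesis
      unfolding norm_add_squared r_def[symmetric] using i2 unit_interval.prob_space by simp
  qed
  also have "(\<integral>s. (norm (g n s))\<^sup>2 \<partial>unit_interval) \<le> (\<epsilon> n)\<^sup>2"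
    by (rule unit_interval.integral_le_const[OF i2]) (auto intro!: AE_I2 power_mono g_le)
  finally show ?thesis by simp
qed

text \<open>Averaging |B + g|^2 adds at most \<epsilon>^2, the cross term having mean zero. So the
  form c (|B|^2 + v) is preserved, and the factor c, which may depend on y, never
  deteriorates.\<close>

lemma wchar_bound_Suc:
  assumes "\<And>B. norm (wchar n B y) \<le> c * ((norm B)\<^sup>2 + v)" and c: "c \<ge> 0"
  shows "norm (wchar (Suc n) B y) \<le> c * ((norm B)\<^sup>2 + (v + (\<epsilon> n)\<^sup>2))"
proof -
  have i: "integrable unit_interval (\<lambda>s. (norm (B + g n s))\<^sup>2)"
    by (rule unit_interval.integrable_const_bound[where B = "(norm B + \<epsilon> n)\<^sup>2"])
       (auto intro!: power_mono norm_triangle_le add_mono g_le)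
  have "norm (wchar (Suc n) B y) \<le> (\<integral>s. norm (wchar n (B + g n s) y * iexp (X n s \<bullet> y)) \<partial>unit_interval)"
    unfolding wchar_Suc by (rule integral_norm_bound)
  also have "\<dots> \<le> (\<integral>s. c * ((norm (B + g n s))\<^sup>2 + v) \<partial>unit_interval)"
    by (rule integral_mono') (use i assms in \<open>auto simp: norm_mult intro: order_trans[OF norm_ge_zero assms(1)]\<close>)
  also have "\<dots> = c * ((\<integral>s. (norm (B + g n s))\<^sup>2 \<partial>unit_interval) + v)"
    using i unit_interval.prob_space by simp
  also have "\<dots> \<le> c * (((norm B)\<^sup>2 + (\<epsilon> n)\<^sup>2) + v)"
    by (intro mult_left_mono add_mono mean_norm_add_squared c) auto
  finally show ?thesis by (simp add: algebra_simps)
qed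

lemma wchar_bound_from:
  assumes "\<And>B. norm (wchar n0 B y) \<le> c * ((norm B)\<^sup>2 + v)" "c \<ge> 0" "n \<ge> n0"
  shows "norm (wchar n B y) \<le> c * ((norm B)\<^sup>2 + (v + (\<Sum>m\<in>{n0..<n}. (\<epsilon> m)\<^sup>2)))"
  using assms(3)
proof (induction n arbitrary: B rule: dec_induct)
  case (step n)
  then show ?case using wchar_bound_Suc[OF step.IH assms(2), of B] by (simp add: add.assoc)
qed (use assms in auto)

definition total :: real where "total = (\<Sum>m. (\<epsilon> m)\<^sup>2)"

lemma total_bound: "finite S \<Longrightarrow> (\<Sum>m\<in>S. (\<epsilon> m)\<^sup>2) \<le> total"
  unfolding total_def by (rule sum_le_suminf[OF eps_summable]) auto

lemma wchar_bound: "norm (wchar n B y) \<le> (norm B)\<^sup>2 + total"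
proof -
  have "norm (wchar 0 B y) \<le> 1 * ((norm B)\<^sup>2 + 0)" for B
  proof -
    interpret prob_space "torus 0" by (rule prob_space_torus)
    show ?thesis by (simp add: wchar_def amplitude_def position_def prob_space norm_power)
  qed
  from wchar_bound_from[OF this, of n B] total_bound[of "{0..<n}"] show ?thesis by simp
qed

text \<open>The second moment is \<open>wchar\<close> at B = 0 and y = 0.\<close>

lemma amplitude_second_moment: "(\<integral>t. (norm (amplitude n t))\<^sup>2 \<partial>torus n) \<le> total"
proof -
  have "wchar n 0 0 = of_real (\<integral>t. (norm (amplitude n t))\<^sup>2 \<partial>torus n)"
    by (simp add: wchar_def flip: integral_complex_of_real)
  then have "\<bar>\<integral>t. (norm (amplitude n t))\<^sup>2 \<partial>torus n\<bar> \<le> total"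
    using wchar_bound[of n 0 0] by simp
  then show ?thesis by linarith
qed

text \<open>Both kinds of steps have mean zero, so adding a coordinate changes the characteristic
  function only to second order in \<epsilon>. The factor depending on the amplitude is then
  averaged by means of its second moment.\<close>

lemma wchar_diff:
  "norm (wchar (Suc n) 0 y - wchar n 0 y) \<le> (\<epsilon> n)\<^sup>2 * (2 * (1 + norm y)\<^sup>2 * (1 + total))"
proof -
  interpret T: prob_space "torus n" by (rule prob_space_torus)
  let ?Y = "(1 + norm y)\<^sup>2"
  \<comment> \<open>The remainder after the constant and the first-order terms; the latter integrate
    to 0.\<close>
  define r where "r A s = of_real ((norm (A + g n s))\<^sup>2) * iexp (X n s \<bullet> y) - of_real ((norm A)\<^sup>2)
      - (of_real ((norm A)\<^sup>2) * (\<i> * of_real (X n s \<bullet> y)) + of_real (2 * Re (cnj A * g n s)))" for A s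
  have r_bound: "norm (r A s) \<le> (\<epsilon> n)\<^sup>2 * (2 * ?Y * (1 + (norm A)\<^sup>2))" for A s
  proof -
    define u where "u = X n s \<bullet> y"
    define w where "w = 2 * Re (cnj A * g n s)"
    define e where "e = \<epsilon> n"
    have e0: "e \<ge> 0" by (simp add: e_def eps_nonneg)
    have u: "\<bar>u\<bar> \<le> e * norm y"
      unfolding u_def e_def by (rule order_trans[OF Cauchy_Schwarz_ineq2]) (intro mult_right_mono X_le norm_ge_zero)
    have w: "\<bar>w\<bar> \<le> 2 * norm A * e"
    proof -
      have "\<bar>Re (cnj A * g n s)\<bar> \<le> norm A * norm (g n s)"
        using abs_Re_le_cmod[of "cnj A * g n s"] by (simp add: norm_mult)
      also have "\<dots> \<le> norm A * e" unfolding e_def by (intro mult_left_mono g_le norm_ge_zero)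
      finally show ?thesis by (simp add: w_def)
    qed
    have z: "(norm (g n s))\<^sup>2 \<le> e\<^sup>2" unfolding e_def by (intro power_mono g_le norm_ge_zero)
    have r_eq: "r A s = of_real ((norm A)\<^sup>2) * (iexp u - 1 - \<i> * of_real u) + of_real w * (iexp u - 1) + of_real ((norm (g n s))\<^sup>2) * iexp u"
      unfolding r_def norm_add_squared u_def[symmetric] w_def[symmetric] by (simp add: algebra_simps)
    have 1: "norm (iexp u - 1) \<le> \<bar>u\<bar>" using iexp_approx1[of u 0] by simp
    have 2: "norm (iexp u - 1 - \<i> * of_real u) \<le> u\<^sup>2"
    proof -
      have "norm (iexp u - 1 - \<i> * of_real u) \<le> u\<^sup>2 / 2"
        using iexp_approx1[of u 1] by (simp add: diff_diff_eq power2_eq_square)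
      then show ?thesis using zero_le_power2[of u] by linarith
    qed
    have u2: "u\<^sup>2 \<le> e\<^sup>2 * (norm y)\<^sup>2"
      using u by (metis abs_ge_zero power2_abs power_mono power_mult_distrib)
    have "norm (r A s) \<le> (norm A)\<^sup>2 * norm (iexp u - 1 - \<i> * of_real u) + \<bar>w\<bar> * norm (iexp u - 1) + (norm (g n s))\<^sup>2"
      unfolding r_eq by (intro norm_triangle_le add_mono) (auto simp: norm_mult norm_power)
    also have "\<dots> \<le> (norm A)\<^sup>2 * (e\<^sup>2 * (norm y)\<^sup>2) + (2 * norm A * e) * (e * norm y) + e\<^sup>2"
      by (intro add_mono mult_mono order_trans[OF 2 u2] order_trans[OF 1 u] w z) (use e0 in auto)
    also have "\<dots> = e\<^sup>2 * (norm A * norm y + 1)\<^sup>2"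
      by (simp add: power2_eq_square algebra_simps)
    also have "\<dots> \<le> e\<^sup>2 * (2 * ?Y * (1 + (norm A)\<^sup>2))"
    proof (rule mult_left_mono)
      have "norm A * norm y + 1 \<le> (1 + norm A) * (1 + norm y)" by (simp add: algebra_simps)
      then have "(norm A * norm y + 1)\<^sup>2 \<le> ((1 + norm A) * (1 + norm y))\<^sup>2" by (intro power_mono) auto
      also have "\<dots> = (1 + norm A)\<^sup>2 * ?Y" by (simp add: power_mult_distrib)
      also have "\<dots> \<le> (2 * (1 + (norm A)\<^sup>2)) * ?Y"
      proof (rule mult_right_mono)
        have "0 \<le> (1 - norm A)\<^sup>2" by simp
        then show "(1 + norm A)\<^sup>2 \<le> 2 * (1 + (norm A)\<^sup>2)" by (simp add: power2_eq_square algebra_simps)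
      qed simp
      finally show "(norm A * norm y + 1)\<^sup>2 \<le> 2 * ?Y * (1 + (norm A)\<^sup>2)" by (simp only: mult_ac)
    qed simp
    finally show ?thesis by (simp add: e_def)
  qed
  have inner: "norm ((\<integral>s. of_real ((norm (A + g n s))\<^sup>2) * iexp (X n s \<bullet> y) \<partial>unit_interval) - of_real ((norm A)\<^sup>2))
    \<le> (\<epsilon> n)\<^sup>2 * (2 * ?Y * (1 + (norm A)\<^sup>2))" for A
  proof -
    define l where "l s = of_real ((norm A)\<^sup>2) * (\<i> * of_real (X n s \<bullet> y)) + complex_of_real (2 * Re (cnj A * g n s))" for s
    have il: "integrable unit_interval l"
      unfolding l_def using X_integrable[of n] g_integrable[of n]
      by (intro Bochner_Integration.integrable_add integrable_mult_right integrable_of_real integrable_Re integrable_inner_left) auto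
    have l0: "(\<integral>s. l s \<partial>unit_interval) = 0"
    proof -
      have "(\<integral>s. l s \<partial>unit_interval) = of_real ((norm A)\<^sup>2) * (\<i> * of_real (\<integral>s. X n s \<bullet> y \<partial>unit_interval)) + of_real (2 * (\<integral>s. Re (cnj A * g n s) \<partial>unit_interval))"
        unfolding l_def
        apply (subst Bochner_Integration.integral_add)
        subgoal using X_integrable[of n] by (intro integrable_mult_right integrable_of_real integrable_inner_left) auto
        subgoal using g_integrable[of n] by (intro integrable_mult_right integrable_of_real integrable_Re) auto
        by (simp only: integral_mult_right_zero integral_complex_of_real)
      then show ?thesis unfolding mean_zero_inner by simp
    qed
    have ir: "integrable unit_interval (r A)"
      by (rule unit_interval.integrable_const_bound[OF AE_I2[OF r_bound[of A]]]) (unfold r_def, measurable)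
    have eq: "of_real ((norm (A + g n s))\<^sup>2) * iexp (X n s \<bullet> y) = of_real ((norm A)\<^sup>2) + (l s + r A s)" for s
      unfolding r_def l_def by simp
    have "(\<integral>s. of_real ((norm (A + g n s))\<^sup>2) * iexp (X n s \<bullet> y) \<partial>unit_interval) = of_real ((norm A)\<^sup>2) + (\<integral>s. r A s \<partial>unit_interval)"
      unfolding eq using il ir l0 unit_interval.prob_space by simp
    moreover have "norm (\<integral>s. r A s \<partial>unit_interval) \<le> (\<epsilon> n)\<^sup>2 * (2 * ?Y * (1 + (norm A)\<^sup>2))"
      by (rule order_trans[OF integral_norm_bound])
         (rule unit_interval.integral_le_const, use ir r_bound in auto)
    ultimately show ?thesis by simp
  qed
  define J where "J A = (\<integral>s. of_real ((norm (A + g n s))\<^sup>2) * iexp (X n s \<bullet> y) \<partial>unit_interval)" for A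
  have Jm [measurable]: "(\<lambda>t. J (amplitude n t)) \<in> borel_measurable (torus n)"
    unfolding J_def by measurable
  have "wchar (Suc n) 0 y = (\<integral>t. iexp (position n t \<bullet> y) * J (amplitude n t) \<partial>torus n)"
    unfolding wchar_Suc_iterated J_def add_0_right
    by (intro Bochner_Integration.integral_cong refl) (simp flip: integral_mult_right_zero add: mult_ac)
  have dint: "integrable (torus n) (\<lambda>t. (\<epsilon> n)\<^sup>2 * (2 * ?Y * (1 + (norm (amplitude n t))\<^sup>2)))"
    using weight_integrable[of n 0] by simp
  have Dle: "norm (iexp (position n t \<bullet> y) * (J (amplitude n t) - of_real ((norm (amplitude n t))\<^sup>2))) \<le> (\<epsilon> n)\<^sup>2 * (2 * ?Y * (1 + (norm (amplitude n t))\<^sup>2))" for t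
    using inner[of "amplitude n t"] by (simp add: norm_mult J_def)
  have Di: "integrable (torus n) (\<lambda>t. iexp (position n t \<bullet> y) * (J (amplitude n t) - of_real ((norm (amplitude n t))\<^sup>2)))"
    by (rule Bochner_Integration.integrable_bound[OF dint]) (measurable, use Dle order_trans[OF _ abs_ge_self] in \<open>auto intro!: AE_I2\<close>)
  have wi: "integrable (torus n) (\<lambda>t. of_real ((norm (amplitude n t))\<^sup>2) * iexp (position n t \<bullet> y))"
    using wchar_integrable[of n 0 y] by simp
  have "wchar (Suc n) 0 y - wchar n 0 y = (\<integral>t. iexp (position n t \<bullet> y) * (J (amplitude n t) - of_real ((norm (amplitude n t))\<^sup>2)) \<partial>torus n)"
  proof -
    have "(\<integral>t. iexp (position n t \<bullet> y) * J (amplitude n t) \<partial>torus n)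
      = (\<integral>t. iexp (position n t \<bullet> y) * (J (amplitude n t) - of_real ((norm (amplitude n t))\<^sup>2)) + of_real ((norm (amplitude n t))\<^sup>2) * iexp (position n t \<bullet> y) \<partial>torus n)"
      by (intro Bochner_Integration.integral_cong refl) (simp add: algebra_simps)
    also have "\<dots> = (\<integral>t. iexp (position n t \<bullet> y) * (J (amplitude n t) - of_real ((norm (amplitude n t))\<^sup>2)) \<partial>torus n) + wchar n 0 y"
      unfolding wchar_def add_0_right by (rule Bochner_Integration.integral_add[OF Di wi])
    finally show ?thesis using \<open>wchar (Suc n) 0 y = _\<close> by simp
  qed
  also have "norm \<dots> \<le> (\<integral>t. (\<epsilon> n)\<^sup>2 * (2 * ?Y * (1 + (norm (amplitude n t))\<^sup>2)) \<partial>torus n)"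
    by (rule order_trans[OF integral_norm_bound], rule integral_mono[OF integrable_norm[OF Di] dint]) (rule Dle)
  also have "\<dots> = (\<epsilon> n)\<^sup>2 * (2 * ?Y * (1 + (\<integral>t. (norm (amplitude n t))\<^sup>2 \<partial>torus n)))"
    using weight_integrable[of n 0] T.prob_space by simp
  also have "\<dots> \<le> (\<epsilon> n)\<^sup>2 * (2 * ?Y * (1 + total))"
    using amplitude_second_moment[of n] by (intro mult_left_mono add_left_mono) auto
  finally show ?thesis .
qed

definition wchar_lim :: "'a \<Rightarrow> complex" where "wchar_lim y = lim (\<lambda>n. wchar n 0 y)"

text \<open>The increments are summable by \<open>wchar_diff\<close>, so the telescoping series
  converges.\<close>

lemma wchar_tendsto: "(\<lambda>n. wchar n 0 y) \<longlonglongrightarrow> wchar_lim y"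
proof -
  have "summable (\<lambda>n. wchar (Suc n) 0 y - wchar n 0 y)"
    by (rule summable_comparison_test'[OF summable_mult2[OF eps_summable], of 0]) (rule wchar_diff)
  then have "(\<lambda>n. \<Sum>k<n. wchar (Suc k) 0 y - wchar k 0 y) \<longlonglongrightarrow> (\<Sum>n. wchar (Suc n) 0 y - wchar n 0 y)"
    by (rule summable_LIMSEQ)
  then have "(\<lambda>n. (\<Sum>k<n. wchar (Suc k) 0 y - wchar k 0 y) + wchar 0 0 y) \<longlonglongrightarrow> (\<Sum>n. wchar (Suc n) 0 y - wchar n 0 y) + wchar 0 0 y"
    by (intro tendsto_intros)
  then have "convergent (\<lambda>n. wchar n 0 y)"
    using sum_lessThan_telescope[of "\<lambda>n. wchar n 0 y"] by (simp add: convergentI)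
  then show ?thesis unfolding wchar_lim_def by (rule convergent_LIMSEQ_iff[THEN iffD1])
qed

lemma wchar_lim_measurable [measurable]: "wchar_lim \<in> borel_measurable borel"
  by (rule borel_measurable_LIMSEQ_metric[OF wchar_measurable wchar_tendsto])

end

section \<open>Gaussian bounds for the densities\<close>

context random_walk
begin

text \<open>Expanding the squares leaves a term of at most \<kappa> \<epsilon>^2 and a part u linear
  in the steps, of mean zero, with u^2 \<le> 8 \<kappa>^2 \<epsilon>^2 (|B|^2 + |x|^2). Since
  \<open>exp_le_quadratic\<close> removes the linear term, the price is quadratic in B and x and can
  be absorbed into the two exponents.\<close>

lemma gaussian_step:
  assumes k: "0 \<le> \<kappa>1" "0 \<le> \<kappa>2" "\<kappa>1 \<le> \<kappa>" "\<kappa>2 \<le> \<kappa>"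
  shows "integrable unit_interval (\<lambda>s. exp (\<kappa>1 * (norm (B + g n s))\<^sup>2 - \<kappa>2 * (norm (x - X n s))\<^sup>2))"
    and "(\<integral>s. exp (\<kappa>1 * (norm (B + g n s))\<^sup>2 - \<kappa>2 * (norm (x - X n s))\<^sup>2) \<partial>unit_interval)
      \<le> exp (\<kappa>1 * (norm B)\<^sup>2 - \<kappa>2 * (norm x)\<^sup>2 + \<kappa> * (\<epsilon> n)\<^sup>2 + 8 * \<kappa>\<^sup>2 * (\<epsilon> n)\<^sup>2 * ((norm B)\<^sup>2 + (norm x)\<^sup>2))"
proof -
  define e where "e = \<epsilon> n"
  have e0: "e \<ge> 0" by (simp add: e_def eps_nonneg)
  have k0: "\<kappa> \<ge> 0" using k by simp
  define u where "u s = 2 * \<kappa>1 * Re (cnj B * g n s) + 2 * \<kappa>2 * (X n s \<bullet> x)" for s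
  define E where "E = exp (\<kappa>1 * (norm B)\<^sup>2 - \<kappa>2 * (norm x)\<^sup>2 + \<kappa> * e\<^sup>2)"
  define c where "c = 8 * \<kappa>\<^sup>2 * e\<^sup>2 * ((norm B)\<^sup>2 + (norm x)\<^sup>2)"
  let ?f = "\<lambda>s. exp (\<kappa>1 * (norm (B + g n s))\<^sup>2 - \<kappa>2 * (norm (x - X n s))\<^sup>2)"
  have uu: "\<bar>u s\<bar> \<le> 2 * \<kappa> * e * (norm B + norm x)" for s
  proof -
    have "\<bar>Re (cnj B * g n s)\<bar> \<le> norm B * norm (g n s)"
      using abs_Re_le_cmod[of "cnj B * g n s"] by (simp add: norm_mult)
    also have "\<dots> \<le> norm B * e" unfolding e_def by (intro mult_left_mono g_le norm_ge_zero)
    finally have 1: "\<bar>Re (cnj B * g n s)\<bar> \<le> norm B * e" .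
    have "\<bar>X n s \<bullet> x\<bar> \<le> norm (X n s) * norm x" by (rule Cauchy_Schwarz_ineq2)
    also have "\<dots> \<le> e * norm x" unfolding e_def by (intro mult_right_mono X_le norm_ge_zero)
    finally have 2: "\<bar>X n s \<bullet> x\<bar> \<le> e * norm x" .
    have "\<bar>u s\<bar> \<le> 2 * (\<kappa>1 * \<bar>Re (cnj B * g n s)\<bar>) + 2 * (\<kappa>2 * \<bar>X n s \<bullet> x\<bar>)"
      unfolding u_def using k by (intro order_trans[OF abs_triangle_ineq]) (simp add: abs_mult)
    also have "\<dots> \<le> 2 * (\<kappa> * (norm B * e)) + 2 * (\<kappa> * (e * norm x))"
      by (intro add_mono mult_left_mono mult_mono 1 2 k k0) auto
    finally show ?thesis by (simp add: algebra_simps)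
  qed
  have u2: "(u s)\<^sup>2 \<le> c" for s
  proof -
    have "(u s)\<^sup>2 \<le> (2 * \<kappa> * e * (norm B + norm x))\<^sup>2"
      using uu[of s] by (metis abs_ge_zero power2_abs power_mono)
    also have "\<dots> = 4 * \<kappa>\<^sup>2 * e\<^sup>2 * (norm B + norm x)\<^sup>2" by (simp add: power_mult_distrib)
    also have "\<dots> \<le> 4 * \<kappa>\<^sup>2 * e\<^sup>2 * (2 * ((norm B)\<^sup>2 + (norm x)\<^sup>2))"
    proof (rule mult_left_mono)
      have "0 \<le> (norm B - norm x)\<^sup>2" by simp
      then show "(norm B + norm x)\<^sup>2 \<le> 2 * ((norm B)\<^sup>2 + (norm x)\<^sup>2)" by (simp add: power2_eq_square algebra_simps)
    qed simp
    finally show ?thesis by (simp add: c_def algebra_simps)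
  qed
  have pw: "?f s \<le> E * (u s + exp c)" for s
  proof -
    have h: "(norm (x - X n s))\<^sup>2 = (norm x)\<^sup>2 - 2 * (X n s \<bullet> x) + (norm (X n s))\<^sup>2"
      by (simp add: power2_norm_eq_inner inner_diff_left inner_diff_right inner_commute)
    have "\<kappa>1 * (norm (B + g n s))\<^sup>2 - \<kappa>2 * (norm (x - X n s))\<^sup>2
      = (\<kappa>1 * (norm B)\<^sup>2 - \<kappa>2 * (norm x)\<^sup>2) + (\<kappa>1 * (norm (g n s))\<^sup>2 - \<kappa>2 * (norm (X n s))\<^sup>2) + u s"
      unfolding norm_add_squared h u_def by (simp add: algebra_simps)
    also have "\<kappa>1 * (norm (g n s))\<^sup>2 - \<kappa>2 * (norm (X n s))\<^sup>2 \<le> \<kappa> * e\<^sup>2 - 0"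
      unfolding e_def using k k0 by (intro diff_mono mult_mono power_mono g_le) auto
    finally have "?f s \<le> E * exp (u s)"
      unfolding E_def exp_add[symmetric] by simp
    also have "exp (u s) \<le> u s + exp c"
      using exp_le_quadratic[of "u s"] u2[of s] by (meson add_left_mono exp_le_cancel_iff order_trans)
    finally show ?thesis by (simp add: E_def)
  qed
  have iu: "integrable unit_interval u"
    unfolding u_def[abs_def] using g_integrable[of n] X_integrable[of n]
    by (intro Bochner_Integration.integrable_add integrable_mult_right integrable_Re integrable_inner_left) auto
  have u0: "(\<integral>s. u s \<partial>unit_interval) = 0"
  proof -
    have "(\<integral>s. u s \<partial>unit_interval) = 2 * \<kappa>1 * (\<integral>s. Re (cnj B * g n s) \<partial>unit_interval) + 2 * \<kappa>2 * (\<integral>s. X n s \<bullet> x \<partial>unit_interval)"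
      unfolding u_def
      apply (subst Bochner_Integration.integral_add)
      subgoal using g_integrable[of n] by (intro integrable_mult_right integrable_Re) auto
      subgoal using X_integrable[of n] by (intro integrable_mult_right integrable_inner_left) auto
      by (simp only: integral_mult_right_zero)
    then show ?thesis unfolding mean_zero_inner by simp
  qed
  have ir: "integrable unit_interval (\<lambda>s. E * (u s + exp c))" using iu by simp
  show i: "integrable unit_interval ?f"
    by (rule Bochner_Integration.integrable_bound[OF ir]) (measurable, use pw order_trans[OF pw abs_ge_self] in \<open>auto intro!: AE_I2\<close>)
  have "(\<integral>s. ?f s \<partial>unit_interval) \<le> (\<integral>s. E * (u s + exp c) \<partial>unit_interval)"
    by (rule integral_mono[OF i ir pw])
  also have "\<dots> = E * exp c" using iu u0 unit_interval.prob_space by simp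
  finally show "(\<integral>s. ?f s \<partial>unit_interval)
      \<le> exp (\<kappa>1 * (norm B)\<^sup>2 - \<kappa>2 * (norm x)\<^sup>2 + \<kappa> * (\<epsilon> n)\<^sup>2 + 8 * \<kappa>\<^sup>2 * (\<epsilon> n)\<^sup>2 * ((norm B)\<^sup>2 + (norm x)\<^sup>2))"
    unfolding E_def c_def e_def exp_add[symmetric] .
qed

text \<open>Derivatives of the density, written on the Fourier side. In this form the recursion over
  n holds for every \<open>es\<close> without differentiating under the torus integral;
  \<open>wdens_density\<close> identifies the functions.\<close>

definition wdens :: "nat \<Rightarrow> 'a list \<Rightarrow> complex \<Rightarrow> 'a \<Rightarrow> real" where
  "wdens n es B = inv_ft (\<lambda>y. partial_symbol es y * wchar n B y)"

end

definition decay_integral :: "'a::euclidean_space itself \<Rightarrow> real" where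
  "decay_integral _ = (\<integral>y. 1 / (1 + norm (y::'a)) ^ (2 * DIM('a)) \<partial>lborel)"

text \<open>In the decay rate, q powers pay for the derivatives and \<open>2 * DIM('a)\<close>
  powers for integrability.\<close>

locale smooth_walk = random_walk X g \<epsilon> for X :: "nat \<Rightarrow> real \<Rightarrow> 'a::euclidean_space" and g \<epsilon> +
  fixes q n0 :: nat and C :: real
  assumes base: "\<And>B y. norm (wchar n0 B y) \<le> C * (1 + (norm B)\<^sup>2) / (1 + norm y) ^ (2 * DIM('a) + q)"
    and C_nonneg: "C \<ge> 0"
begin

text \<open>Decay in y is required only at \<open>n0\<close>: later averages preserve it, because
  \<open>wchar_bound_from\<close> holds for each y with its own factor c.\<close>

lemma wchar_decay:
  assumes "n \<ge> n0"
  shows "norm (wchar n B y) \<le> C * (1 + (norm B)\<^sup>2 + total) / (1 + norm y) ^ (2 * DIM('a) + q)"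
proof -
  let ?c = "C / (1 + norm y) ^ (2 * DIM('a) + q)"
  have c: "?c \<ge> 0" using C_nonneg by simp
  have "norm (wchar n B y) \<le> ?c * ((norm B)\<^sup>2 + (1 + (\<Sum>m\<in>{n0..<n}. (\<epsilon> m)\<^sup>2)))"
    by (rule wchar_bound_from[OF _ c assms]) (use base in \<open>simp add: add.commute\<close>)
  also have "\<dots> \<le> ?c * ((norm B)\<^sup>2 + (1 + total))"
    by (intro mult_left_mono add_left_mono total_bound c) auto
  finally show ?thesis by (simp add: algebra_simps)
qed

lemma symbol_decay:
  assumes es: "set es \<subseteq> Basis" "length es \<le> q" and w: "norm w \<le> c / (1 + norm y) ^ (2 * DIM('a) + q)" and c: "c \<ge> 0"
  shows "norm (partial_symbol es (y::'a) * w) \<le> c * (1 / (1 + norm y) ^ (2 * DIM('a)))"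
proof -
  have "norm (partial_symbol es y) \<le> (1 + norm y) ^ q"
    using partial_symbol_bound[OF es(1), of y] power_increasing[OF es(2), of "1 + norm y"] by simp
  then have "norm (partial_symbol es y * w) \<le> (1 + norm y) ^ q * (c / (1 + norm y) ^ (2 * DIM('a) + q))"
    unfolding norm_mult by (intro mult_mono w) auto
  also have "(1 + norm y) ^ q \<noteq> 0" by (metis add_pos_nonneg norm_ge_zero power_not_zero zero_less_one less_irrefl)
  then have "(1 + norm y) ^ q * (c / (1 + norm y) ^ (2 * DIM('a) + q)) = c * (1 / (1 + norm y) ^ (2 * DIM('a)))"
    by (simp add: power_add)
  finally show ?thesis .
qed

lemma wchar_symbol_bound:
  assumes "set es \<subseteq> Basis" "length es \<le> q" "n \<ge> n0"
  shows "norm (partial_symbol es y * wchar n B y) \<le> C * (1 + (norm B)\<^sup>2 + total) * (1 / (1 + norm y) ^ (2 * DIM('a)))"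
  by (rule symbol_decay[OF assms(1,2) wchar_decay[OF assms(3)]])
     (use C_nonneg total_bound[of "{}"] in auto)

lemma decay_power_integrable:
  assumes [measurable]: "u \<in> borel_measurable borel" and u: "\<And>y. norm (u y) \<le> c / (1 + norm y) ^ (2 * DIM('a) + q)"
  shows "integrable lborel (\<lambda>y::'a. (1 + norm y) ^ q * norm (u y :: complex))"
proof (rule Bochner_Integration.integrable_bound[OF integrable_mult_right[OF integrable_inverse_norm_power, of c]])
  have "(1 + norm y) ^ q * norm (u y) \<le> (1 + norm y) ^ q * (c / (1 + norm y) ^ (2 * DIM('a) + q))" for y
    by (intro mult_left_mono u) auto
  moreover have "(1 + norm y) ^ q \<noteq> 0" for y :: 'a by (metis add_pos_nonneg norm_ge_zero power_not_zero zero_less_one less_irrefl)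
  then have "(1 + norm y) ^ q * (c / (1 + norm y) ^ (2 * DIM('a) + q)) = c * (1 / (1 + norm y) ^ (2 * DIM('a)))" for y :: 'a
    by (simp add: power_add)
  ultimately have *: "(1 + norm y) ^ q * norm (u y) \<le> c * (1 / (1 + norm y) ^ (2 * DIM('a)))" for y by metis
  show "AE y in lborel. norm ((1 + norm y) ^ q * norm (u y)) \<le> norm (c * (1 / (1 + norm y) ^ (2 * DIM('a))))"
    by (intro AE_I2 order_trans[OF _ abs_ge_self[of "c * (1 / (1 + norm _) ^ (2 * DIM('a)))", folded real_norm_def]])
       (use * in \<open>simp add: abs_mult\<close>)
qed measurable

lemma wchar_power_integrable:
  "n \<ge> n0 \<Longrightarrow> integrable lborel (\<lambda>y. (1 + norm y) ^ q * norm (wchar n B y))"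
  by (rule decay_power_integrable[OF wchar_measurable wchar_decay])

lemma wchar_integrable_lborel:
  assumes "n \<ge> n0" shows "integrable lborel (wchar n B)"
proof (rule Bochner_Integration.integrable_bound[OF integrable_mult_right[OF integrable_inverse_norm_power]])
  show "AE y in lborel. norm (wchar n B y) \<le> norm (C * (1 + (norm B)\<^sup>2 + total) * (1 / (1 + norm y) ^ (2 * DIM('a))))"
    using order_trans[OF wchar_symbol_bound[of "[]" n _ B] abs_ge_self] assms by (intro AE_I2) simp
qed simp

lemma wdens_density:
  assumes "n \<ge> n0"
  shows "continuous_density (weighted_law n B) (wdens n [] B)"
    and "C_k q (wdens n [] B)"
    and "set es \<subseteq> Basis \<Longrightarrow> length es \<le> q \<Longrightarrow> iter_partial es (wdens n [] B) = wdens n es B"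
proof -
  have e: "wdens n [] B = inv_ft (wchar n B)" by (simp add: wdens_def)
  show "continuous_density (weighted_law n B) (wdens n [] B)"
    unfolding e char_fn_weighted_law[symmetric]
    by (rule fourier_inversion[OF finite_weighted_law sets_weighted_law])
       (simp add: char_fn_weighted_law wchar_integrable_lborel[OF assms])
  show "C_k q (wdens n [] B)"
    unfolding e by (rule inv_ft_smooth(1)[OF wchar_measurable wchar_power_integrable[OF assms]])
  have e': "wdens n es B = inv_ft (\<lambda>y. partial_symbol es y * wchar n B y)" by (simp add: wdens_def)
  show "iter_partial es (wdens n [] B) = wdens n es B" if "set es \<subseteq> Basis" "length es \<le> q"
    unfolding e e' using that by (rule inv_ft_smooth(2)[OF wchar_measurable wchar_power_integrable[OF assms]])
qed

lemma wdens_Suc: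
  assumes es: "set es \<subseteq> Basis" "length es \<le> q" and n: "n \<ge> n0"
  shows "wdens (Suc n) es B x = (\<integral>s. wdens n es (B + g n s) (x - X n s) \<partial>unit_interval)"
    and "integrable unit_interval (\<lambda>s. wdens n es (B + g n s) (x - X n s))"
proof -
  interpret T: prob_space "torus n" by (rule prob_space_torus)
  interpret pair_sigma_finite unit_interval "lborel :: 'a measure" ..
  \<comment> \<open>An upper bound for the factor in \<open>wchar_symbol_bound\<close> at all shifts
    B + g n s at once, which provides the majorant for Fubini.\<close>
  define W where "W = C * (1 + (norm B + \<epsilon> n)\<^sup>2 + total)"
  define w where "w y = 1 / (1 + norm (y::'a)) ^ (2 * DIM('a))" for y
  have wi: "integrable lborel w" unfolding w_def[abs_def] by (rule integrable_inverse_norm_power)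
  define f where "f s y = iexp (- ((x - X n s) \<bullet> y)) * (partial_symbol es y * wchar n (B + g n s) y)" for s y
  have fm [measurable]: "(\<lambda>(s, y). f s y) \<in> borel_measurable (unit_interval \<Otimes>\<^sub>M lborel)"
    unfolding f_def wchar_def by measurable
  have fb: "norm (f s y) \<le> W * w y" for s y
  proof -
    have "norm (f s y) \<le> C * (1 + (norm (B + g n s))\<^sup>2 + total) * w y"
      unfolding f_def w_def using wchar_symbol_bound[OF es n, of y "B + g n s"] by (simp add: norm_mult)
    also have "\<dots> \<le> W * w y"
      unfolding W_def w_def
      by (intro mult_right_mono mult_left_mono add_mono power_mono norm_triangle_le g_le C_nonneg) auto
    finally show ?thesis .
  qed
  have wint: "integrable (unit_interval \<Otimes>\<^sub>M lborel) (\<lambda>(s, y). W * w y)"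
  proof (rule Fubini_integrable)
    show "integrable unit_interval (\<lambda>s. \<integral>y. norm (case (s, y) of (s, y) \<Rightarrow> W * w y) \<partial>lborel)"
      by simp
    show "AE s in unit_interval. integrable lborel (\<lambda>y. case (s, y) of (s, y) \<Rightarrow> W * w y)"
      by (intro AE_I2) (simp only: prod.case, rule integrable_mult_right[OF wi])
  qed (simp add: w_def)
  have fint: "integrable (unit_interval \<Otimes>\<^sub>M lborel) (\<lambda>(s, y). f s y)"
    by (rule Bochner_Integration.integrable_bound[OF wint fm])
       (use order_trans[OF fb abs_ge_self] in \<open>auto intro!: AE_I2\<close>)
  have f_eq: "f s y = iexp (- (x \<bullet> y)) * (partial_symbol es y * (wchar n (B + g n s) y * iexp (X n s \<bullet> y)))" for s y
  proof -
    have "iexp (- ((x - X n s) \<bullet> y)) = iexp (- (x \<bullet> y)) * iexp (X n s \<bullet> y)"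
      unfolding exp_add[symmetric] by (simp add: inner_diff_left algebra_simps)
    then show ?thesis by (simp add: f_def)
  qed
  have i1: "integrable unit_interval (\<lambda>s. \<integral>y. f s y \<partial>lborel)"
    using integrable_fst'[OF fint] by simp
  have d: "wdens n es (B + g n s) (x - X n s) = Re (\<integral>y. f s y \<partial>lborel) / (2 * pi) ^ DIM('a)" for s
    by (simp add: wdens_def inv_ft_def f_def)
  show "integrable unit_interval (\<lambda>s. wdens n es (B + g n s) (x - X n s))"
    unfolding d using i1 by (intro integrable_divide integrable_Re) auto
  have "(\<integral>y. iexp (- (x \<bullet> y)) * (partial_symbol es y * wchar (Suc n) B y) \<partial>lborel) = (\<integral>y. (\<integral>s. f s y \<partial>unit_interval) \<partial>lborel)"
    unfolding wchar_Suc f_eq by simp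
  also have "\<dots> = (\<integral>s. (\<integral>y. f s y \<partial>lborel) \<partial>unit_interval)"
    using Fubini_integral[OF fint] by simp
  finally show "wdens (Suc n) es B x = (\<integral>s. wdens n es (B + g n s) (x - X n s) \<partial>unit_interval)"
    unfolding d using i1 by (simp add: wdens_def inv_ft_def)
qed

text \<open>Outside the support all derivatives vanish. Inside, |x| \<le> R lets
  \<open>exp (\<alpha> * R\<^sup>2)\<close> pay for the Gaussian factor. The growth 1 + |B|^2 is
  relaxed to exp |B|^2, a form that \<open>gaussian_step\<close> keeps.\<close>

lemma wdens_base:
  assumes es: "set es \<subseteq> Basis" "length es \<le> q" and R: "(\<Sum>m<n0. \<epsilon> m) \<le> R" and \<alpha>: "\<alpha> \<ge> 0"
  shows "\<bar>wdens n0 es B x\<bar> \<le> C * decay_integral TYPE('a) * exp (\<alpha> * R\<^sup>2) * exp ((norm B)\<^sup>2 - \<alpha> * (norm x)\<^sup>2)"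
proof (cases "norm x > (\<Sum>m<n0. \<epsilon> m)")
  case True
  have "iter_partial es (wdens n0 [] B) x = 0"
  proof (rule iter_partial_zero)
    show "open (- cball 0 (\<Sum>m<n0. \<epsilon> m) :: 'a set)" by auto
    show "wdens n0 [] B x = 0" if "x \<in> - cball 0 (\<Sum>m<n0. \<epsilon> m)" for x
      by (rule continuous_density_support[OF wdens_density(1)[OF order_refl] weighted_law_support]) (use that in auto)
  qed (use True in auto)
  then have "wdens n0 es B x = 0" using wdens_density(3)[OF order_refl es] by simp
  then show ?thesis using C_nonneg by (simp add: decay_integral_def)
next
  case False
  have x: "(norm x)\<^sup>2 \<le> R\<^sup>2" using False R by (intro power_mono) auto
  have J: "decay_integral TYPE('a) \<ge> 0" by (simp add: decay_integral_def)
  have "\<bar>wdens n0 es B x\<bar> \<le> (\<integral>y. C * (1 + (norm B)\<^sup>2) * (1 / (1 + norm (y::'a)) ^ (2 * DIM('a))) \<partial>lborel)"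
    unfolding wdens_def
  proof (rule inv_ft_bound)
    show "norm (partial_symbol es y * wchar n0 B y) \<le> C * (1 + (norm B)\<^sup>2) * (1 / (1 + norm y) ^ (2 * DIM('a)))" for y
      by (rule symbol_decay[OF es base]) (use C_nonneg in auto)
  qed (use integrable_inverse_norm_power[where ?'a = 'a] in \<open>auto intro!: integrable_mult_right simp del: times_divide_eq_right\<close>)
  also have "\<dots> = C * decay_integral TYPE('a) * (1 + (norm B)\<^sup>2)"
    unfolding integral_mult_right_zero decay_integral_def by simp
  also have "\<dots> \<le> C * decay_integral TYPE('a) * exp ((norm B)\<^sup>2)"
    by (intro mult_left_mono exp_ge_add_one_self mult_nonneg_nonneg C_nonneg J)
  also have "\<dots> \<le> C * decay_integral TYPE('a) * exp (\<alpha> * R\<^sup>2 + ((norm B)\<^sup>2 - \<alpha> * (norm x)\<^sup>2))"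
    using mult_left_mono[OF x \<alpha>] by (intro mult_left_mono mult_nonneg_nonneg C_nonneg J) auto
  finally show ?thesis by (simp add: exp_add mult.assoc)
qed

text \<open>Induction from \<open>n0\<close> with initial exponents 1 for B and 2 \<alpha> for x.
  Each step worsens both by \<open>8 * \<kappa>\<^sup>2 * (\<epsilon> n)\<^sup>2\<close>, and the
  tail hypothesis keeps the accumulated loss below min 1 \<alpha>, so at least \<alpha> survives for
  x.\<close>

lemma wdens_gaussian:
  assumes es: "set es \<subseteq> Basis" "length es \<le> q" and R: "(\<Sum>m<n0. \<epsilon> m) \<le> R" and \<alpha>: "\<alpha> > 0"
    and tail: "\<And>n. 8 * (2 + 2 * \<alpha>)\<^sup>2 * (\<Sum>m\<in>{n0..<n}. (\<epsilon> m)\<^sup>2) \<le> min 1 \<alpha>" and n: "n \<ge> n0"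
  shows "\<bar>wdens n es 0 x\<bar> \<le> C * decay_integral TYPE('a) * exp (2 * \<alpha> * R\<^sup>2 + 1) * exp (- \<alpha> * (norm x)\<^sup>2)"
proof -
  \<comment> \<open>Dominates both running exponents, which never exceed 2 and 2 \<alpha>.\<close>
  define \<kappa> where "\<kappa> = 2 + 2 * \<alpha>"
  define V where "V n = (\<Sum>m\<in>{n0..<n}. (\<epsilon> m)\<^sup>2)" for n
  \<comment> \<open>The loss accumulated in each exponent up to n.\<close>
  define s where "s n = 8 * \<kappa>\<^sup>2 * V n" for n
  define K where "K = C * decay_integral TYPE('a) * exp (2 * \<alpha> * R\<^sup>2)"
  have K0: "K \<ge> 0" using C_nonneg by (simp add: K_def decay_integral_def)
  have V0: "V n \<ge> 0" for n by (simp add: V_def sum_nonneg)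
  have s: "0 \<le> s n" "s n \<le> 1" "s n \<le> \<alpha>" for n
    using tail[of n] V0[of n] by (auto simp: s_def \<kappa>_def V_def)
  have V_Suc: "V (Suc n) = V n + (\<epsilon> n)\<^sup>2" if "n \<ge> n0" for n
    using that by (simp add: V_def)
  have main: "\<bar>wdens n es B x\<bar> \<le> K * exp ((1 + s n) * (norm B)\<^sup>2 - (2 * \<alpha> - s n) * (norm x)\<^sup>2 + \<kappa> * V n)" for B x
    using n
  proof (induction n arbitrary: B x rule: dec_induct)
    case base
    have "V n0 = 0" by (simp add: V_def)
    then show ?case using wdens_base[OF es R, of "2 * \<alpha>" B x] \<alpha> by (simp add: s_def K_def)
  next
    case (step n)
    let ?f = "\<lambda>t. exp ((1 + s n) * (norm (B + g n t))\<^sup>2 - (2 * \<alpha> - s n) * (norm (x - X n t))\<^sup>2)"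
    have k: "0 \<le> 1 + s n" "0 \<le> 2 * \<alpha> - s n" "1 + s n \<le> \<kappa>" "2 * \<alpha> - s n \<le> \<kappa>"
      using s[of n] \<alpha> by (auto simp: \<kappa>_def)
    note G = gaussian_step[OF k, of B n x]
    have "\<bar>wdens (Suc n) es B x\<bar> \<le> (\<integral>t. K * (exp (\<kappa> * V n) * ?f t) \<partial>unit_interval)"
      unfolding wdens_Suc(1)[OF es step.hyps(1)] real_norm_def[symmetric]
    proof (rule Bochner_Integration.integral_norm_bound_integral)
      show "norm (wdens n es (B + g n t) (x - X n t)) \<le> K * (exp (\<kappa> * V n) * ?f t)" for t
        using step.IH[of "B + g n t" "x - X n t"] by (simp add: exp_add[symmetric] add.commute)
    qed (use wdens_Suc(2)[OF es step.hyps(1)] G(1) in auto)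
    also have "\<dots> = K * (exp (\<kappa> * V n) * (\<integral>t. ?f t \<partial>unit_interval))" by simp
    also have "\<dots> \<le> K * (exp (\<kappa> * V n) * exp ((1 + s n) * (norm B)\<^sup>2 - (2 * \<alpha> - s n) * (norm x)\<^sup>2 + \<kappa> * (\<epsilon> n)\<^sup>2 + 8 * \<kappa>\<^sup>2 * (\<epsilon> n)\<^sup>2 * ((norm B)\<^sup>2 + (norm x)\<^sup>2)))"
      by (intro mult_left_mono G(2) K0) auto
    also have "\<dots> = K * exp ((1 + s (Suc n)) * (norm B)\<^sup>2 - (2 * \<alpha> - s (Suc n)) * (norm x)\<^sup>2 + \<kappa> * V (Suc n))"
      unfolding exp_add[symmetric] s_def V_Suc[OF step.hyps(1)] by (simp add: algebra_simps)
    finally show ?case .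
  qed
  \<comment> \<open>From \<open>s n \<le> 1\<close> and 8 \<kappa> \<ge> 1. This is the 1 inside
    \<open>exp (2 * \<alpha> * R\<^sup>2 + 1)\<close>.\<close>
  have "\<kappa> * V n \<le> 1"
  proof -
    have "\<kappa> * 1 \<le> \<kappa> * (8 * \<kappa>)" using \<alpha> by (intro mult_left_mono) (auto simp: \<kappa>_def)
    then have "\<kappa> * V n \<le> (\<kappa> * (8 * \<kappa>)) * V n" using V0[of n] by (intro mult_right_mono) auto
    then show ?thesis using s(2)[of n] by (simp add: s_def power2_eq_square mult_ac)
  qed
  moreover have "\<alpha> * (norm x)\<^sup>2 \<le> (2 * \<alpha> - s n) * (norm x)\<^sup>2" using s[of n] by (intro mult_right_mono) auto
  ultimately have "exp ((1 + s n) * (norm (0::complex))\<^sup>2 - (2 * \<alpha> - s n) * (norm x)\<^sup>2 + \<kappa> * V n) \<le> exp (1 + (- \<alpha> * (norm x)\<^sup>2))"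
    by simp
  from order_trans[OF main mult_left_mono[OF this K0]]
  show ?thesis unfolding K_def exp_add by (simp only: mult_ac)
qed

text \<open>The limiting characteristic function inherits the decay in y pointwise, so it has its
  own smooth inverse transform. Each derivative of the densities converges by dominated convergence,
  and the bounds pass to the limit.\<close>

theorem density_bounds:
  assumes R: "(\<Sum>m<n0. \<epsilon> m) \<le> R" and \<alpha>: "\<alpha> > 0"
    and tail: "\<And>n. 8 * (2 + 2 * \<alpha>)\<^sup>2 * (\<Sum>m\<in>{n0..<n}. (\<epsilon> m)\<^sup>2) \<le> min 1 \<alpha>"
  defines "K \<equiv> C * decay_integral TYPE('a) * exp (2 * \<alpha> * R\<^sup>2 + 1)"
  shows "n \<ge> n0 \<Longrightarrow> partials_bounded q K \<alpha> (inv_ft (wchar n 0))"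
    and "C_k q (inv_ft wchar_lim)"
    and "partials_bounded q K \<alpha> (inv_ft wchar_lim)"
    and "(\<lambda>n. inv_ft (wchar n 0) x) \<longlonglongrightarrow> inv_ft wchar_lim x"
proof -
  have e: "wdens n [] B = inv_ft (wchar n B)" for n B by (simp add: wdens_def)
  have gb: "\<bar>wdens n es 0 x\<bar> \<le> K * exp (- \<alpha> * (norm x)\<^sup>2)" if "set es \<subseteq> Basis" "length es \<le> q" "n \<ge> n0" for n es x
    unfolding K_def by (rule wdens_gaussian[OF that(1,2) R \<alpha> tail that(3)])
  show "partials_bounded q K \<alpha> (inv_ft (wchar n 0))" if "n \<ge> n0"
    unfolding partials_bounded_def e[symmetric]
    using wdens_density(3)[OF that] gb that by simp
  define c where "c = C * (1 + total)"
  have wb: "norm (wchar n 0 y) \<le> c / (1 + norm y) ^ (2 * DIM('a) + q)" if "n \<ge> n0" for n y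
    using wchar_decay[OF that, of 0 y] by (simp add: c_def)
  have lb: "norm (wchar_lim y) \<le> c / (1 + norm y) ^ (2 * DIM('a) + q)" for y
    by (rule LIMSEQ_le_const2[OF tendsto_norm[OF wchar_tendsto[of y]]]) (use wb in blast)
  note li = decay_power_integrable[OF wchar_lim_measurable lb]
  show "C_k q (inv_ft wchar_lim)" by (rule inv_ft_smooth(1)[OF wchar_lim_measurable li])
  have c0: "c \<ge> 0" using C_nonneg total_bound[of "{}"] by (simp add: c_def)
  have lim: "(\<lambda>n. wdens n es 0 x) \<longlonglongrightarrow> inv_ft (\<lambda>y. partial_symbol es y * wchar_lim y) x"
    if es: "set es \<subseteq> Basis" "length es \<le> q" for es x
  proof (rule LIMSEQ_offset[where k = n0], unfold wdens_def, rule inv_ft_tendsto)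
    show "integrable lborel (\<lambda>y::'a. c * (1 / (1 + norm y) ^ (2 * DIM('a))))"
      by (intro integrable_mult_right integrable_inverse_norm_power)
    show "norm (partial_symbol es y * wchar (n + n0) 0 y) \<le> c * (1 / (1 + norm y) ^ (2 * DIM('a)))" for n y
      by (rule symbol_decay[OF es wb c0]) simp
    show "(\<lambda>n. partial_symbol es y * wchar (n + n0) 0 y) \<longlonglongrightarrow> partial_symbol es y * wchar_lim y" for y
      by (intro tendsto_intros LIMSEQ_ignore_initial_segment wchar_tendsto)
  qed measurable
  show "partials_bounded q K \<alpha> (inv_ft wchar_lim)"
    unfolding partials_bounded_def
  proof (intro allI impI, elim conjE)
    fix es :: "'a list" and x assume es: "set es \<subseteq> Basis" "length es \<le> q"
    have "\<bar>inv_ft (\<lambda>y. partial_symbol es y * wchar_lim y) x\<bar> \<le> K * exp (- \<alpha> * (norm x)\<^sup>2)"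
      by (rule LIMSEQ_le_const2[OF tendsto_rabs[OF lim[OF es]]]) (use gb[OF es] in blast)
    then show "\<bar>iter_partial es (inv_ft wchar_lim) x\<bar> \<le> K * exp (- \<alpha> * (norm x)\<^sup>2)"
      using inv_ft_smooth(2)[OF wchar_lim_measurable li es] by simp
  qed
  show "(\<lambda>n. inv_ft (wchar n 0) x) \<longlonglongrightarrow> inv_ft wchar_lim x"
    using lim[of "[]"] by (simp add: e)
qed

end

section \<open>Decay of the characteristic functions\<close>

lemma prod_if_mem:
  assumes "finite A" shows "(\<Prod>m\<in>A. if m \<in> T then a else 1) = (a::'b::comm_monoid_mult) ^ card (A \<inter> T)"
  using assms by (simp add: prod.If_cases Int_def)

lemma borel_measurable_cnj [measurable]: "cnj \<in> borel_measurable borel"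
  by (intro borel_measurable_continuous_onI continuous_intros)

context random_walk
begin

text \<open>The squared weight is expanded into (n + 1)^2 terms, each a product over independent
  coordinates. The weight touches at most two coordinates of a term; every other coordinate in S
  contributes a plain exponential integral, bounded by \<kappa>. Hence the exponent
  \<open>card S - 2\<close>.\<close>

lemma wchar_product_bound:
  assumes S: "S \<subseteq> {..<n}" and k: "0 \<le> \<kappa>" "\<kappa> \<le> 1"
    and K: "\<And>m. m \<in> S \<Longrightarrow> norm (\<integral>s. iexp (X m s \<bullet> y) \<partial>unit_interval) \<le> \<kappa>"
    and e: "e \<ge> 1" "\<And>m. m < n \<Longrightarrow> \<epsilon> m \<le> e"
  shows "norm (wchar n B y) \<le> (real n + 1)\<^sup>2 * (e ^ 4 * (1 + norm B)\<^sup>2 * \<kappa> ^ (card S - 2))"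
proof -
  define c where "c i j = (if i < n then 1 else B) * (if j < n then 1 else cnj B)" for i j
  define f where "f i j m s = (if m = i then g m s else 1) * (if m = j then cnj (g m s) else 1) * iexp (X m s \<bullet> y)" for i j m s
  \<comment> \<open>The extra index n carries the shift B, so that the weight is the square of a
    single sum over \<open>{..n}\<close>.\<close>
  define G where "G i t = (if i < n then g i (t i) else B)" for i and t :: "nat \<Rightarrow> real"
  have amp: "amplitude n t + B = (\<Sum>i\<le>n. G i t)" for t
  proof -
    have "{..n} = insert n {..<n}" by auto
    then show ?thesis by (simp add: G_def amplitude_def add.commute)
  qed
  have summand: "G i t * cnj (G j t) * iexp (position n t \<bullet> y) = c i j * (\<Prod>m<n. f i j m (t m))" for i j t
  proof -
    have "iexp (position n t \<bullet> y) = (\<Prod>m<n. iexp (X m (t m) \<bullet> y))"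
      unfolding position_def inner_sum_left by (rule iexp_sum) simp
    moreover have "G i t = (if i < n then 1 else B) * (\<Prod>m<n. if m = i then g m (t m) else 1)"
      unfolding G_def by (simp add: prod.delta)
    moreover have "cnj (G j t) = (if j < n then 1 else cnj B) * (\<Prod>m<n. if m = j then cnj (g m (t m)) else 1)"
      unfolding G_def by (simp add: prod.delta)
    ultimately show ?thesis unfolding f_def c_def prod.distrib by (simp add: mult_ac)
  qed
  have fb: "norm (f i j m s) \<le> e\<^sup>2" if "m < n" for i j m s
  proof -
    have "norm (g m s) \<le> e" using g_le[of m s] e(2)[OF that] by simp
    then have "norm (if m = i then g m s else 1) * norm (if m = j then cnj (g m s) else 1) \<le> e * e"
      using e(1) by (intro mult_mono) auto
    then show ?thesis by (simp add: f_def norm_mult power2_eq_square)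
  qed
  have fi: "integrable unit_interval (f i j m)" if "m < n" for i j m
  proof (rule unit_interval.integrable_const_bound[where B = "e\<^sup>2"])
    have "(\<lambda>s. if m = i then g m s else 1) \<in> borel_measurable unit_interval"
      by (cases "m = i") auto
    moreover have "(\<lambda>s. if m = j then cnj (g m s) else 1) \<in> borel_measurable unit_interval"
      using measurable_compose[OF g_unit borel_measurable_cnj, of m] by (cases "m = j") auto
    moreover have "(\<lambda>s. iexp (X m s \<bullet> y)) \<in> borel_measurable unit_interval"
      by measurable
    ultimately have "(\<lambda>s. f i j m s) \<in> borel_measurable unit_interval"
      unfolding f_def by (intro borel_measurable_times)
    then show "f i j m \<in> borel_measurable unit_interval" .
  qed (intro AE_I2 fb[OF that])
  have pint: "integrable (torus n) (\<lambda>t. \<Prod>m<n. f i j m (t m))" for i j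
    unfolding torus_def by (rule torus.product_integrable_prod) (use fi in auto)
  have pval: "(\<integral>t. (\<Prod>m<n. f i j m (t m)) \<partial>torus n) = (\<Prod>m<n. \<integral>s. f i j m s \<partial>unit_interval)" for i j
    unfolding torus_def by (rule torus.product_integral_prod) (use fi in auto)
  have pbound: "norm (\<Prod>m<n. \<integral>s. f i j m s \<partial>unit_interval) \<le> e ^ 4 * \<kappa> ^ (card S - 2)" for i j
  proof -
    have "norm (\<integral>s. f i j m s \<partial>unit_interval) \<le> (if m \<in> {i, j} then e\<^sup>2 else 1) * (if m \<in> S - {i, j} then \<kappa> else 1)" if m: "m < n" for m
    proof (cases "m \<in> {i, j}")
      case True
      have "norm (\<integral>s. f i j m s \<partial>unit_interval) \<le> (\<integral>s. norm (f i j m s) \<partial>unit_interval)" by (rule integral_norm_bound)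
      also have "\<dots> \<le> e\<^sup>2" by (rule unit_interval.integral_le_const[OF integrable_norm[OF fi[OF m]]]) (use fb[OF m] in auto)
      finally show ?thesis using True by auto
    next
      case False
      then have f: "f i j m = (\<lambda>s. iexp (X m s \<bullet> y))" by (auto simp: f_def fun_eq_iff)
      have "norm (\<integral>s. iexp (X m s \<bullet> y) \<partial>unit_interval) \<le> (\<integral>s. norm (iexp (X m s \<bullet> y)) \<partial>unit_interval)" by (rule integral_norm_bound)
      also have "\<dots> = 1" using unit_interval.prob_space by simp
      finally show ?thesis using False K[of m] unfolding f by auto
    qed
    then have "norm (\<Prod>m<n. \<integral>s. f i j m s \<partial>unit_interval) \<le> (\<Prod>m<n. (if m \<in> {i, j} then e\<^sup>2 else 1) * (if m \<in> S - {i, j} then \<kappa> else 1))"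
      unfolding prod_norm[symmetric] by (intro prod_mono) auto
    also have "\<dots> = (e\<^sup>2) ^ card ({..<n} \<inter> {i, j}) * \<kappa> ^ card ({..<n} \<inter> (S - {i, j}))"
      unfolding prod.distrib by (simp only: prod_if_mem finite_lessThan)
    also have "\<dots> \<le> (e\<^sup>2) ^ 2 * \<kappa> ^ (card S - 2)"
    proof (rule mult_mono)
      have c2: "card {i, j} \<le> 2" by (cases "i = j") auto
      have "card ({..<n} \<inter> {i, j}) \<le> card {i, j}" by (rule card_mono) auto
      with c2 have "card ({..<n} \<inter> {i, j}) \<le> 2" by simp
      moreover have "1 \<le> e\<^sup>2" using e(1) by (rule one_le_power)
      ultimately show "(e\<^sup>2) ^ card ({..<n} \<inter> {i, j}) \<le> (e\<^sup>2) ^ 2" by (rule power_increasing)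
      have "card S - card {i, j} \<le> card (S - {i, j})" by (rule diff_card_le_card_Diff) simp
      moreover have "{..<n} \<inter> (S - {i, j}) = S - {i, j}" using S by auto
      ultimately have "card S - 2 \<le> card ({..<n} \<inter> (S - {i, j}))" using c2 by simp
      then show "\<kappa> ^ card ({..<n} \<inter> (S - {i, j})) \<le> \<kappa> ^ (card S - 2)"
        using k by (intro power_decreasing)
    qed (use k in auto)
    finally show ?thesis by (simp add: power_mult[symmetric])
  qed
  have cb: "norm (c i j) \<le> (1 + norm B)\<^sup>2" for i j
    unfolding c_def norm_mult power2_eq_square by (intro mult_mono) auto
  have "of_real ((norm (amplitude n t + B))\<^sup>2) * iexp (position n t \<bullet> y) = (\<Sum>i\<le>n. \<Sum>j\<le>n. c i j * (\<Prod>m<n. f i j m (t m)))" for t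
  proof -
    have "of_real ((norm (amplitude n t + B))\<^sup>2) = (\<Sum>i\<le>n. G i t) * cnj (\<Sum>i\<le>n. G i t)"
      unfolding amp by (rule complex_norm_square)
    also have "\<dots> = (\<Sum>i\<le>n. \<Sum>j\<le>n. G i t * cnj (G j t))"
      by (simp add: sum_product cnj_sum)
    finally show ?thesis by (simp add: sum_distrib_right summand)
  qed
  then have "wchar n B y = (\<Sum>i\<le>n. \<Sum>j\<le>n. c i j * (\<Prod>m<n. \<integral>s. f i j m s \<partial>unit_interval))"
    unfolding wchar_def using pint by (simp add: Bochner_Integration.integral_sum pval)
  also have "norm \<dots> \<le> (\<Sum>i\<le>n. \<Sum>j\<le>n. (1 + norm B)\<^sup>2 * (e ^ 4 * \<kappa> ^ (card S - 2)))"
    by (intro sum_norm_le order_trans[OF norm_sum] sum_mono) (auto simp: norm_mult intro!: mult_mono cb pbound)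
  also have "\<dots> = (real n + 1)\<^sup>2 * (e ^ 4 * (1 + norm B)\<^sup>2 * \<kappa> ^ (card S - 2))"
    by (simp add: power2_eq_square mult_ac add.commute)
  finally show ?thesis .
qed

text \<open>For |y| \<ge> Q^2 at least 2 N factors Q / sqrt |y|, each at most 1, survive the weight
  and give (Q^2 / |y|)^N. For smaller y the bound without oscillation suffices, since then 1 + |y|
  \<le> 2 Q^2.\<close>

lemma wchar_base_bound:
  assumes Q: "Q \<ge> 1" and e: "e \<ge> 1" "\<And>m. m < n \<Longrightarrow> \<epsilon> m \<le> e"
    and good: "\<And>y. norm y \<ge> Q\<^sup>2 \<Longrightarrow> \<exists>S\<subseteq>{..<n}. card S = 2 * N + 2 \<and>
      (\<forall>m\<in>S. norm (\<integral>s. iexp (X m s \<bullet> y) \<partial>unit_interval) \<le> Q / sqrt (norm y))"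
  shows "norm (wchar n B y) \<le> (2 * (real n + 1)\<^sup>2 * e ^ 4 * (2 * Q\<^sup>2) ^ N) * (1 + (norm B)\<^sup>2) / (1 + norm y) ^ N"
proof -
  define D where "D = (real n + 1)\<^sup>2 * (e ^ 4 * (1 + norm B)\<^sup>2)"
  have D0: "D \<ge> 0" using e by (auto simp: D_def)
  have Q2: "1 \<le> Q\<^sup>2" using Q by (rule one_le_power)
  have "norm (wchar n B y) \<le> D * ((2 * Q\<^sup>2) ^ N / (1 + norm y) ^ N)"
  proof (cases "norm y \<ge> Q\<^sup>2")
    case True
    from good[OF this] obtain S where S: "S \<subseteq> {..<n}" "card S = 2 * N + 2"
      "\<forall>m\<in>S. norm (\<integral>s. iexp (X m s \<bullet> y) \<partial>unit_interval) \<le> Q / sqrt (norm y)"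
      by (elim exE conjE)
    have y1: "norm y \<ge> 1" using True Q2 by simp
    have "Q \<le> sqrt (norm y)" using True Q by (intro real_le_rsqrt) auto
    then have k1: "Q / sqrt (norm y) \<le> 1" using y1 by (simp add: divide_le_eq)
    have "norm (wchar n B y) \<le> D * (Q / sqrt (norm y)) ^ (2 * N)"
      using wchar_product_bound[OF S(1) _ k1 bspec[OF S(3)] e, of B] Q y1 unfolding S(2) D_def by (simp add: mult_ac)
    also have "(Q / sqrt (norm y)) ^ (2 * N) = (Q\<^sup>2 / norm y) ^ N"
    proof -
      have "(sqrt (norm y))\<^sup>2 = norm y" by (rule real_sqrt_pow2) simp
      then show ?thesis unfolding power_mult power_divide by (simp only:)
    qed
    also have "D * (Q\<^sup>2 / norm y) ^ N \<le> D * (2 * Q\<^sup>2 / (1 + norm y)) ^ N"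
    proof (intro mult_left_mono power_mono D0)
      have "2 * Q\<^sup>2 / (2 * norm y) \<le> 2 * Q\<^sup>2 / (1 + norm y)"
        using y1 by (intro divide_left_mono mult_pos_pos) auto
      then show "Q\<^sup>2 / norm y \<le> 2 * Q\<^sup>2 / (1 + norm y)" by simp
    qed (use y1 in auto)
    finally show ?thesis unfolding power_divide .
  next
    case False
    have "norm (wchar n B y) \<le> D * 1"
      using wchar_product_bound[of "{}" n 1 y e B] e unfolding D_def by simp
    also have "\<dots> \<le> D * ((2 * Q\<^sup>2) ^ N / (1 + norm y) ^ N)"
    proof (intro mult_left_mono D0)
      have "(1 + norm y) ^ N \<le> (2 * Q\<^sup>2) ^ N" using False Q2 by (intro power_mono) auto
      moreover have "(1 + norm y) ^ N > 0" by (intro zero_less_power add_pos_nonneg) auto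
      ultimately show "1 \<le> (2 * Q\<^sup>2) ^ N / (1 + norm y) ^ N" by (simp add: le_divide_eq)
    qed
    finally show ?thesis .
  qed
  also have "\<dots> \<le> ((real n + 1)\<^sup>2 * (e ^ 4 * (2 * (1 + (norm B)\<^sup>2)))) * ((2 * Q\<^sup>2) ^ N / (1 + norm y) ^ N)"
  proof (rule mult_right_mono)
    have "0 \<le> (1 - norm B)\<^sup>2" by simp
    then have "(1 + norm B)\<^sup>2 \<le> 2 * (1 + (norm B)\<^sup>2)" by (simp add: power2_eq_square algebra_simps)
    then show "D \<le> (real n + 1)\<^sup>2 * (e ^ 4 * (2 * (1 + (norm B)\<^sup>2)))"
      unfolding D_def using e by (intro mult_left_mono) auto
  qed (use Q in auto)
  finally show ?thesis by (simp only: mult_ac times_divide_eq_right times_divide_eq_left)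
qed

end

text \<open>The torus uses [0,1), the oscillation estimate [0,1]; the endpoint is
  negligible.\<close>

lemma unit_interval_integral:
  fixes f :: "real \<Rightarrow> 'b::euclidean_space"
  assumes f: "continuous_on UNIV f"
  shows "(\<integral>s. f s \<partial>unit_interval) = integral {0..1} f"
proof -
  have "set_integrable lborel {0..1} f"
    unfolding set_integrable_def
    by (rule borel_integrable_compact[OF compact_Icc continuous_on_subset[OF f subset_UNIV]])
  then have i: "set_integrable lborel {0..<1} f"
    by (rule set_integrable_subset) auto
  have "(\<integral>s. f s \<partial>unit_interval) = (LINT s:{0..<1}|lborel. f s)"
    by (simp add: integral_restrict_space set_lebesgue_integral_def)
  also have "\<dots> = integral {0..<1} f" by (rule set_borel_integral_eq_integral(2)[OF i])
  also have "\<dots> = integral {0..1} f"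
    by (rule integral_spike_set) (auto intro: negligible_subset[of "{1}"])
  finally show ?thesis .
qed

section \<open>Local factors\<close>

lemma has_real_derivative_Re_Im:
  assumes "(f has_vector_derivative f') (at t)"
  shows "((\<lambda>t. Re (f t)) has_real_derivative Re f') (at t)"
    and "((\<lambda>t. Im (f t)) has_real_derivative Im f') (at t)"
  unfolding has_real_derivative_iff_has_vector_derivative
  using bounded_linear.has_vector_derivative[OF bounded_linear_Re assms]
    bounded_linear.has_vector_derivative[OF bounded_linear_Im assms] by auto

text \<open>Dominates the tails of the series and of its derivatives up to order 3. The ratio 3/4
  lies above 2^(-1/2), the largest value that p^(\<theta> - \<sigma>) can approach.\<close>

definition tail_const :: real where
  "tail_const = (\<Sum>i\<le>3. \<Sum>k. real (k + 2) ^ i * (3 / 4) ^ k)"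

text \<open>The constant of \<open>oscillatory_integral_bound\<close> with C = 10 \<pi>^3 and c =
  1/8. The former is 8 \<pi>^3 from three differentiations times 5/4 for the perturbation of the
  first harmonic; the latter is explained in \<open>circle_oscillation\<close>.\<close>

definition osc_const :: real where
  "osc_const = (10 * pi ^ 3 + 1) * (1 + 2 * (10 * pi ^ 3)) / (1 / 8)"

lemma osc_const_ge_1: "osc_const \<ge> 1"
proof -
  have "(1::real) * 1 \<le> (10 * pi ^ 3 + 1) * (1 + 2 * (10 * pi ^ 3))"
    by (intro mult_mono) auto
  then show ?thesis unfolding osc_const_def by simp
qed

lemma tail_summable: "summable (\<lambda>k. real (k + 2) ^ i * (3 / 4) ^ k)"
proof -
  interpret circle_coeffs "\<lambda>_. 0" 0 0 by unfold_locales auto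
  have "summable (\<lambda>k. real (k + 2) ^ i * (3 / 4) ^ (k + 2))"
    by (rule summable_ignore_initial_segment[OF summable_majorant]) auto
  then have "summable (\<lambda>k. (real (k + 2) ^ i * (3 / 4) ^ (k + 2)) * (16 / 9))" by (rule summable_mult2)
  then show ?thesis by (simp add: power_add power2_eq_square)
qed

lemma tail_const_ge: "i \<le> 3 \<Longrightarrow> (\<Sum>k. real (k + 2) ^ i * (3 / 4) ^ k) \<le> tail_const"
  unfolding tail_const_def
  by (rule member_le_sum[of i "{..3}"], simp, rule suminf_nonneg[OF tail_summable]) simp_all

lemma tail_const_nonneg: "tail_const \<ge> 0"
  unfolding tail_const_def by (intro sum_nonneg suminf_nonneg tail_summable) auto

context circle_coeffs
begin

lemma circle_series_near:
  assumes "rho \<le> 3 / 4" "i \<le> 3"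
  shows "norm (circle_series d i t - d 1 * iexp (- 2 * pi * t)) \<le> B * rho\<^sup>2 * tail_const"
proof -
  have "norm (circle_series d i t - d 1 * iexp (- 2 * pi * t)) \<le> B * rho\<^sup>2 * (\<Sum>k. real (k + 2) ^ i * (3 / 4) ^ k)"
    by (rule circle_series_tail) (use assms in auto)
  also have "\<dots> \<le> B * rho\<^sup>2 * tail_const"
    by (intro mult_left_mono tail_const_ge assms mult_nonneg_nonneg B_nonneg) auto
  finally show ?thesis .
qed

lemma circle_series_bound:
  assumes "rho \<le> 3 / 4" "i \<le> 3"
  shows "norm (circle_series d i t) \<le> B * (1 + tail_const) * rho"
proof -
  have "norm (circle_series d i t) \<le> norm (d 1 * iexp (- 2 * pi * t)) + norm (circle_series d i t - d 1 * iexp (- 2 * pi * t))"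
    by (rule norm_triangle_sub)
  also have "\<dots> \<le> B * rho + B * rho\<^sup>2 * tail_const"
    using d_bound[of 1] by (intro add_mono circle_series_near assms) (simp add: norm_mult)
  also have "B * rho\<^sup>2 * tail_const \<le> B * rho * tail_const"
  proof -
    have "rho\<^sup>2 \<le> rho" using lam by (simp add: power2_eq_square mult_left_le_one_le)
    then show ?thesis using B_nonneg tail_const_nonneg by (intro mult_right_mono mult_left_mono)
  qed
  finally show ?thesis by (simp add: algebra_simps)
qed

text \<open>Dividing the k-th coefficient by k produces a periodic antiderivative, which reduces
  index 0 to a positive index; \<open>d_0\<close> makes the division harmless at k = 0.\<close>

lemma circle_series_mean: "(circle_series d i has_integral 0) {0..1}"
proof (cases i)
  case 0
  define d' where "d' k = d k / of_nat k" for k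
  interpret d': circle_coeffs d' B rho
  proof
    show "norm (d' k) \<le> B * rho ^ k" for k
    proof (cases "k = 0")
      case False
      then have "norm (d k) / real k \<le> norm (d k) / 1" by (intro divide_left_mono) auto
      then show ?thesis using d_bound[of k] by (simp add: d'_def norm_divide)
    qed (use B_nonneg in \<open>simp add: d'_def\<close>)
  qed (use lam in \<open>auto simp: d'_def d_0\<close>)
  have "circle_series d' (Suc 0) = circle_series d 0"
    unfolding circle_series_def
    by (intro ext suminf_cong) (simp add: d'_def d_0)
  then show ?thesis using d'.circle_series_mean_Suc[of 0] 0 by simp
next
  case (Suc i)
  then show ?thesis using circle_series_mean_Suc by simp
qed

text \<open>With a = |d 1|, the smallness hypothesis keeps the phase and its derivatives, suitably
  scaled, within a/4 of a single harmonic of size a. The first and second derivatives see its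
  imaginary and real parts, which cannot both be small. For a < 1 the bound 1 for the modulus
  suffices, because \<open>osc_const_ge_1\<close>.\<close>

lemma circle_oscillation:
  assumes r: "rho \<le> 3 / 4" and a: "norm (d 1) > 0" and small: "B * rho\<^sup>2 * tail_const \<le> norm (d 1) / 4"
  shows "norm (\<integral>s. iexp (Re (circle_series d 0 s)) \<partial>unit_interval) \<le> osc_const / sqrt (norm (d 1))"
proof -
  define a where "a = norm (d 1)"
  define S where "S i t = circle_series d i t" for i t
  define f1 where "f1 t = 2 * pi * Im (S 1 t)" for t
  define f2 where "f2 t = - (4 * pi\<^sup>2) * Re (S 2 t)" for t
  define f3 where "f3 t = - (8 * pi ^ 3) * Im (S 3 t)" for t
  have dS: "(S i has_vector_derivative (- 2 * of_real pi * \<i> * S (Suc i) t)) (at t)" for i t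
    unfolding S_def by (rule circle_series_deriv)
  have cS: "continuous_on A (S i)" for A i unfolding S_def by (rule circle_series_continuous)
  have per: "S i 1 = S i 0" for i unfolding S_def by (rule circle_series_periodic)
  have near: "norm (S i t - d 1 * iexp (- 2 * pi * t)) \<le> a / 4" if "i \<le> 3" for i t
    unfolding S_def a_def by (rule order_trans[OF circle_series_near[OF r that] small])
  have nz: "norm (d 1 * iexp (- 2 * pi * t)) = a" for t by (simp add: norm_mult a_def)
  have Sb: "norm (S i t) \<le> 5 / 4 * a" if "i \<le> 3" for i t
    using norm_triangle_sub[of "S i t" "d 1 * iexp (- 2 * pi * t)"] near[OF that, of t] nz[of t] by simp
  have a0: "a > 0" using a by (simp add: a_def)
  have p1: "1 \<le> pi" using pi_gt3 by simp
  have bound: "norm (integral {0..1} (\<lambda>t. iexp (Re (S 0 t)))) \<le> (10 * pi ^ 3 + 1) * (1 + 2 * (10 * pi ^ 3)) / (1 / 8) / sqrt a" if "a \<ge> 1"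
  proof (rule oscillatory_integral_bound[where ?f1.0 = f1 and ?f2.0 = f2 and ?f3.0 = f3])
    show "((\<lambda>t. Re (S 0 t)) has_real_derivative f1 t) (at t)" for t
      using has_real_derivative_Re_Im(1)[OF dS[of 0 t]] by (simp add: f1_def)
    show "(f1 has_real_derivative f2 t) (at t)" for t
      unfolding f1_def[abs_def] using DERIV_cmult[OF has_real_derivative_Re_Im(2)[OF dS[of 1 t]], of "2 * pi"]
      by (simp add: f2_def power2_eq_square numeral_2_eq_2 mult_ac)
    show "(f2 has_real_derivative f3 t) (at t)" for t
      unfolding f2_def[abs_def] using DERIV_cmult[OF has_real_derivative_Re_Im(1)[OF dS[of 2 t]], of "- (4 * pi\<^sup>2)"]
      by (simp add: f3_def power2_eq_square power3_eq_cube numeral_3_eq_3 numeral_2_eq_2 mult_ac)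
    show "continuous_on UNIV f3" unfolding f3_def[abs_def] by (intro continuous_intros cS)
    show "f1 1 = f1 0" "f2 1 = f2 0" "Re (S 0 1) = Re (S 0 0)" by (simp_all add: f1_def f2_def per)
    show "\<bar>f2 t\<bar> \<le> 10 * pi ^ 3 * a" for t
    proof -
      have "\<bar>Re (S 2 t)\<bar> \<le> 5 / 4 * a" using Sb[of 2 t] abs_Re_le_cmod[of "S 2 t"] by simp
      then have "\<bar>f2 t\<bar> \<le> 4 * pi\<^sup>2 * (5 / 4 * a)"
        unfolding f2_def abs_mult by (intro mult_mono) auto
      also have "\<dots> \<le> 10 * pi ^ 3 * a"
      proof -
        have "pi\<^sup>2 * 1 \<le> pi\<^sup>2 * pi" by (intro mult_left_mono p1) auto
        then have "5 * (pi\<^sup>2 * a) \<le> 5 * (pi ^ 3 * a)" using a0 by (intro mult_left_mono mult_right_mono) (auto simp: power2_eq_square power3_eq_cube)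
        moreover have "0 \<le> pi ^ 3 * a" using a0 by simp
        moreover have "4 * pi\<^sup>2 * (5 / 4 * a) = 5 * (pi\<^sup>2 * a)" "10 * pi ^ 3 * a = 10 * (pi ^ 3 * a)" by simp_all
        ultimately show ?thesis by linarith
      qed
      finally show ?thesis .
    qed
    show "\<bar>f3 t\<bar> \<le> 10 * pi ^ 3 * a" for t
    proof -
      have "\<bar>Im (S 3 t)\<bar> \<le> 5 / 4 * a" using Sb[of 3 t] abs_Im_le_cmod[of "S 3 t"] by simp
      then have "\<bar>f3 t\<bar> \<le> 8 * pi ^ 3 * (5 / 4 * a)"
        unfolding f3_def abs_mult by (intro mult_mono) auto
      then show ?thesis by (simp add: mult_ac)
    qed
    show "1 / 8 * a\<^sup>2 \<le> (f1 t)\<^sup>2 + (f2 t)\<^sup>2" for t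
    proof -
      define z where "z = d 1 * iexp (- 2 * pi * t)"
      define u where "u = \<bar>Im (S 1 t)\<bar>"
      define v where "v = \<bar>Re (S 2 t)\<bar>"
      have "\<bar>Im (S 1 t) - Im z\<bar> \<le> a / 4"
        using near[of 1 t] abs_Im_le_cmod[of "S 1 t - z"] by (simp add: z_def)
      moreover have "\<bar>Re (S 2 t) - Re z\<bar> \<le> a / 4"
        using near[of 2 t] abs_Re_le_cmod[of "S 2 t - z"] by (simp add: z_def)
      moreover have "a \<le> \<bar>Re z\<bar> + \<bar>Im z\<bar>"
        using cmod_le[of z] nz[of t] by (simp add: z_def)
      \<comment> \<open>The two perturbations cost a/4 each, leaving a/2; squaring a sum of two
        terms costs a factor 2, whence c = 1/8.\<close>
      ultimately have uv: "a / 2 \<le> u + v" unfolding u_def v_def by linarith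
      have "(a / 2)\<^sup>2 \<le> (u + v)\<^sup>2" using uv a0 by (intro power_mono) auto
      also have "\<dots> \<le> 2 * (u\<^sup>2 + v\<^sup>2)"
        using zero_le_power2[of "u - v"] by (simp add: power2_eq_square algebra_simps)
      finally have "1 / 8 * a\<^sup>2 \<le> u\<^sup>2 + v\<^sup>2" by (simp add: power2_eq_square)
      also have "u\<^sup>2 \<le> (f1 t)\<^sup>2"
      proof -
        have "1 * u \<le> 2 * pi * u" using p1 by (intro mult_right_mono) (auto simp: u_def)
        then have "u \<le> \<bar>f1 t\<bar>" by (simp add: f1_def u_def abs_mult)
        then show ?thesis by (metis u_def abs_ge_zero power2_abs power_mono)
      qed
      also have "v\<^sup>2 \<le> (f2 t)\<^sup>2"
      proof -
        have "1 * 1 \<le> 4 * pi\<^sup>2" using p1 by (intro mult_mono one_le_power) auto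
        then have "1 * v \<le> 4 * pi\<^sup>2 * v" by (intro mult_right_mono) (auto simp: v_def)
        then have "v \<le> \<bar>f2 t\<bar>" by (simp add: f2_def v_def abs_mult)
        then show ?thesis by (metis v_def abs_ge_zero power2_abs power_mono)
      qed
      finally show ?thesis by simp
    qed
  qed (use that in auto)
  have eq: "(\<integral>s. iexp (Re (S 0 s)) \<partial>unit_interval) = integral {0..1} (\<lambda>t. iexp (Re (S 0 t)))"
    by (intro unit_interval_integral continuous_intros cS)
  have "norm (\<integral>s. iexp (Re (S 0 s)) \<partial>unit_interval) \<le> osc_const / sqrt a"
  proof (cases "a \<ge> 1")
    case True
    then show ?thesis using bound unfolding eq osc_const_def by simp
  next
    case False
    have "norm (\<integral>s. iexp (Re (S 0 s)) \<partial>unit_interval) \<le> (\<integral>s. norm (iexp (Re (S 0 s))) \<partial>unit_interval)"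
      by (rule integral_norm_bound)
    also have "\<dots> = 1" using unit_interval.prob_space by simp
    also have "1 \<le> osc_const / sqrt a"
    proof -
      have "sqrt a \<le> 1" using False by simp
      then have "sqrt a \<le> osc_const" using osc_const_ge_1 by (rule order_trans)
      then show ?thesis using a0 by (simp add: le_divide_eq)
    qed
    finally show ?thesis .
  qed
  then show ?thesis by (simp add: S_def a_def)
qed

end

text \<open>Coefficients of the local logarithm in the variable z = p^(-(w - \<sigma>)), which runs
  through the unit circle as the torus coordinate varies.\<close>

definition local_coeffs :: "(nat \<Rightarrow> complex) \<Rightarrow> nat \<Rightarrow> real \<Rightarrow> nat \<Rightarrow> complex" where
  "local_coeffs b p \<sigma> k = (if k = 0 then 0 else b (p ^ k) * of_real (real p powr (- \<sigma>)) ^ k)"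

lemma local_coeffs_circle:
  assumes p: "prime p" and \<sigma>: "\<sigma> \<ge> 1" and \<theta>: "\<theta> < 1 / 2" and C: "C \<ge> 0"
    and b: "\<And>k. k \<ge> 1 \<Longrightarrow> norm (b (p ^ k)) \<le> C * real p powr (real k * \<theta>)"
  shows "circle_coeffs (local_coeffs b p \<sigma>) C (real p powr (\<theta> - \<sigma>))"
    and "real p powr (\<theta> - \<sigma>) \<le> 3 / 4"
proof -
  have p2: "real p \<ge> 2" using prime_ge_2_nat[OF p] by simp
  have "real p powr (\<theta> - \<sigma>) \<le> real p powr (- (1/2))"
    using p2 \<sigma> \<theta> by (intro powr_mono) auto
  also have "\<dots> \<le> 2 powr (- (1/2))" using p2 by (intro powr_mono2') auto
  also have "\<dots> = 1 / sqrt 2" by (simp add: powr_minus_divide powr_half_sqrt)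
  also have "\<dots> \<le> 3 / 4"
  proof -
    have "4 / 3 \<le> sqrt 2" by (intro real_le_rsqrt) (simp add: power2_eq_square)
    then have "1 / sqrt 2 \<le> 1 / (4 / 3)" by (intro divide_left_mono) auto
    then show ?thesis by simp
  qed
  finally show le: "real p powr (\<theta> - \<sigma>) \<le> 3 / 4" .
  show "circle_coeffs (local_coeffs b p \<sigma>) C (real p powr (\<theta> - \<sigma>))"
  proof
    fix k
    show "norm (local_coeffs b p \<sigma> k) \<le> C * (real p powr (\<theta> - \<sigma>)) ^ k"
    proof (cases "k = 0")
      case False
      have "norm (local_coeffs b p \<sigma> k) = norm (b (p ^ k)) * (real p powr (- \<sigma>)) ^ k"
        using False by (simp add: local_coeffs_def norm_mult norm_power)
      also have "\<dots> \<le> C * real p powr (real k * \<theta>) * (real p powr (- \<sigma>)) ^ k"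
        using False by (intro mult_right_mono b) auto
      also have "\<dots> = C * (real p powr (\<theta> - \<sigma>)) ^ k"
        using p2 by (simp add: powr_power powr_add[symmetric] algebra_simps)
      finally show ?thesis .
    qed (use C in \<open>simp add: local_coeffs_def\<close>)
  qed (use le in \<open>auto simp: local_coeffs_def\<close>)
qed

lemma suminf_Suc_zero:
  fixes f :: "nat \<Rightarrow> 'b::real_normed_vector"
  assumes "f 0 = 0" shows "(\<Sum>k. f (Suc k)) = (\<Sum>k. f k)"
proof -
  have "(\<lambda>k. f (Suc k)) sums s \<longleftrightarrow> f sums s" for s
    using sums_Suc_iff[of f s] assms by (metis add_0_right)
  then show ?thesis by (simp add: suminf_def)
qed

lemma log_local_power_series:
  assumes p: "prime p"
  shows "log_local b p w = (\<Sum>k. of_nat k ^ 0 * local_coeffs b p \<sigma> k * exp (- (w - of_real \<sigma>) * of_real (ln (real p))) ^ k)"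
proof -
  have p0: "real p > 0" using prime_gt_0_nat[OF p] by simp
  define h where "h k = of_nat k ^ 0 * local_coeffs b p \<sigma> k * exp (- (w - of_real \<sigma>) * of_real (ln (real p))) ^ k" for k
  have "b (p ^ Suc k) * of_nat p powr (- (of_nat (Suc k) * w))
     = of_nat (Suc k) ^ 0 * local_coeffs b p \<sigma> (Suc k) * exp (- (w - of_real \<sigma>) * of_real (ln (real p))) ^ Suc k" for k
  proof -
    have "of_nat p powr (- (of_nat (Suc k) * w)) = exp (of_nat (Suc k) * (- w * of_real (ln (real p))))"
      using p0 by (simp add: powr_def Ln_of_nat mult_ac)
    also have "\<dots> = exp (- w * of_real (ln (real p))) ^ Suc k"
      by (rule exp_of_nat_mult)
    also have "exp (- w * of_real (ln (real p))) = of_real (real p powr (- \<sigma>)) * exp (- (w - of_real \<sigma>) * of_real (ln (real p)))"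
    proof -
      have "complex_of_real (real p powr (- \<sigma>)) = exp (- of_real \<sigma> * of_real (ln (real p)))"
        using p0 by (simp add: powr_def flip: exp_of_real)
      then show ?thesis by (simp add: exp_add[symmetric] algebra_simps)
    qed
    finally show ?thesis by (simp only: power_mult_distrib local_coeffs_def) simp
  qed
  then have "log_local b p w = (\<Sum>k. h (Suc k))"
    unfolding log_local_def h_def by (intro suminf_cong)
  also have "\<dots> = (\<Sum>k. h k)" by (rule suminf_Suc_zero) (simp add: h_def local_coeffs_def)
  finally show ?thesis by (simp only: h_def)
qed

text \<open>At the shifted point z becomes exp(-2 \<pi> i t). The logarithmic derivative is -ln p
  times z d/dz of the same series, the exponential in \<open>local_factor\<close>
  cancelling.\<close>

lemma log_local_shifted:
  fixes t :: real
  assumes p: "prime p" and cc: "circle_coeffs (local_coeffs b p \<sigma>) C \<rho>"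
  defines "s \<equiv> of_real \<sigma> + 2 * of_real pi * \<i> * of_real t / of_real (ln (real p))"
  shows "log_local b p s = circle_series (local_coeffs b p \<sigma>) 0 t"
    and "deriv (local_factor b p) s / local_factor b p s = - of_real (ln (real p)) * circle_series (local_coeffs b p \<sigma>) 1 t"
proof -
  interpret circle_coeffs "local_coeffs b p \<sigma>" C \<rho> by fact
  have l0: "ln (real p) > 0" using prime_ge_2_nat[OF p] by simp
  define e where "e w = exp (- (w - of_real \<sigma>) * of_real (ln (real p)))" for w :: complex
  define P where "P i z = (\<Sum>k. of_nat k ^ i * local_coeffs b p \<sigma> k * z ^ k)" for i and z :: complex
  have ll: "log_local b p = (\<lambda>w. P 0 (e w))"
    unfolding P_def e_def by (rule ext) (rule log_local_power_series[OF p])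
  have es: "e s = iexp (- 2 * pi * t)"
    unfolding e_def s_def using l0 by (simp add: mult_ac)
  have cs: "circle_series (local_coeffs b p \<sigma>) i t = P i (e s)" for i
    unfolding circle_series_def P_def es ..
  show "log_local b p s = circle_series (local_coeffs b p \<sigma>) 0 t"
    unfolding ll cs ..
  have "norm (e s) \<le> 1" unfolding es by simp
  from power_series_deriv[OF this, of 0]
  obtain D where D: "(P 0 has_field_derivative D) (at (e s))" "e s * D = P (Suc 0) (e s)"
    unfolding P_def[symmetric] by (elim exE conjE)
  have "(e has_field_derivative e s * (- of_real (ln (real p)))) (at s)"
    unfolding e_def by (auto intro!: derivative_eq_intros)
  from DERIV_chain2[OF D(1) this]
  have d: "(log_local b p has_field_derivative D * (e s * (- of_real (ln (real p))))) (at s)"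
    unfolding ll .
  have lf: "local_factor b p = (\<lambda>w. exp (log_local b p w))" by (simp add: local_factor_def fun_eq_iff)
  have "(local_factor b p has_field_derivative exp (log_local b p s) * (D * (e s * (- of_real (ln (real p)))))) (at s)"
    unfolding lf by (rule DERIV_chain2[OF DERIV_exp d])
  then have "deriv (local_factor b p) s = local_factor b p s * (D * (e s * (- of_real (ln (real p)))))"
    unfolding lf by (rule DERIV_imp_deriv)
  moreover have "local_factor b p s \<noteq> 0" by (simp add: lf)
  ultimately have "deriv (local_factor b p) s / local_factor b p s = D * (e s * (- of_real (ln (real p))))" by simp
  also have "\<dots> = - of_real (ln (real p)) * (e s * D)" by simp
  finally show "deriv (local_factor b p) s / local_factor b p s = - of_real (ln (real p)) * circle_series (local_coeffs b p \<sigma>) 1 t"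
    unfolding D(2) cs One_nat_def .
qed

section \<open>Enumeration of the primes and the walk attached to a family of Euler products\<close>

lemma nth_prime: "prime (nth_prime m)"
  using enumerate_in_set[of "{p::nat. prime p}"] primes_infinite unfolding nth_prime_def by auto

lemma strict_mono_nth_prime: "strict_mono nth_prime"
  unfolding nth_prime_def using strict_mono_enumerate[OF primes_infinite] by (simp add: strict_mono_def)

lemma nth_prime_ge: "m + 2 \<le> nth_prime m"
proof (induction m)
  case 0
  then show ?case using prime_ge_2_nat[OF nth_prime[of 0]] by simp
next
  case (Suc m)
  then show ?case using strict_mono_less[OF strict_mono_nth_prime, of m "Suc m"] by simp
qed

lemma nth_prime_mono: "m \<le> n \<Longrightarrow> nth_prime m \<le> nth_prime n"
  using strict_mono_nth_prime by (simp add: strict_mono_less_eq)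

locale euler_family =
  fixes b :: "'n::finite \<Rightarrow> nat \<Rightarrow> complex" and C \<theta> :: real
  assumes theta: "0 \<le> \<theta>" "\<theta> < 1 / 2" and C: "C \<ge> 0"
    and b_bound: "\<And>j p k. prime p \<Longrightarrow> k \<ge> 1 \<Longrightarrow> norm (b j (p ^ k)) \<le> C * real p powr (real k * \<theta>)"
begin

abbreviation coeffs :: "'n \<Rightarrow> nat \<Rightarrow> real \<Rightarrow> nat \<Rightarrow> complex" where
  "coeffs j m \<sigma> \<equiv> local_coeffs (b j) (nth_prime m) \<sigma>"

definition step :: "real \<Rightarrow> nat \<Rightarrow> real \<Rightarrow> complex ^ 'n" where
  "step \<sigma> m t = (\<chi> j. circle_series (coeffs j m \<sigma>) 0 t)"

text \<open>Linear combinations of the logarithmic derivatives treat both kinds of measures at once: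
  the coefficient vectors are a unit vector, or 1 at j and \<tau> at l, and both satisfy
  \<open>(\<Sum>j\<in>UNIV. norm (c j)) \<le> 2\<close>.\<close>

definition weight :: "real \<Rightarrow> ('n \<Rightarrow> complex) \<Rightarrow> nat \<Rightarrow> real \<Rightarrow> complex" where
  "weight \<sigma> c m t = (\<Sum>j\<in>UNIV. c j * (- of_real (ln (real (nth_prime m))) * circle_series (coeffs j m \<sigma>) 1 t))"

text \<open>A bound valid for all \<sigma> \<ge> 1. The count \<open>CARD('n)\<close> pays for the
  norm of the step and 2 for the sum of the |c j|; in \<open>1 + ln p\<close> the 1 serves the step
  and the logarithm the weight.\<close>

definition eps :: "nat \<Rightarrow> real" where
  "eps m = (real CARD('n) + 2) * (C * (1 + tail_const)) * ((1 + ln (real (nth_prime m))) * real (nth_prime m) powr (\<theta> - 1))"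

lemma coeffs_circle:
  assumes "\<sigma> \<ge> 1"
  shows "circle_coeffs (coeffs j m \<sigma>) C (real (nth_prime m) powr (\<theta> - \<sigma>))"
    and "real (nth_prime m) powr (\<theta> - \<sigma>) \<le> 3 / 4"
  using local_coeffs_circle[OF nth_prime assms theta(2) C b_bound[OF nth_prime]] by auto

lemma nth_prime_real: "real (nth_prime m) \<ge> 2"
  using prime_ge_2_nat[OF nth_prime[of m]] by simp

lemma series_bound:
  assumes "\<sigma> \<ge> 1" "i \<le> 3"
  shows "norm (circle_series (coeffs j m \<sigma>) i t) \<le> C * (1 + tail_const) * real (nth_prime m) powr (\<theta> - 1)"
proof -
  have "norm (circle_series (coeffs j m \<sigma>) i t) \<le> C * (1 + tail_const) * real (nth_prime m) powr (\<theta> - \<sigma>)"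
    by (rule circle_coeffs.circle_series_bound[OF coeffs_circle[OF assms(1)] assms(2)])
  also have "\<dots> \<le> C * (1 + tail_const) * real (nth_prime m) powr (\<theta> - 1)"
    using nth_prime_real[of m] assms tail_const_nonneg C by (intro mult_left_mono powr_mono mult_nonneg_nonneg) auto
  finally show ?thesis .
qed

text \<open>Since the m-th prime exceeds m, this reduces to a power series in m of exponent below
  -1, available because 2 (\<theta> - 1) < -1.\<close>

lemma eps_summable: "summable (\<lambda>m. (eps m)\<^sup>2)"
proof -
  \<comment> \<open>Half of the gap 1/2 - \<theta>, spent on absorbing the logarithm into a power of
    p.\<close>
  define \<delta> where "\<delta> = (1 / 2 - \<theta>) / 2"
  have d: "\<delta> > 0" "2 * (\<theta> - 1 + \<delta>) < -1" using theta by (auto simp: \<delta>_def field_simps)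
  define E where "E = (real CARD('n) + 2) * (C * (1 + tail_const)) * (1 + 1 / \<delta>)"
  have E0: "E \<ge> 0" unfolding E_def using C tail_const_nonneg d by auto
  have "eps m \<le> E * real (Suc m) powr (\<theta> - 1 + \<delta>)" for m
  proof -
    let ?p = "real (nth_prime m)"
    have p: "?p \<ge> 2" by (rule nth_prime_real)
    have "1 + ln ?p \<le> ?p powr \<delta> + ?p powr \<delta> / \<delta>"
      using p d ge_one_powr_ge_zero[of ?p \<delta>] by (intro add_mono ln_powr_bound) auto
    also have "\<dots> = (1 + 1 / \<delta>) * ?p powr \<delta>" by (simp add: algebra_simps)
    finally have "(1 + ln ?p) * ?p powr (\<theta> - 1) \<le> ((1 + 1 / \<delta>) * ?p powr \<delta>) * ?p powr (\<theta> - 1)"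
      by (intro mult_right_mono) auto
    also have "\<dots> = (1 + 1 / \<delta>) * ?p powr (\<theta> - 1 + \<delta>)" by (simp add: powr_add[symmetric] add.commute)
    also have "\<dots> \<le> (1 + 1 / \<delta>) * real (Suc m) powr (\<theta> - 1 + \<delta>)"
      using nth_prime_ge[of m] d theta by (intro mult_left_mono powr_mono2') auto
    finally have "(1 + ln ?p) * ?p powr (\<theta> - 1) \<le> (1 + 1 / \<delta>) * real (Suc m) powr (\<theta> - 1 + \<delta>)" .
    then have "eps m \<le> (real CARD('n) + 2) * (C * (1 + tail_const)) * ((1 + 1 / \<delta>) * real (Suc m) powr (\<theta> - 1 + \<delta>))"
      unfolding eps_def using C tail_const_nonneg by (intro mult_left_mono) auto
    then show ?thesis by (simp add: E_def mult_ac)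
  qed
  moreover have e0: "eps m \<ge> 0" for m
    unfolding eps_def using C tail_const_nonneg nth_prime_real[of m] by (intro mult_nonneg_nonneg) auto
  ultimately have sq: "(eps m)\<^sup>2 \<le> E\<^sup>2 * real (Suc m) powr (2 * (\<theta> - 1 + \<delta>))" for m
  proof -
    have "(eps m)\<^sup>2 \<le> (E * real (Suc m) powr (\<theta> - 1 + \<delta>))\<^sup>2" by (intro power_mono) fact+
    also have "\<dots> = E\<^sup>2 * real (Suc m) powr (2 * (\<theta> - 1 + \<delta>))"
      by (simp add: power_mult_distrib powr_power mult.commute)
    finally show ?thesis .
  qed
  have "summable (\<lambda>m. real m powr (2 * (\<theta> - 1 + \<delta>)))"
    using d by (simp add: summable_real_powr_iff)
  then have "summable (\<lambda>m. real (Suc m) powr (2 * (\<theta> - 1 + \<delta>)))" by (subst summable_Suc_iff)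
  then have "summable (\<lambda>m. E\<^sup>2 * real (Suc m) powr (2 * (\<theta> - 1 + \<delta>)))" by (rule summable_mult)
  then show ?thesis
    by (rule summable_comparison_test'[where N = 0]) (use sq in auto)
qed

lemma step_bound:
  assumes "\<sigma> \<ge> 1" shows "norm (step \<sigma> m t) \<le> eps m"
proof -
  let ?u = "real (nth_prime m) powr (\<theta> - 1)"
  have l: "ln (real (nth_prime m)) \<ge> 0" using nth_prime_real[of m] by simp
  have "norm (step \<sigma> m t) \<le> (\<Sum>j\<in>UNIV. norm (step \<sigma> m t $ j))"
    unfolding norm_vec_def by (rule L2_set_le_sum) simp
  also have "\<dots> \<le> (\<Sum>j\<in>(UNIV::'n set). C * (1 + tail_const) * ?u)"
    unfolding step_def vec_lambda_beta by (intro sum_mono series_bound assms) simp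
  also have "\<dots> = real CARD('n) * (C * (1 + tail_const)) * (1 * ?u)" by simp
  also have "\<dots> \<le> eps m"
    unfolding eps_def using C tail_const_nonneg l by (intro mult_mono mult_right_mono) auto
  finally show ?thesis .
qed

lemma weight_bound:
  assumes "\<sigma> \<ge> 1" and c: "(\<Sum>j\<in>UNIV. norm (c j)) \<le> 2"
  shows "norm (weight \<sigma> c m t) \<le> eps m"
proof -
  let ?u = "real (nth_prime m) powr (\<theta> - 1)" and ?l = "ln (real (nth_prime m))"
  have l: "?l \<ge> 0" using nth_prime_real[of m] by simp
  have "norm (weight \<sigma> c m t) \<le> (\<Sum>j\<in>UNIV. norm (c j) * (?l * (C * (1 + tail_const) * ?u)))"
    unfolding weight_def
  proof (rule sum_norm_le)
    fix j
    have "norm (circle_series (coeffs j m \<sigma>) 1 t) \<le> C * (1 + tail_const) * ?u" by (rule series_bound[OF assms(1)]) simp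
    then have "norm (c j) * (?l * norm (circle_series (coeffs j m \<sigma>) 1 t)) \<le> norm (c j) * (?l * (C * (1 + tail_const) * ?u))"
      using l by (intro mult_left_mono) auto
    then show "norm (c j * (- of_real ?l * circle_series (coeffs j m \<sigma>) 1 t)) \<le> norm (c j) * (?l * (C * (1 + tail_const) * ?u))"
      using l by (simp add: norm_mult)
  qed
  also have "\<dots> = (\<Sum>j\<in>UNIV. norm (c j)) * (?l * (C * (1 + tail_const) * ?u))" by (simp add: sum_distrib_right)
  also have "\<dots> \<le> 2 * (?l * (C * (1 + tail_const) * ?u))"
    using c l C tail_const_nonneg by (intro mult_right_mono mult_nonneg_nonneg) auto
  also have "\<dots> = 2 * (C * (1 + tail_const)) * (?l * ?u)" by simp
  also have "\<dots> \<le> eps m"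
    unfolding eps_def using C tail_const_nonneg l by (intro mult_mono mult_right_mono) auto
  finally show ?thesis .
qed

lemma step_continuous: "\<sigma> \<ge> 1 \<Longrightarrow> continuous_on A (step \<sigma> m)"
  unfolding step_def[abs_def]
  by (intro continuous_on_vec_lambda circle_coeffs.circle_series_continuous[OF coeffs_circle(1)])

lemma weight_continuous: "\<sigma> \<ge> 1 \<Longrightarrow> continuous_on A (weight \<sigma> c m)"
  unfolding weight_def[abs_def]
  by (intro continuous_intros circle_coeffs.circle_series_continuous[OF coeffs_circle(1)])

lemma step_mean:
  assumes "\<sigma> \<ge> 1" shows "(\<integral>t. step \<sigma> m t \<partial>unit_interval) = 0"
proof -
  have "(step \<sigma> m has_integral 0) {0..1}"
  proof (subst has_integral_componentwise_iff, intro ballI)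
    fix e :: "complex ^ 'n" assume "e \<in> Basis"
    then obtain j u where e: "e = axis j u" unfolding Basis_vec_def by auto
    have "((\<lambda>t. circle_series (coeffs j m \<sigma>) 0 t) has_integral 0) {0..1}"
      by (rule circle_coeffs.circle_series_mean[OF coeffs_circle(1)[OF assms]])
    from has_integral_linear[OF this bounded_linear_inner_left[of u]]
    show "((\<lambda>t. step \<sigma> m t \<bullet> e) has_integral 0 \<bullet> e) {0..1}"
      by (simp add: e inner_axis step_def o_def)
  qed
  then show ?thesis
    using unit_interval_integral[OF step_continuous[OF assms]] by (simp add: integral_unique)
qed

lemma weight_mean:
  assumes "\<sigma> \<ge> 1" shows "(\<integral>t. weight \<sigma> c m t \<partial>unit_interval) = 0"
proof -
  have "(weight \<sigma> c m has_integral (\<Sum>j\<in>UNIV. c j * (- of_real (ln (real (nth_prime m))) * 0))) {0..1}"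
    unfolding weight_def[abs_def]
    by (intro has_integral_sum has_integral_mult_right circle_coeffs.circle_series_mean[OF coeffs_circle(1)[OF assms]]) simp
  then show ?thesis
    using unit_interval_integral[OF weight_continuous[OF assms]] by (simp add: integral_unique)
qed

lemma walk:
  assumes "\<sigma> \<ge> 1" "(\<Sum>j\<in>UNIV. norm (c j)) \<le> 2"
  shows "random_walk (step \<sigma>) (weight \<sigma> c) eps"
proof
  show "step \<sigma> m \<in> borel_measurable borel" "weight \<sigma> c m \<in> borel_measurable borel" for m
    using step_continuous[OF assms(1)] weight_continuous[OF assms(1)] by (auto intro: borel_measurable_continuous_onI)
qed (use assms step_bound weight_bound step_mean weight_mean eps_summable in auto)

lemma log_trunc_vec_eq:
  fixes c :: "'n \<Rightarrow> complex"
  assumes "\<sigma> \<ge> 1" "(\<Sum>j\<in>UNIV. norm (c j)) \<le> 2"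
  shows "log_trunc_vec b n \<sigma> = random_walk.position (step \<sigma>) n"
  unfolding log_trunc_vec_def[abs_def] log_trunc_def random_walk.position_def[OF walk[OF assms], abs_def]
  by (auto simp: fun_eq_iff vec_eq_iff step_def shifted_point_def log_local_shifted(1)[OF nth_prime coeffs_circle(1)[OF assms(1)]])

lemma logderiv_trunc_eq:
  fixes c :: "'n \<Rightarrow> complex"
  assumes "\<sigma> \<ge> 1" "(\<Sum>j\<in>UNIV. norm (c j)) \<le> 2"
  shows "(\<Sum>j\<in>UNIV. c j * logderiv_trunc (b j) n \<sigma> t) = random_walk.amplitude (weight \<sigma> c) n t"
proof -
  have "logderiv_trunc (b j) n \<sigma> t = (\<Sum>m<n. - of_real (ln (real (nth_prime m))) * circle_series (coeffs j m \<sigma>) 1 (t m))" for j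
    unfolding logderiv_trunc_def shifted_point_def
    by (intro sum.cong refl log_local_shifted(2)[OF nth_prime coeffs_circle(1)[OF assms(1)]])
  then have "(\<Sum>j\<in>UNIV. c j * logderiv_trunc (b j) n \<sigma> t)
    = (\<Sum>j\<in>UNIV. \<Sum>m<n. c j * (- of_real (ln (real (nth_prime m))) * circle_series (coeffs j m \<sigma>) 1 (t m)))"
    by (simp only: sum_distrib_left)
  also have "\<dots> = random_walk.amplitude (weight \<sigma> c) n t"
    unfolding random_walk.amplitude_def[OF walk[OF assms]] weight_def by (rule sum.swap)
  finally show ?thesis .
qed

lemma weighted_law_eq:
  fixes c :: "'n \<Rightarrow> complex"
  assumes "\<sigma> \<ge> 1" "(\<Sum>j\<in>UNIV. norm (c j)) \<le> 2"
  shows "random_walk.weighted_law (step \<sigma>) (weight \<sigma> c) n 0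
    = distr (density (torus n) (\<lambda>t. ennreal ((norm (\<Sum>j\<in>UNIV. c j * logderiv_trunc (b j) n \<sigma> t))\<^sup>2))) borel (log_trunc_vec b n \<sigma>)"
  unfolding random_walk.weighted_law_def[OF walk[OF assms]] logderiv_trunc_eq[OF assms] log_trunc_vec_eq[OF assms] by simp

text \<open>Pairing with y merges the components into one circle series, whose first coefficient is
  the form at y times p^(-\<sigma>). The lower bound on the form and the size of p make it dominate
  the harmonics k \<ge> 2, as \<open>circle_oscillation\<close> demands.\<close>

lemma step_oscillation:
  assumes \<sigma>: "\<sigma> \<ge> 1" and \<eta>: "\<eta> = (1 - 2 * \<theta>) / 2"
    and big: "4 * (C * real CARD('n)) * tail_const \<le> real (nth_prime m) powr \<eta>"
    and y: "norm y > 0" and lead: "norm (\<Sum>j\<in>UNIV. b j (nth_prime m) * cnj (y $ j)) \<ge> norm y * real (nth_prime m) powr (- \<eta>)"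
  shows "norm (\<integral>s. iexp (step \<sigma> m s \<bullet> y) \<partial>unit_interval) \<le> osc_const * real (nth_prime m) powr ((\<eta> + \<sigma>) / 2) / sqrt (norm y)"
proof -
  define p where "p = real (nth_prime m)"
  have p: "p \<ge> 2" unfolding p_def by (rule nth_prime_real)
  define \<rho> where "\<rho> = p powr (\<theta> - \<sigma>)"
  define B where "B = C * real CARD('n) * norm y"
  define d where "d k = (\<Sum>j\<in>UNIV. coeffs j m \<sigma> k * cnj (y $ j))" for k
  have cc: "circle_coeffs (coeffs j m \<sigma>) C \<rho>" for j unfolding \<rho>_def p_def by (rule coeffs_circle[OF \<sigma>])
  have r34: "\<rho> \<le> 3 / 4" unfolding \<rho>_def p_def by (rule coeffs_circle[OF \<sigma>])
  interpret circle_coeffs d B \<rho>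
  proof
    show "norm (d k) \<le> B * \<rho> ^ k" for k
    proof -
      have "norm (d k) \<le> (\<Sum>j\<in>(UNIV::'n set). C * \<rho> ^ k * norm y)"
        unfolding d_def
      proof (rule sum_norm_le)
        show "norm (coeffs j m \<sigma> k * cnj (y $ j)) \<le> C * \<rho> ^ k * norm y" for j
          using circle_coeffs.d_bound[OF cc, of j k] Finite_Cartesian_Product.norm_nth_le[of y j] C
          unfolding norm_mult by (intro mult_mono) (auto simp: \<rho>_def)
      qed
      then show ?thesis by (simp add: B_def mult_ac)
    qed
  qed (use r34 in \<open>auto simp: d_def local_coeffs_def \<rho>_def\<close>)
  have series: "step \<sigma> m s \<bullet> y = Re (circle_series d 0 s)" for s
  proof -
    let ?z = "iexp (- 2 * pi * s)"
    have sm: "summable (\<lambda>k. of_nat k ^ 0 * coeffs j m \<sigma> k * ?z ^ k)" for j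
      by (rule summable_norm_cancel[OF circle_coeffs.summable_series[OF cc]]) simp
    have "circle_series d 0 s = (\<Sum>k. \<Sum>j\<in>UNIV. (of_nat k ^ 0 * coeffs j m \<sigma> k * ?z ^ k) * cnj (y $ j))"
      unfolding circle_series_def d_def by (intro suminf_cong) (simp add: sum_distrib_left sum_distrib_right mult_ac)
    also have "\<dots> = (\<Sum>j\<in>UNIV. (\<Sum>k. (of_nat k ^ 0 * coeffs j m \<sigma> k * ?z ^ k) * cnj (y $ j)))"
      by (rule suminf_sum) (intro summable_mult2 sm)
    also have "\<dots> = (\<Sum>j\<in>UNIV. circle_series (coeffs j m \<sigma>) 0 s * cnj (y $ j))"
      unfolding circle_series_def by (intro sum.cong refl suminf_mult2[symmetric] sm)
    finally show ?thesis
      by (simp add: inner_vec_def step_def inner_complex_def)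
  qed
  have d1: "d 1 = (\<Sum>j\<in>UNIV. b j (nth_prime m) * cnj (y $ j)) * of_real (p powr (- \<sigma>))"
    by (simp add: d_def local_coeffs_def p_def sum_distrib_left sum_distrib_right mult_ac)
  have lower: "norm y * p powr (- (\<eta> + \<sigma>)) \<le> norm (d 1)"
  proof -
    have "norm y * p powr (- \<eta>) * p powr (- \<sigma>) \<le> norm (\<Sum>j\<in>UNIV. b j (nth_prime m) * cnj (y $ j)) * p powr (- \<sigma>)"
      using lead by (intro mult_right_mono) (auto simp: p_def)
    also have "\<dots> = norm (d 1)" unfolding d1 by (simp add: norm_mult)
    also have "norm y * p powr (- \<eta>) * p powr (- \<sigma>) = norm y * p powr (- (\<eta> + \<sigma>))" by (simp add: powr_add[symmetric])
    finally show ?thesis .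
  qed
  have ppos: "norm y * p powr (- (\<eta> + \<sigma>)) > 0" using y p by simp
  have small: "B * \<rho>\<^sup>2 * tail_const \<le> norm (d 1) / 4"
  proof -
    have "4 * (B * \<rho>\<^sup>2 * tail_const) = (4 * (C * real CARD('n)) * tail_const) * (norm y * p powr (2 * (\<theta> - \<sigma>)))"
      unfolding B_def \<rho>_def using p by (simp add: powr_power mult_ac)
    also have "\<dots> \<le> p powr \<eta> * (norm y * p powr (2 * (\<theta> - \<sigma>)))"
      using big by (intro mult_right_mono) (auto simp: p_def)
    also have "\<dots> = norm y * p powr (\<eta> + 2 * (\<theta> - \<sigma>))" by (simp add: powr_add mult_ac)
    \<comment> \<open>The comparison of exponents amounts to 2 \<eta> \<le> \<sigma> - 2 \<theta>;
      as 2 \<eta> = 1 - 2 \<theta>, it holds for \<sigma> \<ge> 1.\<close>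
    also have "\<dots> \<le> norm y * p powr (- (\<eta> + \<sigma>))"
      using p \<sigma> unfolding \<eta> by (intro mult_left_mono powr_mono) (auto simp: field_simps)
    finally show ?thesis using lower by linarith
  qed
  have "norm (\<integral>s. iexp (step \<sigma> m s \<bullet> y) \<partial>unit_interval) \<le> osc_const / sqrt (norm (d 1))"
    unfolding series by (rule circle_oscillation[OF r34 _ small]) (use lower ppos in linarith)
  also have "\<dots> \<le> osc_const / sqrt (norm y * p powr (- (\<eta> + \<sigma>)))"
  proof (rule divide_left_mono)
    have "norm (d 1) > 0" using lower ppos by linarith
    then show "0 < sqrt (norm (d 1)) * sqrt (norm y * p powr (- (\<eta> + \<sigma>)))"
      by (rule mult_pos_pos[OF real_sqrt_gt_zero real_sqrt_gt_zero[OF ppos]])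
  qed (use lower osc_const_ge_1 in \<open>auto simp del: One_nat_def\<close>)
  also have "sqrt (norm y * p powr (- (\<eta> + \<sigma>))) = sqrt (norm y) * p powr (- ((\<eta> + \<sigma>) / 2))"
  proof -
    have "sqrt (p powr (- (\<eta> + \<sigma>))) = p powr (- ((\<eta> + \<sigma>) / 2))"
    proof -
      have "sqrt (p powr (- (\<eta> + \<sigma>))) = p powr (- (\<eta> + \<sigma>) * (1 / 2))"
        unfolding powr_powr[symmetric] by (rule powr_half_sqrt[symmetric]) simp
      also have "- (\<eta> + \<sigma>) * (1 / 2) = - ((\<eta> + \<sigma>) / 2)" by (simp add: field_simps)
      finally show ?thesis .
    qed
    then show ?thesis by (simp only: real_sqrt_mult)
  qed
  also have "osc_const / (sqrt (norm y) * p powr (- ((\<eta> + \<sigma>) / 2))) = osc_const * p powr ((\<eta> + \<sigma>) / 2) / sqrt (norm y)"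
    using p by (simp add: powr_minus_divide)
  finally show ?thesis by (simp add: p_def)
qed

end

section \<open>Coefficients at primes\<close>

text \<open>Once the coefficients below n vanish, multiplication by n^r isolates u n. All later
  terms shrink at least like (n / (n + 1))^r, so integer exponents r suffice.\<close>

lemma dirichlet_coeffs_zero:
  fixes u :: "nat \<Rightarrow> complex"
  assumes s: "\<And>r::nat. ((\<lambda>n. u n / of_nat n ^ r) has_sum 0) UNIV" and u0: "u 0 = 0"
  shows "u n = 0"
proof (induction n rule: less_induct)
  case (less n)
  show ?case
  proof (cases "n = 0")
    case False
    have su: "summable (\<lambda>m. norm (u m))"
    proof -
      have "u summable_on UNIV" using s[of 0] by (auto simp: summable_on_def)
      then show ?thesis by (intro summable_on_imp_summable) (simp add: summable_on_iff_abs_summable_on_complex)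
    qed
    have sT: "summable (\<lambda>m. norm (u (m + Suc n)))" using su by (rule summable_ignore_initial_segment)
    define T where "T = (\<Sum>m. norm (u (m + Suc n)))"
    define q where "q = real n / real (Suc n)"
    have q: "0 \<le> q" "q < 1" by (auto simp: q_def)
    have "norm (u n) \<le> T * q ^ r" for r
    proof -
      define v where "v m = of_nat n ^ r * (u m / of_nat m ^ r)" for m
      have v: "v sums 0"
        using sums_mult[OF has_sum_imp_sums[OF s[of r]], of "of_nat n ^ r"] unfolding v_def[abs_def] mult_zero_right .
      have vn: "(\<Sum>i<Suc n. v i) = u n"
      proof -
        have "(\<Sum>i<n. v i) = 0" by (rule sum.neutral) (use less in \<open>auto simp: v_def\<close>)
        then show ?thesis using False by (simp add: v_def)
      qed
      have "(\<lambda>m. v (m + Suc n)) sums (- u n)"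
        using sums_split_initial_segment[OF v, of "Suc n"] unfolding vn by simp
      then have e: "- u n = (\<Sum>m. v (m + Suc n))" by (rule sums_unique)
      have b: "norm (v (m + Suc n)) \<le> norm (u (m + Suc n)) * q ^ r" for m
      proof -
        have "real n / real (m + Suc n) \<le> q" unfolding q_def by (rule divide_left_mono) auto
        then have "(real n / real (m + Suc n)) ^ r \<le> q ^ r" by (intro power_mono) auto
        then have "norm (u (m + Suc n)) * (real n / real (m + Suc n)) ^ r \<le> norm (u (m + Suc n)) * q ^ r"
          by (intro mult_left_mono) auto
        moreover have "norm (v (m + Suc n)) = norm (u (m + Suc n)) * (real n / real (m + Suc n)) ^ r"
          unfolding v_def norm_mult norm_divide norm_power norm_of_nat power_divide by simp
        ultimately show ?thesis by simp
      qed
      have "norm (\<Sum>m. v (m + Suc n)) \<le> (\<Sum>m. norm (u (m + Suc n)) * q ^ r)"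
        by (rule norm_suminf_le[OF b summable_mult2[OF sT]])
      also have "\<dots> = T * q ^ r" unfolding T_def by (rule suminf_mult2[OF sT, symmetric])
      finally show ?thesis unfolding e[symmetric] by simp
    qed
    moreover have "(\<lambda>r. T * q ^ r) \<longlonglongrightarrow> T * 0"
      using q by (intro tendsto_mult tendsto_const LIMSEQ_power_zero) auto
    ultimately have "norm (u n) \<le> T * 0"
      by (intro LIMSEQ_le_const) auto
    then show ?thesis by simp
  qed (use u0 in simp)
qed

text \<open>Regrouping by the value of N turns an arbitrary absolutely convergent family into a
  series over natural numbers.\<close>

lemma has_sum_fibres:
  fixes x :: "'i \<Rightarrow> complex" and N :: "'i \<Rightarrow> nat"
  assumes x: "(x has_sum S) J"
  shows "((\<lambda>n. infsum x {i \<in> J. N i = n}) has_sum S) UNIV"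
proof -
  have bij: "bij_betw snd (Sigma UNIV (\<lambda>n. {i \<in> J. N i = n})) J"
    unfolding bij_betw_def by (auto simp: inj_on_def image_iff)
  have "((\<lambda>z. x (snd z)) has_sum S) (Sigma UNIV (\<lambda>n. {i \<in> J. N i = n}))"
    using has_sum_reindex_bij_betw[OF bij, of x S] x by simp
  moreover have "((\<lambda>i. x (snd (n, i))) has_sum infsum x {i \<in> J. N i = n}) {i \<in> J. N i = n}" for n
  proof -
    have "x summable_on {i \<in> J. N i = n}"
      by (rule summable_on_subset_banach[OF has_sum_imp_summable[OF x]]) auto
    then show ?thesis by simp
  qed
  ultimately show ?thesis by (rule has_sum_SigmaD)
qed

text \<open>The k-th power of the sum is expanded over k-tuples, so the exponential becomes one
  absolutely convergent family, majorised by the exponential of the sum of norms.\<close>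

lemma has_sum_exp_family:
  fixes f :: "'i \<Rightarrow> complex"
  assumes f: "(\<lambda>i. norm (f i)) summable_on I" and I: "countable I"
  shows "((\<lambda>(k, g). (\<Prod>j<k. f (g j)) / fact k) has_sum exp (infsum f I)) (Sigma UNIV (\<lambda>k. PiE {..<k} (\<lambda>_. I)))"
proof -
  have pabs: "(\<lambda>g. norm (\<Prod>j<k. f (g j))) summable_on PiE {..<k} (\<lambda>_. I)" for k :: nat
  proof -
    have "Infinite_Set_Sum.abs_summable_on (\<lambda>g. \<Prod>j<k. f (g j)) (PiE {..<k} (\<lambda>_. I))"
      by (rule Infinite_Set_Sum.abs_summable_on_prod_PiE) (use f I in \<open>auto simp: abs_summable_equivalent[symmetric]\<close>)
    then show ?thesis by (simp add: abs_summable_equivalent[symmetric])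
  qed
  have psum: "infsum (\<lambda>g. \<Prod>j<k. f (g j)) (PiE {..<k} (\<lambda>_. I)) = infsum f I ^ k" for k :: nat
    using infsum_prod_PiE_abs[of "{..<k}" "\<lambda>_. f" "\<lambda>_. I"] f by simp
  have nsum: "infsum (\<lambda>g. norm (\<Prod>j<k. f (g j))) (PiE {..<k} (\<lambda>_. I)) = infsum (\<lambda>i. norm (f i)) I ^ k" for k :: nat
    using infsum_prod_PiE_abs[of "{..<k}" "\<lambda>_ i. norm (f i)" "\<lambda>_. I"] f by (simp add: prod_norm)
  define R where "R = infsum (\<lambda>i. norm (f i)) I"
  have R0: "R \<ge> 0" unfolding R_def by (intro infsum_nonneg) auto
  have "(\<lambda>x. norm (case x of (k, g) \<Rightarrow> (\<Prod>j<k. f (g j)) / fact k)) summable_on (Sigma UNIV (\<lambda>k. PiE {..<k} (\<lambda>_. I)))"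
    unfolding Infinite_Sum.abs_summable_on_Sigma_iff
  proof (intro conjI ballI)
    fix k :: nat
    have "(\<lambda>g. norm (\<Prod>j<k. f (g j)) * (1 / fact k)) summable_on PiE {..<k} (\<lambda>_. I)"
      by (intro summable_on_cmult_left pabs)
    then show "(\<lambda>g. norm (case (k, g) of (k, g) \<Rightarrow> (\<Prod>j<k. f (g j)) / fact k)) summable_on PiE {..<k} (\<lambda>_. I)"
      by (simp add: norm_divide)
  next
    have "infsum (\<lambda>g. norm (case (k, g) of (k, g) \<Rightarrow> (\<Prod>j<k. f (g j)) / fact k)) (PiE {..<k} (\<lambda>_. I)) = R ^ k / fact k" for k
    proof -
      have "infsum (\<lambda>g. norm (\<Prod>j<k. f (g j)) * (1 / fact k)) (PiE {..<k} (\<lambda>_. I)) = R ^ k * (1 / fact k)"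
        unfolding R_def nsum[symmetric] by (rule infsum_cmult_left') 
      then show ?thesis by (simp add: norm_divide)
    qed
    moreover have "(\<lambda>k. R ^ k / fact k) summable_on UNIV"
    proof (rule summable_nonneg_imp_summable_on)
      show "summable (\<lambda>k. R ^ k / fact k)"
        using summable_exp[of R] by (simp add: divide_inverse mult.commute)
    qed (use R0 in auto)
    ultimately show "(\<lambda>k. norm (infsum (\<lambda>g. norm (case (k, g) of (k, g) \<Rightarrow> (\<Prod>j<k. f (g j)) / fact k)) (PiE {..<k} (\<lambda>_. I)))) summable_on UNIV"
      using R0 by simp
  qed
  then have summable: "(\<lambda>(k, g). (\<Prod>j<k. f (g j)) / fact k) summable_on (Sigma UNIV (\<lambda>k. PiE {..<k} (\<lambda>_. I)))"
    by (rule abs_summable_summable)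
  show ?thesis
  proof (rule has_sum_SigmaI[OF _ _ summable])
    fix k :: nat
    have "((\<lambda>g. \<Prod>j<k. f (g j)) has_sum infsum f I ^ k) (PiE {..<k} (\<lambda>_. I))"
      using has_sum_infsum[OF abs_summable_summable[OF pabs[of k]]] unfolding psum .
    from has_sum_cmult_left[OF this, of "1 / fact k"]
    show "((\<lambda>g. case (k, g) of (k, g) \<Rightarrow> (\<Prod>j<k. f (g j)) / fact k) has_sum infsum f I ^ k / fact k) (PiE {..<k} (\<lambda>_. I))"
      by simp
  next
    show "((\<lambda>k. infsum f I ^ k / fact k) has_sum exp (infsum f I)) UNIV"
    proof (rule norm_summable_imp_has_sum)
      show "summable (\<lambda>k. norm (infsum f I ^ k / fact k))"
        using summable_norm_exp[of "infsum f I"] by (simp add: norm_divide norm_power scaleR_conv_of_real divide_inverse norm_mult norm_inverse mult.commute)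
      show "(\<lambda>k. infsum f I ^ k / fact k) sums exp (infsum f I)"
        using exp_converges[of "infsum f I"] by (simp add: scaleR_conv_of_real divide_inverse mult.commute)
    qed
  qed
qed

text \<open>F is the only link between \<open>a\<close> and \<open>b\<close>. Exponentiating the
  logarithm gives a family indexed by tuples of prime powers; grouped by the product of the tuple it
  is a Dirichlet series with the same values as F. Uniqueness applies, and a prime p is the product
  of the one-tuple p^1 only.\<close>

lemma prime_coefficient:
  assumes a: "abs_conv_dirichlet a F" and b: "abs_conv_euler_log b F" and p: "prime p"
  shows "a p = b p"
proof -
  define I where "I = {p::nat. prime p} \<times> {1::nat..}"
  define N where "N = (\<lambda>(q::nat, k::nat). q ^ k)"
  \<comment> \<open>The terms at s = 2, inside the half-plane of absolute convergence. Passing to s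
    = 2 + r divides each by \<open>N i ^ r\<close>.\<close>
  define d where "d = (\<lambda>(q, k). b (q ^ k) * of_nat q powr (- (of_nat k * 2)))"
  have N2: "N i \<ge> 2" if "i \<in> I" for i
  proof -
    obtain q k where i: "i = (q, k)" "prime q" "k \<ge> 1" using \<open>i \<in> I\<close> by (auto simp: I_def)
    have "2 ^ 1 \<le> q ^ k" using prime_ge_2_nat[OF i(2)] i(3)
      by (metis one_le_numeral order_trans power_increasing power_mono zero_le_numeral)
    then show ?thesis by (simp add: N_def i)
  qed
  have powr_shift: "complex_of_nat m powr (- (of_nat 2 + of_nat r)) = of_nat m powr (- 2) / of_nat m ^ r" if "m \<ge> 1" for m r
  proof -
    have "complex_of_nat m powr (- (of_nat 2 + of_nat r)) = of_nat m powr (- 2) * of_nat m powr (- of_nat r)"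
      by (simp add: powr_add[symmetric])
    also have "complex_of_nat m powr (- of_nat r) = 1 / of_nat m ^ r"
      using that by (simp add: powr_minus divide_inverse powr_nat')
    finally show ?thesis by simp
  qed
  have summand: "b (q ^ k) * of_nat q powr (- (of_nat k * (2 + of_nat r))) = d (q, k) / of_nat (N (q, k)) ^ r" if "(q, k) \<in> I" for q k r
  proof -
    have q: "q \<ge> 1" using that prime_ge_1_nat by (auto simp: I_def)
    have "complex_of_nat q powr (- (of_nat k * (2 + of_nat r))) = of_nat q powr (- (of_nat k * 2)) * of_nat q powr (- of_nat (k * r))"
      by (simp add: powr_add[symmetric] algebra_simps)
    also have "complex_of_nat q powr (- of_nat (k * r)) = 1 / of_nat q ^ (k * r)"
    proof -
      have "complex_of_nat q powr of_nat (k * r) = of_nat q ^ (k * r)"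
        by (rule powr_nat') (use q in auto)
      then show ?thesis unfolding powr_minus by (simp only: inverse_eq_divide)
    qed
    finally show ?thesis by (simp add: d_def N_def power_mult)
  qed
  have sums: "(\<lambda>i. norm (d i / of_nat (N i) ^ r)) summable_on I"
    and F: "F (2 + of_nat r) = exp (infsum (\<lambda>i. d i / of_nat (N i) ^ r) I)" for r
  proof -
    let ?s = "2 + of_nat r :: complex"
    have "Re ?s > 1" by simp
    with b have 1: "(\<lambda>(p, k). norm (b (p ^ k) * of_nat p powr (- (of_nat k * ?s)))) summable_on I"
      and 2: "F ?s = exp (\<Sum>\<^sub>\<infinity>(p, k)\<in>I. b (p ^ k) * of_nat p powr (- (of_nat k * ?s)))"
      unfolding abs_conv_euler_log_def I_def by blast+
    show "(\<lambda>i. norm (d i / of_nat (N i) ^ r)) summable_on I"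
      using 1 by (rule summable_on_cong[THEN iffD1, rotated]) (use summand in auto)
    have "(\<Sum>\<^sub>\<infinity>(p, k)\<in>I. b (p ^ k) * of_nat p powr (- (of_nat k * ?s))) = infsum (\<lambda>i. d i / of_nat (N i) ^ r) I"
      by (rule infsum_cong) (use summand in auto)
    with 2 show "F ?s = exp (infsum (\<lambda>i. d i / of_nat (N i) ^ r) I)" by simp
  qed
  define J where "J = Sigma UNIV (\<lambda>k::nat. PiE {..<k} (\<lambda>_. I))"
  define W where "W = (\<lambda>(k, g). (\<Prod>j<k. d (g j)) / fact k)"
  define NN where "NN = (\<lambda>(k::nat, g). \<Prod>j<k. N (g j))"
  have WJ: "((\<lambda>x. W x / of_nat (NN x) ^ r) has_sum F (2 + of_nat r)) J" for r
  proof -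
    have cI: "countable I" by simp
    have e: "(\<lambda>x. W x / of_nat (NN x) ^ r) = (\<lambda>(k, g). (\<Prod>j<k. d (g j) / of_nat (N (g j)) ^ r) / fact k)"
      by (auto simp: W_def NN_def fun_eq_iff prod_dividef prod_power_distrib)
    show ?thesis unfolding F e J_def by (rule has_sum_exp_family[OF sums cI])
  qed
  define h where "h n = infsum W {x \<in> J. NN x = n}" for n
  define h' where "h' n = (if n = 0 then 0 else a n * of_nat n powr (- 2))" for n
  have NN_pos: "NN x \<ge> 1" if "x \<in> J" for x
  proof -
    obtain k g where x: "x = (k, g)" "g \<in> PiE {..<k} (\<lambda>_. I)" using \<open>x \<in> J\<close> by (auto simp: J_def)
    have "N (g j) \<ge> 1" if "j < k" for j using N2[of "g j"] x(2) that by (auto simp: PiE_iff)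
    then have "0 < (\<Prod>j<k. N (g j))" by (intro prod_pos) force
    then show ?thesis unfolding x NN_def prod.case by linarith
  qed
  have h: "((\<lambda>n. h n / of_nat n ^ r) has_sum F (2 + of_nat r)) UNIV" for r
  proof -
    have "infsum (\<lambda>x. W x / of_nat (NN x) ^ r) {x \<in> J. NN x = n} = h n / of_nat n ^ r" for n
    proof -
      have "infsum (\<lambda>x. W x / of_nat (NN x) ^ r) {x \<in> J. NN x = n} = infsum (\<lambda>x. W x * (1 / of_nat n ^ r)) {x \<in> J. NN x = n}"
        by (rule infsum_cong) auto
      also have "\<dots> = h n * (1 / of_nat n ^ r)" unfolding h_def by (rule infsum_cmult_left')
      finally show ?thesis by simp
    qed
    then show ?thesis using has_sum_fibres[OF WJ[of r], of NN] by simp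
  qed
  have h': "((\<lambda>n. h' n / of_nat n ^ r) has_sum F (2 + of_nat r)) UNIV" for r
  proof -
    have "((\<lambda>n. a n * of_nat n powr (- (2 + of_nat r))) has_sum F (2 + of_nat r)) {1..}"
    proof -
      have "Re (2 + of_nat r :: complex) > 1" by simp
      with a show ?thesis unfolding abs_conv_dirichlet_def by blast
    qed
    then show ?thesis
      by (rule has_sum_cong_neutral[THEN iffD1, rotated -1])
         (use powr_shift[of _ r] in \<open>auto simp: h'_def\<close>)
  qed
  have "h p - h' p = 0"
  proof (rule dirichlet_coeffs_zero)
    show "((\<lambda>n. (h n - h' n) / of_nat n ^ r) has_sum 0) UNIV" for r
      using has_sum_add[OF h[of r] has_sum_cmult_right[OF h'[of r], of "-1"]] by (simp add: diff_divide_distrib)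
    have e: "{x \<in> J. NN x = 0} = {}" using NN_pos by force
    show "h 0 - h' 0 = 0" unfolding h_def h'_def e by simp
  qed
  moreover have "h p = b p * of_nat p powr (- 2)"
  proof -
    \<comment> \<open>The only tuple with product p, restricted so that it is an element of
      \<open>PiE\<close>.\<close>
    define g0 where "g0 = (\<lambda>j\<in>{..<1::nat}. (p, 1::nat))"
    have "{x \<in> J. NN x = p} = {(1, g0)}"
    proof (intro equalityI subsetI)
      fix x assume "x \<in> {x \<in> J. NN x = p}"
      then obtain k g where x: "x = (k, g)" and g: "g \<in> PiE {..<k} (\<lambda>_. I)" and pr: "(\<Prod>j<k. N (g j)) = p"
        by (auto simp: J_def NN_def)
      have gI: "g j \<in> I" if "j < k" for j using g that by auto
      obtain k' where k: "k = Suc k'" using pr prime_gt_1_nat[OF p] by (cases k) auto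
      have sp: "N (g 0) * (\<Prod>j<k'. N (g (Suc j))) = p"
        using pr unfolding k by (simp add: prod.lessThan_Suc_shift del: prod.lessThan_Suc)
      have g02: "N (g 0) \<ge> 2" using N2[OF gI[of 0]] k by simp
      have "N (g 0) dvd p" using sp by (metis dvd_triv_left)
      then have Ng0: "N (g 0) = p" using p g02 unfolding prime_nat_iff by fastforce
      then have rest: "(\<Prod>j<k'. N (g (Suc j))) = 1" using sp prime_gt_0_nat[OF p] by simp
      have "k' = 0"
      proof (rule ccontr)
        assume "k' \<noteq> 0"
        then have "N (g (Suc 0)) dvd (\<Prod>j<k'. N (g (Suc j)))" by (intro dvd_prodI) auto
        then show False using rest N2[OF gI[of "Suc 0"]] k \<open>k' \<noteq> 0\<close> by simp
      qed
      then have k1: "k = 1" using k by simp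
      obtain q e where qe: "g 0 = (q, e)" "prime q" "e \<ge> 1" using gI[of 0] k by (cases "g 0") (auto simp: I_def)
      have qp: "q ^ e = p" using Ng0 qe by (simp add: N_def)
      then have "q dvd p" using qe(3) by (metis dvd_power less_le_trans zero_less_one)
      then have "q = p" using p qe(2) by (metis prime_nat_iff prime_gt_1_nat less_irrefl)
      then have "p ^ e = p ^ 1" using qp by simp
      then have "e = 1" using prime_gt_1_nat[OF p] power_inject_exp by blast
      then have "g 0 = (p, 1)" using qe \<open>q = p\<close> by simp
      then have "g = g0" using g k1 unfolding g0_def by (auto simp: PiE_iff extensional_def fun_eq_iff)
      then show "x \<in> {(1, g0)}" using x k1 by simp
    next
      fix x :: "nat \<times> (nat \<Rightarrow> nat \<times> nat)" assume "x \<in> {(1, g0)}"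
      then show "x \<in> {x \<in> J. NN x = p}" using p by (auto simp: J_def NN_def g0_def N_def I_def)
    qed
    then show ?thesis unfolding h_def by (simp add: W_def g0_def d_def)
  qed
  moreover have "complex_of_nat p powr (- 2) \<noteq> 0" using prime_gt_0_nat[OF p] by simp
  ultimately show ?thesis using prime_gt_0_nat[OF p] by (simp add: h'_def)
qed

section \<open>Large primes\<close>

lemma finite_primes_upto: "finite {p::nat. prime p \<and> real p \<le> x}"
  by (rule finite_subset[of _ "{..nat \<lfloor>x\<rfloor>}"]) (auto simp: le_nat_floor)

text \<open>
  If \<open>\<eta> > 0\<close>, the primes at which the form is below \<open>p powr (- \<eta>)\<close> contribute only a bounded amount
  to the sum in the orthogonality relation, so the remaining primes must be infinite in number.
\<close>

lemma orthogonal_infinitely_many_large: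
  fixes a :: "'n::finite \<Rightarrow> nat \<Rightarrow> complex" and z :: "'n \<Rightarrow> complex"
  assumes orth: "orthogonal_coeffs a" and z: "z i0 \<noteq> 0" and \<eta>: "\<eta> > 0"
  shows "infinite {p. prime p \<and> norm (\<Sum>j\<in>UNIV. a j p * cnj (z j)) > real p powr (- \<eta>)}" (is "infinite ?G")
proof
  assume fin: "finite ?G"
  define c where "c p = (\<Sum>j\<in>UNIV. a j p * cnj (z j))" for p
  obtain m :: "'n \<Rightarrow> 'n \<Rightarrow> real" where m: "\<And>i. m i i > 0" "\<And>i j. i \<noteq> j \<Longrightarrow> m i j = 0"
    "\<And>i j. ((\<lambda>x :: real. (\<Sum>p | prime p \<and> real p \<le> x. a i p * cnj (a j p) / of_nat p)
                              / of_real (ln (ln x))) \<longlongrightarrow> of_real (m i j)) at_top"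
    using orth unfolding orthogonal_coeffs_def by blast
  define S where "S x = (\<Sum>p | prime p \<and> real p \<le> x. (norm (c p))\<^sup>2 / real p)" for x
  define \<mu> where "\<mu> = (\<Sum>i\<in>UNIV. m i i * (norm (z i))\<^sup>2)"
  have mu: "\<mu> > 0"
    unfolding \<mu>_def
  proof (rule sum_pos2[of _ i0])
    show "0 < m i0 i0 * (norm (z i0))\<^sup>2" using z m(1)[of i0] by simp
    show "0 \<le> m i i * (norm (z i))\<^sup>2" for i using m(1)[of i] by simp
  qed auto
  have csq: "of_real ((norm (c p))\<^sup>2) = (\<Sum>i\<in>UNIV. \<Sum>j\<in>UNIV. cnj (z i) * z j * (a i p * cnj (a j p)))" for p
    unfolding complex_norm_square c_def cnj_sum sum_product by (simp add: mult_ac)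
  have Seq: "complex_of_real (S x / ln (ln x)) = (\<Sum>i\<in>UNIV. \<Sum>j\<in>UNIV. cnj (z i) * z j *
      ((\<Sum>p | prime p \<and> real p \<le> x. a i p * cnj (a j p) / of_nat p) / of_real (ln (ln x))))" for x
  proof -
    have "complex_of_real (S x) = (\<Sum>p | prime p \<and> real p \<le> x. \<Sum>i\<in>UNIV. \<Sum>j\<in>UNIV. cnj (z i) * z j * (a i p * cnj (a j p) / of_nat p))"
      unfolding S_def of_real_sum of_real_divide csq by (simp add: sum_divide_distrib)
    also have "\<dots> = (\<Sum>i\<in>UNIV. \<Sum>j\<in>UNIV. \<Sum>p | prime p \<and> real p \<le> x. cnj (z i) * z j * (a i p * cnj (a j p) / of_nat p))"
      by (subst sum.swap, intro sum.cong refl, rule sum.swap)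
    finally show ?thesis
      unfolding of_real_divide by (simp add: sum_distrib_left sum_divide_distrib)
  qed
  have "((\<lambda>x. complex_of_real (S x / ln (ln x))) \<longlongrightarrow> (\<Sum>i\<in>UNIV. \<Sum>j\<in>UNIV. cnj (z i) * z j * of_real (m i j))) at_top"
    unfolding Seq by (intro tendsto_sum tendsto_mult tendsto_const m(3))
  also have "(\<Sum>i\<in>UNIV. \<Sum>j\<in>UNIV. cnj (z i) * z j * of_real (m i j)) = of_real \<mu>"
  proof -
    have "(\<Sum>j\<in>UNIV. cnj (z i) * z j * of_real (m i j)) = of_real (m i i * (norm (z i))\<^sup>2)" for i
    proof -
      have "(\<Sum>j\<in>UNIV. cnj (z i) * z j * of_real (m i j)) = (\<Sum>j\<in>UNIV. if j = i then cnj (z i) * z i * of_real (m i i) else 0)"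
        by (intro sum.cong) (use m(2) in auto)
      then show ?thesis unfolding of_real_mult complex_norm_square by (simp add: mult_ac)
    qed
    then show ?thesis unfolding \<mu>_def by simp
  qed
  finally have limS: "((\<lambda>x. S x / ln (ln x)) \<longlongrightarrow> \<mu>) at_top"
    by (simp only: tendsto_of_real_iff)
  have sm: "summable (\<lambda>p. real p powr (- 1 - 2 * \<eta>))" using \<eta> by (simp add: summable_real_powr_iff)
  define T where "T = (\<Sum>p. real p powr (- 1 - 2 * \<eta>))"
  define K where "K = (\<Sum>p\<in>?G. (norm (c p))\<^sup>2 / real p) + T"
  have S_le: "\<bar>S x\<bar> \<le> K" for x
  proof -
    let ?P = "{p::nat. prime p \<and> real p \<le> x}"
    have fP: "finite ?P" by (rule finite_primes_upto)
    have "S x = (\<Sum>p\<in>?P \<inter> ?G. (norm (c p))\<^sup>2 / real p) + (\<Sum>p\<in>?P - ?G. (norm (c p))\<^sup>2 / real p)"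
      unfolding S_def by (subst sum.union_disjoint[symmetric]) (use fP in \<open>auto intro!: sum.cong\<close>)
    also have "\<dots> \<le> (\<Sum>p\<in>?G. (norm (c p))\<^sup>2 / real p) + (\<Sum>p\<in>?P - ?G. real p powr (- 1 - 2 * \<eta>))"
    proof (intro add_mono sum_mono2 sum_mono fin)
      fix p assume p: "p \<in> ?P - ?G"
      then have p0: "real p > 0" using prime_gt_0_nat by auto
      have "norm (c p) \<le> real p powr (- \<eta>)" using p by (auto simp: c_def)
      then have "(norm (c p))\<^sup>2 \<le> (real p powr (- \<eta>))\<^sup>2" by (intro power_mono) auto
      also have "\<dots> = real p powr (- 2 * \<eta>)" using p0 by (simp add: powr_power)
      finally have "(norm (c p))\<^sup>2 / real p \<le> real p powr (- 2 * \<eta>) / real p" by (intro divide_right_mono) auto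
      also have "\<dots> = real p powr (- 2 * \<eta> - 1)" using p0 by (simp add: powr_diff)
      also have "- 2 * \<eta> - 1 = - 1 - 2 * \<eta>" by simp
      finally show "(norm (c p))\<^sup>2 / real p \<le> real p powr (- 1 - 2 * \<eta>)" .
    qed auto
    also have "(\<Sum>p\<in>?P - ?G. real p powr (- 1 - 2 * \<eta>)) \<le> T"
      unfolding T_def by (rule sum_le_suminf[OF sm]) (use fP in auto)
    finally have "S x \<le> K" by (simp add: K_def)
    moreover have "S x \<ge> 0" unfolding S_def by (intro sum_nonneg) auto
    ultimately show ?thesis by simp
  qed
  have "filterlim (\<lambda>x::real. ln (ln x)) at_top at_top"
    by (rule filterlim_compose[OF ln_at_top ln_at_top])
  then have "((\<lambda>x::real. K / ln (ln x)) \<longlongrightarrow> 0) at_top"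
    by (rule tendsto_divide_0[OF tendsto_const filterlim_at_top_imp_at_infinity])
  then have "((\<lambda>x. S x / ln (ln x)) \<longlongrightarrow> 0) at_top"
  proof (rule Lim_null_comparison[rotated])
    have "eventually (\<lambda>x::real. ln (ln x) \<ge> 0) at_top"
      using \<open>filterlim (\<lambda>x::real. ln (ln x)) at_top at_top\<close> by (auto simp: filterlim_at_top)
    then show "eventually (\<lambda>x. norm (S x / ln (ln x)) \<le> K / ln (ln x)) at_top"
      by eventually_elim (use S_le in \<open>auto intro!: divide_right_mono\<close>)
  qed
  from tendsto_unique[OF _ limS this] mu show False by simp
qed

lemma nth_prime_surj: "prime p \<Longrightarrow> \<exists>m. p = nth_prime m"
  unfolding nth_prime_def using enumerate_Ex[of "{p::nat. prime p}" p] primes_infinite by auto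

text \<open>Compactness of the unit sphere makes the choice of large primes uniform in the direction.\<close>

lemma uniform_large_primes:
  fixes b :: "'n::finite \<Rightarrow> nat \<Rightarrow> complex"
  assumes inf: "\<And>z i. z i \<noteq> 0 \<Longrightarrow> infinite {p. prime p \<and> norm (\<Sum>j\<in>UNIV. b j p * cnj (z j)) > real p powr (- \<eta>)}"
  shows "\<exists>n. \<forall>y::complex^'n. y \<noteq> 0 \<longrightarrow> (\<exists>S\<subseteq>{m0..<n}. card S = M \<and>
    (\<forall>m\<in>S. norm (\<Sum>j\<in>UNIV. b j (nth_prime m) * cnj (y $ j)) \<ge> norm y * real (nth_prime m) powr (- \<eta>)))"
proof -
  define L where "L m y = norm (\<Sum>j\<in>UNIV. b j (nth_prime m) * cnj (y $ j))" for m and y :: "complex ^ 'n"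
  have cont: "continuous_on UNIV (L m)" for m
    unfolding L_def[abs_def] by (intro continuous_intros)
  have ex: "\<exists>S\<subseteq>{m0..}. finite S \<and> card S = M \<and> (\<forall>m\<in>S. L m y > real (nth_prime m) powr (- \<eta>))" if y: "y \<noteq> 0" for y
  proof -
    obtain i where "y $ i \<noteq> 0" using y by (auto simp: vec_eq_iff)
    from inf[of "\<lambda>j. y $ j", OF this]
    have "infinite {p. prime p \<and> norm (\<Sum>j\<in>UNIV. b j p * cnj (y $ j)) > real p powr (- \<eta>)}" .
    also have "{p. prime p \<and> norm (\<Sum>j\<in>UNIV. b j p * cnj (y $ j)) > real p powr (- \<eta>)} = nth_prime ` {m. L m y > real (nth_prime m) powr (- \<eta>)}"
    proof (intro equalityI subsetI)
      fix p assume p: "p \<in> {p. prime p \<and> norm (\<Sum>j\<in>UNIV. b j p * cnj (y $ j)) > real p powr (- \<eta>)}"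
      then obtain m where m: "p = nth_prime m" using nth_prime_surj by blast
      have "m \<in> {m. L m y > real (nth_prime m) powr (- \<eta>)}" using p unfolding m L_def by simp
      then show "p \<in> nth_prime ` {m. L m y > real (nth_prime m) powr (- \<eta>)}" unfolding m by (rule imageI)
    next
      fix p assume "p \<in> nth_prime ` {m. L m y > real (nth_prime m) powr (- \<eta>)}"
      then obtain m where m: "p = nth_prime m" "L m y > real (nth_prime m) powr (- \<eta>)" by (elim imageE CollectE)
      then show "p \<in> {p. prime p \<and> norm (\<Sum>j\<in>UNIV. b j p * cnj (y $ j)) > real p powr (- \<eta>)}"
        using nth_prime[of m] by (simp add: L_def)
    qed
    finally have "infinite {m. L m y > real (nth_prime m) powr (- \<eta>)}"
      using finite_imageI by blast
    then have "infinite ({m. L m y > real (nth_prime m) powr (- \<eta>)} - {..<m0})" by (rule Diff_infinite_finite[rotated]) simp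
    from infinite_arbitrarily_large[OF this, of M]
    obtain S where "finite S" "card S = M" "S \<subseteq> {m. L m y > real (nth_prime m) powr (- \<eta>)} - {..<m0}" by blast
    then show ?thesis by (intro exI[of _ S]) auto
  qed
  then obtain S where S: "\<And>y. y \<noteq> 0 \<Longrightarrow> S y \<subseteq> {m0..}" "\<And>y. y \<noteq> 0 \<Longrightarrow> finite (S y)" "\<And>y. y \<noteq> 0 \<Longrightarrow> card (S y) = M"
    "\<And>y m. y \<noteq> 0 \<Longrightarrow> m \<in> S y \<Longrightarrow> L m y > real (nth_prime m) powr (- \<eta>)"
    by metis
  \<comment> \<open>Directions in which the primes chosen for y still work; the strict inequality
    makes this set open.\<close>
  define U where "U y = (\<Inter>m\<in>S y. {x. L m x > real (nth_prime m) powr (- \<eta>)})" for y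
  let ?sph = "sphere (0::complex^'n) 1"
  have nz: "y \<noteq> 0" if "y \<in> ?sph" for y using that by auto
  have "open (U y)" if "y \<in> ?sph" for y
    unfolding U_def by (intro open_INT ballI S(2)[OF nz[OF that]] open_Collect_less cont continuous_on_const)
  moreover have "?sph \<subseteq> (\<Union>y\<in>?sph. U y)" using S(4)[OF nz] unfolding U_def by blast
  ultimately obtain Y where Y: "Y \<subseteq> ?sph" "finite Y" "?sph \<subseteq> (\<Union>y\<in>Y. U y)"
    using compactE_image[OF compact_sphere, of "?sph" U 0 1] by (metis compactE_image compact_sphere)
  have "finite (\<Union>y\<in>Y. S y)" using Y S(2)[OF nz] by auto
  then obtain n where n: "\<And>m. m \<in> (\<Union>y\<in>Y. S y) \<Longrightarrow> m < n"
    by (metis finite_nat_set_iff_bounded)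
  show ?thesis
  proof (intro exI[of _ n] allI impI)
    fix y :: "complex ^ 'n" assume y: "y \<noteq> 0"
    \<comment> \<open>Both sides of the inequality are homogeneous of degree one in y, so unit
      vectors suffice.\<close>
    define u where "u = y /\<^sub>R norm y"
    have "u \<in> ?sph" using y by (simp add: u_def)
    then obtain x where x: "x \<in> Y" "u \<in> U x" using Y(3) by blast
    have xs: "x \<noteq> 0" using x Y(1) nz by blast
    show "\<exists>S\<subseteq>{m0..<n}. card S = M \<and>
      (\<forall>m\<in>S. norm (\<Sum>j\<in>UNIV. b j (nth_prime m) * cnj (y $ j)) \<ge> norm y * real (nth_prime m) powr (- \<eta>))"
    proof (intro exI[of _ "S x"] conjI ballI)
      show "S x \<subseteq> {m0..<n}" using S(1)[OF xs] n x(1) by fastforce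
      show "card (S x) = M" by (rule S(3)[OF xs])
      fix m assume m: "m \<in> S x"
      have "real (nth_prime m) powr (- \<eta>) < L m u" using x(2) m by (auto simp: U_def)
      then have "norm y * real (nth_prime m) powr (- \<eta>) \<le> norm y * L m u" by (intro mult_left_mono) auto
      also have "norm y * L m u = L m y"
      proof -
        have "(\<Sum>j\<in>UNIV. b j (nth_prime m) * cnj (y $ j)) = of_real (norm y) * (\<Sum>j\<in>UNIV. b j (nth_prime m) * cnj (u $ j))"
          unfolding sum_distrib_left
        proof (intro sum.cong refl)
          fix j
          have "norm y *\<^sub>R (u $ j) = y $ j" using y by (simp add: u_def)
          then have "y $ j = of_real (norm y) * (u $ j)" by (simp only: scaleR_conv_of_real)
          then show "b j (nth_prime m) * cnj (y $ j) = of_real (norm y) * (b j (nth_prime m) * cnj (u $ j))" by simp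
        qed
        then show ?thesis unfolding L_def by (simp add: norm_mult)
      qed
      finally show "norm (\<Sum>j\<in>UNIV. b j (nth_prime m) * cnj (y $ j)) \<ge> norm y * real (nth_prime m) powr (- \<eta>)"
        by (simp add: L_def)
    qed
  qed
qed

section \<open>The main theorem\<close>

context euler_family
begin

definition law :: "real \<Rightarrow> ('n \<Rightarrow> complex) \<Rightarrow> nat \<Rightarrow> (complex ^ 'n) measure" where
  "law \<sigma> c n = distr (density (torus n) (\<lambda>t. ennreal ((norm (\<Sum>j\<in>UNIV. c j * logderiv_trunc (b j) n \<sigma> t))\<^sup>2)))
     borel (log_trunc_vec b n \<sigma>)"

text \<open>One order q at a time. The limit is recorded as a pointwise limit of densities so that
  the limits found for different orders can be identified afterwards.\<close>

definition bounded_densities :: "nat \<Rightarrow> real \<Rightarrow> nat \<Rightarrow> real \<Rightarrow> real \<Rightarrow> ('n \<Rightarrow> complex) \<Rightarrow> bool" where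
  "bounded_densities q \<alpha> n0 K \<sigma> c \<longleftrightarrow> (\<exists>G H.
      (\<forall>n\<ge>n0. continuous_density (law \<sigma> c n) (G n) \<and> C_k q (G n) \<and> partials_bounded q K \<alpha> (G n)) \<and>
      C_k q H \<and> partials_bounded q K \<alpha> H \<and> (\<forall>x. (\<lambda>n. G n x) \<longlonglongrightarrow> H x))"

definition smooth_limit :: "nat \<Rightarrow> real \<Rightarrow> nat \<Rightarrow> real \<Rightarrow> real \<Rightarrow> ('n \<Rightarrow> complex) \<Rightarrow> bool" where
  "smooth_limit q \<alpha> n0 K \<sigma> c \<longleftrightarrow>
      (\<forall>n\<ge>n0. \<exists>G. continuous_density (law \<sigma> c n) G \<and> C_k q G \<and> partials_bounded q K \<alpha> G) \<and>
      (\<exists>L G. weakly_converges (law \<sigma> c) L \<and> continuous_density L G \<and> (\<forall>k. C_k k G) \<and> partials_bounded q K \<alpha> G)"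

lemma partials_bounded_mono:
  "partials_bounded q K \<alpha> G \<Longrightarrow> K \<le> K' \<Longrightarrow> partials_bounded q K' \<alpha> G"
  unfolding partials_bounded_def by (meson exp_ge_zero mult_right_mono order_trans)

text \<open>The index \<open>n0\<close> must supply enough good primes in every direction and a
  small enough tail of squared steps. Neither depends on \<sigma>: the form at primes is built from
  \<open>b\<close> alone, and \<open>eps\<close> is uniform in \<sigma> \<ge> 1.\<close>

lemma uniform_density_bounds:
  assumes inf: "\<forall>z i \<eta>. z i \<noteq> 0 \<longrightarrow> \<eta> > 0 \<longrightarrow> infinite {p. prime p \<and> norm (\<Sum>j\<in>UNIV. b j p * cnj (z j)) > real p powr (- \<eta>)}"
    and \<alpha>: "\<alpha> > 0"
  shows "\<exists>n0\<ge>1. \<forall>\<sigma>\<^sub>0\<ge>1. \<exists>K>0. \<forall>\<sigma>\<in>{1..\<sigma>\<^sub>0}. \<forall>c. (\<Sum>j\<in>UNIV. norm (c j)) \<le> 2 \<longrightarrow> bounded_densities q \<alpha> n0 K \<sigma> c"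
proof -
  define \<eta> where "\<eta> = (1 - 2 * \<theta>) / 2"
  have \<eta>: "\<eta> > 0" using theta by (simp add: \<eta>_def)
  \<comment> \<open>Each power of 1 / (1 + |y|) takes two good primes and the weight spoils at most
    two more, hence the sets of size 2 N + 2 below.\<close>
  define N where "N = 2 * DIM(complex ^ 'n) + q"
  have "filterlim (\<lambda>m. real (nth_prime m) powr \<eta>) at_top sequentially"
  proof -
    have "filterlim (\<lambda>m::nat. real m powr \<eta>) at_top sequentially" using \<eta> by real_asymp
    moreover have "real m powr \<eta> \<le> real (nth_prime m) powr \<eta>" for m
      using nth_prime_ge[of m] \<eta> by (intro powr_mono2) auto
    ultimately show ?thesis by (rule filterlim_at_top_mono[OF _ always_eventually[OF allI]])
  qed
  then have "eventually (\<lambda>m. 4 * (C * real CARD('n)) * tail_const \<le> real (nth_prime m) powr \<eta>) sequentially"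
    by (simp add: filterlim_at_top)
  then obtain m0 where m0: "\<And>m. m \<ge> m0 \<Longrightarrow> 4 * (C * real CARD('n)) * tail_const \<le> real (nth_prime m) powr \<eta>"
    by (auto simp: eventually_sequentially)
  obtain n1 where n1: "\<forall>y::complex^'n. y \<noteq> 0 \<longrightarrow> (\<exists>S\<subseteq>{m0..<n1}. card S = 2 * N + 2 \<and>
    (\<forall>m\<in>S. norm (\<Sum>j\<in>UNIV. b j (nth_prime m) * cnj (y $ j)) \<ge> norm y * real (nth_prime m) powr (- \<eta>)))"
  proof -
    have "\<exists>n. \<forall>y::complex^'n. y \<noteq> 0 \<longrightarrow> (\<exists>S\<subseteq>{m0..<n}. card S = 2 * N + 2 \<and>
      (\<forall>m\<in>S. norm (\<Sum>j\<in>UNIV. b j (nth_prime m) * cnj (y $ j)) \<ge> norm y * real (nth_prime m) powr (- \<eta>)))"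
      by (rule uniform_large_primes) (rule inf[rule_format, OF _ \<eta>])
    then show thesis by (elim exE) (rule that)
  qed
  \<comment> \<open>The tail of squared steps that meets the hypothesis of
    \<open>density_bounds\<close> with equality.\<close>
  define \<delta> where "\<delta> = min 1 \<alpha> / (8 * (2 + 2 * \<alpha>)\<^sup>2)"
  have k0: "8 * (2 + 2 * \<alpha>)\<^sup>2 > 0" using \<alpha> by simp
  have \<delta>: "\<delta> > 0" using \<alpha> k0 by (simp add: \<delta>_def)
  obtain n2 where n2: "\<And>m n. m \<ge> n2 \<Longrightarrow> norm (\<Sum>k=m..<n. (eps k)\<^sup>2) < \<delta>"
    using eps_summable \<delta> unfolding summable_Cauchy by blast
  define n0 where "n0 = max 1 (max n1 n2)"
  have tail: "8 * (2 + 2 * \<alpha>)\<^sup>2 * (\<Sum>m\<in>{n0..<n}. (eps m)\<^sup>2) \<le> min 1 \<alpha>" for n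
  proof -
    have "(\<Sum>m\<in>{n0..<n}. (eps m)\<^sup>2) \<le> \<delta>" proof -
      have "n0 \<ge> n2" by (simp add: n0_def)
      from n2[OF this, of n] show ?thesis by simp
    qed
    then have "8 * (2 + 2 * \<alpha>)\<^sup>2 * (\<Sum>m\<in>{n0..<n}. (eps m)\<^sup>2) \<le> 8 * (2 + 2 * \<alpha>)\<^sup>2 * \<delta>"
      using k0 by (intro mult_left_mono) auto
    also have "\<dots> = min 1 \<alpha>" using k0 by (simp add: \<delta>_def)
    finally show ?thesis .
  qed
  show ?thesis
  proof (intro exI[of _ n0] conjI allI impI)
    show "1 \<le> n0" by (simp add: n0_def)
    fix \<sigma>\<^sub>0 :: real assume s0: "1 \<le> \<sigma>\<^sub>0"
    define R where "R = (\<Sum>m<n0. eps m)"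
    define e where "e = 1 + (\<Sum>m<n0. \<bar>eps m\<bar>)"
    \<comment> \<open>The oscillation bound grows with the prime and with \<sigma>; its value at
      \<open>n0\<close> and \<open>\<sigma>\<^sub>0\<close> covers all primes and all \<sigma> in
      question. This is how K comes to depend on \<open>\<sigma>\<^sub>0\<close>.\<close>
    define Q where "Q = max 1 (osc_const * real (nth_prime n0) powr ((\<eta> + \<sigma>\<^sub>0) / 2))"
    define D where "D = 2 * (real n0 + 1)\<^sup>2 * e ^ 4 * (2 * Q\<^sup>2) ^ N"
    define K where "K = D * decay_integral TYPE(complex ^ 'n) * exp (2 * \<alpha> * R\<^sup>2 + 1)"
    have e1: "e \<ge> 1" by (simp add: e_def sum_nonneg)
    have em: "eps m \<le> e" if "m < n0" for m
    proof -
      have "eps m \<le> \<bar>eps m\<bar>" by simp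
      also have "\<dots> \<le> (\<Sum>m<n0. \<bar>eps m\<bar>)" by (rule member_le_sum) (use that in auto)
      finally show ?thesis by (simp add: e_def)
    qed
    have D0: "D \<ge> 0" using e1 by (simp add: D_def)
    show "\<exists>K>0. \<forall>\<sigma>\<in>{1..\<sigma>\<^sub>0}. \<forall>c. (\<Sum>j\<in>UNIV. norm (c j)) \<le> 2 \<longrightarrow> bounded_densities q \<alpha> n0 K \<sigma> c"
    proof (intro exI[of _ "\<bar>K\<bar> + 1"] conjI ballI allI impI)
      show "\<bar>K\<bar> + 1 > 0" by simp
      have KK: "K \<le> \<bar>K\<bar> + 1" by simp
      fix \<sigma> and c :: "'n \<Rightarrow> complex" assume "\<sigma> \<in> {1..\<sigma>\<^sub>0}" and c: "(\<Sum>j\<in>UNIV. norm (c j)) \<le> 2"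
      then have \<sigma>: "1 \<le> \<sigma>" "\<sigma> \<le> \<sigma>\<^sub>0" by auto
      interpret random_walk "step \<sigma>" "weight \<sigma> c" eps by (rule walk[OF \<sigma>(1) c])
      have good: "\<exists>S\<subseteq>{..<n0}. card S = 2 * N + 2 \<and>
        (\<forall>m\<in>S. norm (\<integral>s. iexp (step \<sigma> m s \<bullet> y) \<partial>unit_interval) \<le> Q / sqrt (norm y))" if y: "norm y \<ge> Q\<^sup>2" for y
      proof -
        have "Q\<^sup>2 \<ge> 1" by (rule one_le_power) (simp add: Q_def)
        then have y0: "norm y > 0" using y by linarith
        then have "y \<noteq> 0" by auto
        from n1[THEN spec, THEN mp, OF this] obtain S where S: "S \<subseteq> {m0..<n1}" "card S = 2 * N + 2"
          "\<forall>m\<in>S. norm (\<Sum>j\<in>UNIV. b j (nth_prime m) * cnj (y $ j)) \<ge> norm y * real (nth_prime m) powr (- \<eta>)"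
          by (elim exE conjE)
        have "norm (\<integral>s. iexp (step \<sigma> m s \<bullet> y) \<partial>unit_interval) \<le> Q / sqrt (norm y)" if m: "m \<in> S" for m
        proof -
          have "n1 \<le> n0" by (simp add: n0_def)
          then have mm: "m \<ge> m0" "m \<le> n0" using subsetD[OF S(1) m] by auto
          have "norm (\<integral>s. iexp (step \<sigma> m s \<bullet> y) \<partial>unit_interval) \<le> osc_const * real (nth_prime m) powr ((\<eta> + \<sigma>) / 2) / sqrt (norm y)"
            by (rule step_oscillation[OF \<sigma>(1) \<eta>_def m0[OF mm(1)] y0 bspec[OF S(3) m]])
          also have "\<dots> \<le> Q / sqrt (norm y)"
          proof (rule divide_right_mono)
            have "real (nth_prime m) powr ((\<eta> + \<sigma>) / 2) \<le> real (nth_prime n0) powr ((\<eta> + \<sigma>) / 2)"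
              using nth_prime_mono[OF mm(2)] \<eta> \<sigma> by (intro powr_mono2) auto
            also have "\<dots> \<le> real (nth_prime n0) powr ((\<eta> + \<sigma>\<^sub>0) / 2)"
              using nth_prime_real[of n0] \<sigma> by (intro powr_mono) auto
            finally have "osc_const * real (nth_prime m) powr ((\<eta> + \<sigma>) / 2) \<le> osc_const * real (nth_prime n0) powr ((\<eta> + \<sigma>\<^sub>0) / 2)"
              using osc_const_ge_1 by (intro mult_left_mono) auto
            then show "osc_const * real (nth_prime m) powr ((\<eta> + \<sigma>) / 2) \<le> Q" by (simp add: Q_def)
          qed simp
          finally show ?thesis .
        qed
        moreover have "S \<subseteq> {..<n0}"
        proof -
          have "n1 \<le> n0" by (simp add: n0_def)
          then have "{m0..<n1} \<subseteq> {..<n0}" by auto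
          with S(1) show ?thesis by (rule subset_trans)
        qed
        ultimately show ?thesis using S(2) by blast
      qed
      interpret smooth_walk "step \<sigma>" "weight \<sigma> c" eps q n0 D
      proof
        show "norm (wchar n0 B y) \<le> D * (1 + (norm B)\<^sup>2) / (1 + norm y) ^ (2 * DIM(complex ^ 'n) + q)" for B y
          unfolding D_def N_def[symmetric]
          by (rule wchar_base_bound[OF _ e1 em good]) (auto simp: Q_def)
      qed (rule D0)
      note db = density_bounds[OF order_refl \<alpha> tail, folded R_def, folded K_def]
      have law: "law \<sigma> c n = weighted_law n 0" for n
        unfolding law_def by (rule weighted_law_eq[OF \<sigma>(1) c, symmetric])
      show "bounded_densities q \<alpha> n0 (\<bar>K\<bar> + 1) \<sigma> c"
        unfolding bounded_densities_def
      proof (intro exI[of _ "\<lambda>n. inv_ft (wchar n 0)"] exI[of _ "inv_ft wchar_lim"] conjI allI impI)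
        fix n assume n: "n0 \<le> n"
        have e: "wdens n [] 0 = inv_ft (wchar n 0)" by (simp add: wdens_def)
        show "continuous_density (law \<sigma> c n) (inv_ft (wchar n 0))" "C_k q (inv_ft (wchar n 0))"
          using wdens_density(1,2)[OF n, of 0] unfolding e law by auto
        show "partials_bounded q (\<bar>K\<bar> + 1) \<alpha> (inv_ft (wchar n 0))"
          by (rule partials_bounded_mono[OF db(1)[OF n] KK])
      next
        show "C_k q (inv_ft wchar_lim)" by (rule db(2))
        show "partials_bounded q (\<bar>K\<bar> + 1) \<alpha> (inv_ft wchar_lim)" by (rule partials_bounded_mono[OF db(3) KK])
        show "(\<lambda>n. inv_ft (wchar n 0) x) \<longlonglongrightarrow> inv_ft wchar_lim x" for x by (rule db(4))
      qed
    qed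
  qed
qed

text \<open>Each order k has its own starting index and its own limit. For large n the densities
  coincide, since a continuous density is unique, so all these limits are the same function and it
  is smooth of every order.\<close>

lemma bounded_densities_limit:
  assumes b: "bounded_densities q \<alpha> n0 K \<sigma> c" and bk: "\<And>k. \<exists>n' K'. bounded_densities k \<alpha> n' K' \<sigma> c" and \<alpha>: "\<alpha> > 0"
  shows "smooth_limit q \<alpha> n0 K \<sigma> c"
proof -
  from b[unfolded bounded_densities_def] obtain G H where
    G: "\<forall>n\<ge>n0. continuous_density (law \<sigma> c n) (G n) \<and> C_k q (G n) \<and> partials_bounded q K \<alpha> (G n)"
    and H: "C_k q H" "partials_bounded q K \<alpha> H" and lim: "\<forall>x. (\<lambda>n. G n x) \<longlonglongrightarrow> H x"
    by (elim exE conjE)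
  have gb: "\<bar>G n x\<bar> \<le> K * exp (- \<alpha> * (norm x)\<^sup>2)" if "n \<ge> n0" for n x
  proof -
    have "partials_bounded q K \<alpha> (G n)" using G that by blast
    from this[unfolded partials_bounded_def, rule_format, of "[]" x] show ?thesis by simp
  qed
  have Gd: "continuous_density (law \<sigma> c n) (G n)" if "n \<ge> n0" for n using G that by blast
  have smooth: "C_k k H" for k
  proof -
    obtain n' K' where "bounded_densities k \<alpha> n' K' \<sigma> c" using bk by blast
    from this[unfolded bounded_densities_def] obtain G' H' where
      G': "\<forall>n\<ge>n'. continuous_density (law \<sigma> c n) (G' n) \<and> C_k k (G' n) \<and> partials_bounded k K' \<alpha> (G' n)"
      and H': "C_k k H'" and lim': "\<forall>x. (\<lambda>n. G' n x) \<longlonglongrightarrow> H' x"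
      by (elim exE conjE)
    have eq: "G' n = G n" if "n \<ge> max n0 n'" for n
    proof (rule continuous_density_unique)
      show "continuous_density (law \<sigma> c n) (G' n)" using G' that by simp
      show "continuous_density (law \<sigma> c n) (G n)" using Gd that by simp
    qed
    have "H x = H' x" for x
    proof (rule LIMSEQ_unique[OF spec[OF lim]])
      have "eventually (\<lambda>n. G' n x = G n x) sequentially"
        using eq by (intro eventually_sequentiallyI[of "max n0 n'"]) simp
      then show "(\<lambda>n. G n x) \<longlonglongrightarrow> H' x" by (rule Lim_transform_eventually[OF spec[OF lim']])
    qed
    then have "H = H'" by (rule ext)
    with H' show ?thesis by simp
  qed
  show ?thesis
    unfolding smooth_limit_def
  proof (intro conjI allI impI)
    show "\<exists>G. continuous_density (law \<sigma> c n) G \<and> C_k q G \<and> partials_bounded q K \<alpha> G" if "n \<ge> n0" for n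
      using G that by blast
    show "\<exists>L G. weakly_converges (law \<sigma> c) L \<and> continuous_density L G \<and> (\<forall>k. C_k k G) \<and> partials_bounded q K \<alpha> G"
    proof (rule exI[of _ "density lborel (\<lambda>x. ennreal (H x))"], rule exI[of _ H], intro conjI allI)
      show "weakly_converges (law \<sigma> c) (density lborel (\<lambda>x. ennreal (H x)))"
        by (rule weakly_converges_densities(1)[OF Gd C_k_imp_continuous[OF H(1)] spec[OF lim] gb \<alpha>])
      show "continuous_density (density lborel (\<lambda>x. ennreal (H x))) H"
        by (rule weakly_converges_densities(2)[OF Gd C_k_imp_continuous[OF H(1)] spec[OF lim] gb \<alpha>])
    qed (use smooth H(2) in auto)
  qed
qed

lemma uniform_smooth_limit:
  assumes inf: "\<forall>z i \<eta>. z i \<noteq> 0 \<longrightarrow> \<eta> > 0 \<longrightarrow> infinite {p. prime p \<and> norm (\<Sum>j\<in>UNIV. b j p * cnj (z j)) > real p powr (- \<eta>)}"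
    and \<alpha>: "\<alpha> > 0"
  shows "\<exists>n0\<ge>1. \<forall>\<sigma>\<^sub>0\<ge>1. \<exists>K>0. \<forall>\<sigma>\<in>{1..\<sigma>\<^sub>0}. \<forall>c. (\<Sum>j\<in>UNIV. norm (c j)) \<le> 2 \<longrightarrow> smooth_limit q \<alpha> n0 K \<sigma> c"
proof -
  note U = uniform_density_bounds[OF inf \<alpha>]
  have bk: "\<exists>n' K'. bounded_densities k \<alpha> n' K' \<sigma> c"
    if "1 \<le> \<sigma>" "(\<Sum>j\<in>UNIV. norm (c j)) \<le> 2" for k \<sigma> c
  proof -
    obtain n' where "\<forall>\<sigma>\<^sub>0\<ge>1. \<exists>K>0. \<forall>\<sigma>\<in>{1..\<sigma>\<^sub>0}. \<forall>c. (\<Sum>j\<in>UNIV. norm (c j)) \<le> 2 \<longrightarrow> bounded_densities k \<alpha> n' K \<sigma> c"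
      using U[of k] by (elim exE conjE)
    then have "\<exists>K>0. \<forall>\<sigma>\<in>{1..\<sigma>}. \<forall>c. (\<Sum>j\<in>UNIV. norm (c j)) \<le> 2 \<longrightarrow> bounded_densities k \<alpha> n' K \<sigma> c"
      using that(1) by blast
    then obtain K where K: "\<forall>\<sigma>\<in>{1..\<sigma>}. \<forall>c. (\<Sum>j\<in>UNIV. norm (c j)) \<le> 2 \<longrightarrow> bounded_densities k \<alpha> n' K \<sigma> c"
      by (elim exE conjE)
    have "\<sigma> \<in> {1..\<sigma>}" using that(1) by simp
    with K that(2) have "bounded_densities k \<alpha> n' K \<sigma> c" by blast
    then show ?thesis by blast
  qed
  obtain n0 where n0: "n0 \<ge> 1" and b0: "\<forall>\<sigma>\<^sub>0\<ge>1. \<exists>K>0. \<forall>\<sigma>\<in>{1..\<sigma>\<^sub>0}. \<forall>c. (\<Sum>j\<in>UNIV. norm (c j)) \<le> 2 \<longrightarrow> bounded_densities q \<alpha> n0 K \<sigma> c"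
    using U[of q] by (elim exE conjE)
  show ?thesis
  proof (intro exI[of _ n0] conjI allI impI n0)
    fix \<sigma>\<^sub>0 :: real assume "1 \<le> \<sigma>\<^sub>0"
    with b0 have "\<exists>K>0. \<forall>\<sigma>\<in>{1..\<sigma>\<^sub>0}. \<forall>c. (\<Sum>j\<in>UNIV. norm (c j)) \<le> 2 \<longrightarrow> bounded_densities q \<alpha> n0 K \<sigma> c" by blast
    then obtain K where K: "K > 0" and b1: "\<forall>\<sigma>\<in>{1..\<sigma>\<^sub>0}. \<forall>c. (\<Sum>j\<in>UNIV. norm (c j)) \<le> 2 \<longrightarrow> bounded_densities q \<alpha> n0 K \<sigma> c"
      by (elim exE conjE)
    have "smooth_limit q \<alpha> n0 K \<sigma> c" if "\<sigma> \<in> {1..\<sigma>\<^sub>0}" "(\<Sum>j\<in>UNIV. norm (c j)) \<le> 2" for \<sigma> c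
    proof (rule bounded_densities_limit[OF _ _ \<alpha>])
      show "bounded_densities q \<alpha> n0 K \<sigma> c" using b1 that by blast
      show "\<exists>n' K'. bounded_densities k \<alpha> n' K' \<sigma> c" for k using bk that by simp
    qed
    with K show "\<exists>K>0. \<forall>\<sigma>\<in>{1..\<sigma>\<^sub>0}. \<forall>c. (\<Sum>j\<in>UNIV. norm (c j)) \<le> 2 \<longrightarrow> smooth_limit q \<alpha> n0 K \<sigma> c"
      by blast
  qed
qed

lemma lambda_single_law: "lambda_single b \<sigma> n j = law \<sigma> (\<lambda>i. if i = j then 1 else 0) n"
  unfolding lambda_single_def law_def by (simp add: if_distrib[of "\<lambda>x. x * _"] cong: if_cong)

lemma lambda_pair_law:
  assumes "j \<noteq> l"
  shows "lambda_pair b \<sigma> n j l \<tau> = law \<sigma> (\<lambda>i. if i = j then 1 else if i = l then \<tau> else 0) n"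
proof -
  have "(\<Sum>i\<in>UNIV. (if i = j then 1 else if i = l then \<tau> else 0) * logderiv_trunc (b i) n \<sigma> t)
    = (\<Sum>i\<in>UNIV. (if i = j then logderiv_trunc (b j) n \<sigma> t else 0) + (if i = l then \<tau> * logderiv_trunc (b l) n \<sigma> t else 0))" for t
    using assms by (intro sum.cong) auto
  then show ?thesis
    unfolding lambda_pair_def law_def by (simp add: sum.distrib)
qed

end

lemma euler_family_exists:
  fixes b :: "'n::finite \<Rightarrow> nat \<Rightarrow> complex"
  assumes "\<And>j. abs_conv_euler_log (b j) (F j)"
  obtains C \<theta> where "euler_family b C \<theta>"
proof -
  have "\<forall>j. \<exists>\<theta> C :: real. \<theta> < 1 / 2 \<and> (\<forall>p k. prime p \<longrightarrow> k \<ge> 1 \<longrightarrow> norm (b j (p ^ k)) \<le> C * real p powr (real k * \<theta>))"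
    using assms unfolding abs_conv_euler_log_def by blast
  then obtain th Cs where th: "\<And>j. th j < 1 / 2"
    and bd: "\<And>j p k. prime p \<Longrightarrow> k \<ge> 1 \<Longrightarrow> norm (b j (p ^ k)) \<le> Cs j * real p powr (real k * th j)"
    by metis
  \<comment> \<open>Finitely many functions share a maximal exponent; inserting 0 secures \<theta>
    \<ge> 0.\<close>
  define \<theta> where "\<theta> = Max (insert 0 (range th))"
  define C where "C = (\<Sum>j\<in>UNIV. \<bar>Cs j\<bar>)"
  have t0: "\<theta> \<ge> 0" "th j \<le> \<theta>" for j unfolding \<theta>_def by (rule Max_ge; simp)+
  have t1: "\<theta> < 1 / 2" unfolding \<theta>_def by (subst Max_less_iff) (use th in auto)
  have "euler_family b C \<theta>"
  proof
    fix j p and k :: nat assume p: "prime (p::nat)" and k: "k \<ge> 1"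
    have "real p \<ge> 1" using prime_ge_1_nat[OF p] by simp
    have "norm (b j (p ^ k)) \<le> Cs j * real p powr (real k * th j)" by (rule bd[OF p k])
    also have "\<dots> \<le> \<bar>Cs j\<bar> * real p powr (real k * th j)" by (intro mult_right_mono) auto
    also have "\<dots> \<le> C * real p powr (real k * \<theta>)"
    proof (rule mult_mono)
      show "\<bar>Cs j\<bar> \<le> C" unfolding C_def by (rule member_le_sum) auto
      show "real p powr (real k * th j) \<le> real p powr (real k * \<theta>)"
        using \<open>real p \<ge> 1\<close> t0(2)[of j] by (intro powr_mono mult_left_mono) auto
    qed (auto simp: C_def sum_nonneg)
    finally show "norm (b j (p ^ k)) \<le> C * real p powr (real k * \<theta>)" .
  qed (use t0 t1 in \<open>auto simp: C_def sum_nonneg\<close>)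
  then show thesis by (rule that)
qed

theorem theorem11:
  fixes F :: "'n::finite \<Rightarrow> complex \<Rightarrow> complex"
    and a b :: "'n \<Rightarrow> nat \<Rightarrow> complex"
    and \<alpha> :: real and q :: nat
  assumes "\<And>j. abs_conv_dirichlet (a j) (F j)"
    and "\<And>j. abs_conv_euler_log (b j) (F j)"
    and "orthogonal_coeffs a"
    and "\<alpha> > 0"
  shows "\<exists>n\<^sub>q\<ge>1. \<forall>\<sigma>\<^sub>0\<ge>1. \<exists>K>0. \<forall>\<sigma>\<in>{1..\<sigma>\<^sub>0}.
    (\<forall>j. \<forall>n\<ge>n\<^sub>q. \<exists>G. continuous_density (lambda_single b \<sigma> n j) G \<and>
        C_k q G \<and> partials_bounded q K \<alpha> G) \<and>
    (\<forall>j l \<tau>. j \<noteq> l \<and> \<tau> \<in> {1, -1, \<i>, -\<i>} \<longrightarrow>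
        (\<forall>n\<ge>n\<^sub>q. \<exists>G. continuous_density (lambda_pair b \<sigma> n j l \<tau>) G \<and>
           C_k q G \<and> partials_bounded q K \<alpha> G)) \<and>
    (\<forall>j. \<exists>L G. weakly_converges (\<lambda>n. lambda_single b \<sigma> n j) L \<and> continuous_density L G \<and>
        (\<forall>k. C_k k G) \<and> partials_bounded q K \<alpha> G) \<and>
    (\<forall>j l \<tau>. j \<noteq> l \<and> \<tau> \<in> {1, -1, \<i>, -\<i>} \<longrightarrow>
        (\<exists>L G. weakly_converges (\<lambda>n. lambda_pair b \<sigma> n j l \<tau>) L \<and> continuous_density L G \<and>
           (\<forall>k. C_k k G) \<and> partials_bounded q K \<alpha> G))"
proof -
  obtain C \<theta> where "euler_family b C \<theta>" using euler_family_exists[of b F] assms(2) by blast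
  then interpret euler_family b C \<theta> .
  \<comment> \<open>\<open>prime_coefficient\<close> carries the consequence of orthogonality over
    from \<open>a\<close> to \<open>b\<close>.\<close>
  have large: "infinite {p. prime p \<and> norm (\<Sum>j\<in>UNIV. b j p * cnj (z j)) > real p powr (- \<eta>)}"
    if "z i \<noteq> 0" "\<eta> > 0" for z i \<eta>
  proof -
    have "{p. prime p \<and> norm (\<Sum>j\<in>UNIV. b j p * cnj (z j)) > real p powr (- \<eta>)}
      = {p. prime p \<and> norm (\<Sum>j\<in>UNIV. a j p * cnj (z j)) > real p powr (- \<eta>)}"
      using prime_coefficient[OF assms(1,2)] by (auto intro!: Collect_cong)
    then show ?thesis using orthogonal_infinitely_many_large[where z = z and ?i0.0 = i, OF assms(3) that] by simp
  qed
  then have inf: "\<forall>z i \<eta>. z i \<noteq> 0 \<longrightarrow> \<eta> > 0 \<longrightarrow> infinite {p. prime p \<and> norm (\<Sum>j\<in>UNIV. b j p * cnj (z j)) > real p powr (- \<eta>)}"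
    by (intro allI impI)
  have c1: "(\<Sum>i\<in>UNIV. norm (if i = j then 1 else 0 :: complex)) \<le> 2" for j :: 'n
    by (simp add: if_distrib[of norm] cong: if_cong)
  have c2: "(\<Sum>i\<in>UNIV. norm (if i = j then 1 else if i = l then \<tau> else 0 :: complex)) \<le> 2"
    if "j \<noteq> l" "\<tau> \<in> {1, -1, \<i>, -\<i>}" for j l :: 'n and \<tau>
  proof -
    have "norm \<tau> = 1" using that by auto
    then have "(\<Sum>i\<in>UNIV. norm (if i = j then 1 else if i = l then \<tau> else 0 :: complex)) = (\<Sum>i\<in>UNIV. (if i = j then 1 else 0) + (if i = l then 1 else 0))"
      using that by (intro sum.cong) auto
    also have "\<dots> = 2" by (simp add: sum.distrib)
    finally show ?thesis by simp
  qed
  obtain n0 where n0: "n0 \<ge> 1" and B: "\<forall>\<sigma>\<^sub>0\<ge>1. \<exists>K>0. \<forall>\<sigma>\<in>{1..\<sigma>\<^sub>0}. \<forall>c. (\<Sum>j\<in>UNIV. norm (c j)) \<le> 2 \<longrightarrow>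
      smooth_limit q \<alpha> n0 K \<sigma> c"
    using uniform_smooth_limit[OF inf assms(4), of q] by (elim exE conjE)
  show ?thesis
  proof (intro exI[of _ n0] conjI[OF n0] allI impI)
    fix \<sigma>\<^sub>0 :: real assume "1 \<le> \<sigma>\<^sub>0"
    with B have "\<exists>K>0. \<forall>\<sigma>\<in>{1..\<sigma>\<^sub>0}. \<forall>c. (\<Sum>j\<in>UNIV. norm (c j)) \<le> 2 \<longrightarrow> smooth_limit q \<alpha> n0 K \<sigma> c" by blast
    then obtain K where K: "K > 0" and BK: "\<forall>\<sigma>\<in>{1..\<sigma>\<^sub>0}. \<forall>c. (\<Sum>j\<in>UNIV. norm (c j)) \<le> 2 \<longrightarrow> smooth_limit q \<alpha> n0 K \<sigma> c"
      by (elim exE conjE)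
    show "\<exists>K>0. \<forall>\<sigma>\<in>{1..\<sigma>\<^sub>0}.
      (\<forall>j. \<forall>n\<ge>n0. \<exists>G. continuous_density (lambda_single b \<sigma> n j) G \<and> C_k q G \<and> partials_bounded q K \<alpha> G) \<and>
      (\<forall>j l \<tau>. j \<noteq> l \<and> \<tau> \<in> {1, -1, \<i>, -\<i>} \<longrightarrow>
        (\<forall>n\<ge>n0. \<exists>G. continuous_density (lambda_pair b \<sigma> n j l \<tau>) G \<and> C_k q G \<and> partials_bounded q K \<alpha> G)) \<and>
      (\<forall>j. \<exists>L G. weakly_converges (\<lambda>n. lambda_single b \<sigma> n j) L \<and> continuous_density L G \<and>
        (\<forall>k. C_k k G) \<and> partials_bounded q K \<alpha> G) \<and>
      (\<forall>j l \<tau>. j \<noteq> l \<and> \<tau> \<in> {1, -1, \<i>, -\<i>} \<longrightarrow>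
        (\<exists>L G. weakly_converges (\<lambda>n. lambda_pair b \<sigma> n j l \<tau>) L \<and> continuous_density L G \<and>
           (\<forall>k. C_k k G) \<and> partials_bounded q K \<alpha> G))"
    proof (rule exI[of _ K], rule conjI[OF K], rule ballI)
      fix \<sigma> assume "\<sigma> \<in> {1..\<sigma>\<^sub>0}"
      then have BS: "smooth_limit q \<alpha> n0 K \<sigma> c" if "(\<Sum>j\<in>UNIV. norm (c j)) \<le> 2" for c using BK that by blast
      have "\<exists>G. continuous_density (lambda_single b \<sigma> n j) G \<and> C_k q G \<and> partials_bounded q K \<alpha> G" if "n \<ge> n0" for n j
        unfolding lambda_single_law using BS[OF c1, unfolded smooth_limit_def] that by blast
      moreover have "\<exists>L G. weakly_converges (\<lambda>n. lambda_single b \<sigma> n j) L \<and> continuous_density L G \<and>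
        (\<forall>k. C_k k G) \<and> partials_bounded q K \<alpha> G" for j
        unfolding lambda_single_law using BS[OF c1, unfolded smooth_limit_def] by blast
      moreover have "\<exists>G. continuous_density (lambda_pair b \<sigma> n j l \<tau>) G \<and> C_k q G \<and> partials_bounded q K \<alpha> G"
        if "j \<noteq> l \<and> \<tau> \<in> {1, -1, \<i>, -\<i>}" "n \<ge> n0" for n j l \<tau>
        unfolding lambda_pair_law[OF conjunct1[OF that(1)]] using BS[OF c2[OF conjunct1[OF that(1)] conjunct2[OF that(1)]], unfolded smooth_limit_def] that(2) by blast
      moreover have "\<exists>L G. weakly_converges (\<lambda>n. lambda_pair b \<sigma> n j l \<tau>) L \<and> continuous_density L G \<and>
        (\<forall>k. C_k k G) \<and> partials_bounded q K \<alpha> G" if "j \<noteq> l \<and> \<tau> \<in> {1, -1, \<i>, -\<i>}" for j l \<tau>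
        unfolding lambda_pair_law[OF conjunct1[OF that]] using BS[OF c2[OF conjunct1[OF that] conjunct2[OF that]], unfolded smooth_limit_def] by blast
      ultimately show "(\<forall>j. \<forall>n\<ge>n0. \<exists>G. continuous_density (lambda_single b \<sigma> n j) G \<and> C_k q G \<and> partials_bounded q K \<alpha> G) \<and>
      (\<forall>j l \<tau>. j \<noteq> l \<and> \<tau> \<in> {1, -1, \<i>, -\<i>} \<longrightarrow>
        (\<forall>n\<ge>n0. \<exists>G. continuous_density (lambda_pair b \<sigma> n j l \<tau>) G \<and> C_k q G \<and> partials_bounded q K \<alpha> G)) \<and>
      (\<forall>j. \<exists>L G. weakly_converges (\<lambda>n. lambda_single b \<sigma> n j) L \<and> continuous_density L G \<and>
        (\<forall>k. C_k k G) \<and> partials_bounded q K \<alpha> G) \<and>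
      (\<forall>j l \<tau>. j \<noteq> l \<and> \<tau> \<in> {1, -1, \<i>, -\<i>} \<longrightarrow>
        (\<exists>L G. weakly_converges (\<lambda>n. lambda_pair b \<sigma> n j l \<tau>) L \<and> continuous_density L G \<and>
           (\<forall>k. C_k k G) \<and> partials_bounded q K \<alpha> G))"
        by (intro conjI allI impI)
    qed
  qed
qed

end
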